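(* (i) Suppose that a curve $\Gamma$ and a function $\psi$, together with $\mu\in\mathbb{R}$, form a regular solution of the solitary wave problem on deep water, with fluid domain $\Omega$ below $\Gamma$. Let $-\phi$ be a harmonic conjugate of $\psi$ (so that $\phi+i\psi$ is holomorphic in $X+iY\in\Omega$), and let $w(x)=\mathrm{Im}\,(\phi+i\psi)^{-1}(x+i0)$ for $x\in\mathbb{R}$. If $w\in H^1(\mathbb{R})\cap C^{1+\alpha}(\mathbb{R})$ for some $\alpha\in(0,1)$, then $w$ satisfies $$\mathcal{H}w'=\mu\bigl(w+w\,\mathcal{H}w'+\mathcal{H}(ww')\bigr)\quad\text{on }\mathbb{R},\qquad ( * )$$ and in addition: $\phi+i\psi$ is a conformal bijection from $\overline{\Omega}$ onto $\overline{\mathbb{P}}$ which maps $\infty$ to $\infty$; $$(1-2\mu w)\bigl((1+\mathcal{H}w')^2+(w')^2\bigr)=1\quad\text{on }\mathbb{R};$$ and $\inf_{x\in\mathbb{R}}(1+\mathcal{H}w'(x))>0$. (ii) Conversely, suppose that $w\in H^1(\mathbb{R})\cap C^{1+\alpha}(\mathbb{R})$, $\alpha\in(0,1)$, satisfies $( * )$ for some $\mu\in\mathbb{R}$ and $\inf_{x\in\mathbb{R}}(1+\mathcal{H}w'(x))>0$. Let $\Gamma=\{(x+\mathcal{H}w(x),w(x)):x\in\mathbb{R}\}$ and let $\Omega$ be the open domain below $\Gamma$. Then there exists a conformal bijection $\Phi:\Omega\to\mathbb{P}$ such that $\Gamma$, $\mathrm{Im}\,\Phi$ (extended continuously to $\overline{\Omega}$)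 and $\mu$ form a regular solution of the solitary wave problem on deep water.
   Context: $'=d/dx$. The Hilbert transform is $\mathcal{H}v(x)=\frac1\pi\,PV\int_{-\infty}^\infty\frac{v(t)}{x-t}\,dt$ (principal value), equivalently $\widehat{\mathcal{H}v}(\xi)=-i\,\mathrm{sgn}(\xi)\hat v(\xi)$. $\mathbb{P}=\{x+iy\in\mathbb{C}:y<0\}$ is the open lower half plane; $\mathbb{R}^2$ is identified with $\mathbb{C}$ via $(X,Y)\leftrightarrow X+iY$. $C^{1+\alpha}(\mathbb{R})$ is the H\"older space of $C^1$ functions $v$ with $\sup|v|+\sup|v'|+\sup_{x}\sup_{|x-t|\le1}|v'(x)-v'(t)|/|x-t|^\alpha<\infty$. The solitary wave problem on deep water: find a parametric curve $\Gamma=\{(u(x),v(x)):x\in\mathbb{R}\}$, a parameter $\mu\in\mathbb{R}$ and a function $\psi$ on $\overline{\Omega}$, where $\Omega$ is the open region of the $(X,Y)$-plane below $\Gamma$, such that (a) $x\mapsto(u(x),v(x))$ is continuously differentiable; (b) $u'(x)>0$ and $u'(x)^2+v'(x)^2<\infty$ for every $x\in\mathbb{R}$; (c) $(u(x)-x,v(x))\to0$ as $|x|\to\infty$; (d) $\psi\in C^1(\overline{\Omega})\cap C^2(\Omega)$ and $\psi$ is harmonic in $\Omega$; (e) $\psi=0$ on $\Gamma$; (f) $\psi(X,Y)-Y\to0$ as $|(X,Y)|\to\infty$; (g) $\lim_{(X,Y)\to(u(x),v(x))}|\nabla\psi(X,Y)|^2+2\mu v(x)=1$ for every $x\in\mathbb{R}$.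 A solution triple $\Gamma,\mu,\psi$ is called regular if $|\nabla\psi|>0$ on $\Gamma$. *)

theory Defs
  imports "HOL-Complex_Analysis.Complex_Analysis"
begin

section \<open>Functions on the real line\<close>

text \<open>
  For every \<open>v\<close> in \<open>L\<^sup>p\<close> with \<open>1 \<le> p < \<infinity>\<close> the truncated integral converges absolutely, and if \<open>v\<close> is in
  addition locally Hoelder continuous, the limit exists at every \<open>x\<close>; at other functions the value
  is not meaningful.
\<close>
definition hilbert :: "(real \<Rightarrow> real) \<Rightarrow> real \<Rightarrow> real" where
  "hilbert v x =
     1 / pi * Lim (at_right 0) (\<lambda>\<epsilon>. LINT t : {t. \<bar>x - t\<bar> > \<epsilon>} | lborel. v t / (x - t))"

definition square_integrable :: "(real \<Rightarrow> real) \<Rightarrow> bool" where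
  "square_integrable f \<longleftrightarrow>
     f \<in> borel_measurable lborel \<and> integrable lborel (\<lambda>x. (f x)\<^sup>2)"

text \<open>
  The Sobolev space \<open>H\<^sup>1 = W\<^sup>1\<^sup>,\<^sup>2\<close>, defined by weak derivatives. As in Brezis' textbook the test
  functions are the compactly supported \<open>C\<^sup>1\<close> functions.
\<close>
definition H1 :: "(real \<Rightarrow> real) set" where
  "H1 = {w. square_integrable w \<and>
     (\<exists>g. square_integrable g \<and>
       (\<forall>\<eta>::real \<Rightarrow> real. \<eta> C1_differentiable_on UNIV \<and> compact (closure {x. \<eta> x \<noteq> 0}) \<longrightarrow>
          (LINT x | lborel. w x * deriv \<eta> x) = - (LINT x | lborel. g x * \<eta> x)))}"

definition C1_holder :: "real \<Rightarrow> (real \<Rightarrow> real) set" where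
  "C1_holder \<alpha> = {v. v C1_differentiable_on UNIV \<and>
     bdd_above (range (\<lambda>x. \<bar>v x\<bar>)) \<and>
     bdd_above (range (\<lambda>x. \<bar>deriv v x\<bar>)) \<and>
     bdd_above {\<bar>deriv v x - deriv v t\<bar> / \<bar>x - t\<bar> powr \<alpha> | x t. x \<noteq> t \<and> \<bar>x - t\<bar> \<le> 1}}"

section \<open>Functions on planar domains\<close>

text \<open>The plane is identified with \<^typ>\<open>complex\<close>; gradients are complex numbers.\<close>

definition dX :: "(complex \<Rightarrow> real) \<Rightarrow> complex \<Rightarrow> real" where
  "dX f z = frechet_derivative f (at z) 1"

definition dY :: "(complex \<Rightarrow> real) \<Rightarrow> complex \<Rightarrow> real" where
  "dY f z = frechet_derivative f (at z) \<i>"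

definition grad :: "(complex \<Rightarrow> real) \<Rightarrow> complex \<Rightarrow> complex" where
  "grad f z = Complex (dX f z) (dY f z)"

text \<open>
  Extension of a function on an open set \<open>U\<close> to \<open>closure U\<close> by its limits from inside \<open>U\<close>. A function
  that is continuous on \<open>U\<close> has a continuous extension to \<open>closure U\<close> iff this one is continuous on
  \<open>closure U\<close>.
\<close>
definition ext_closure :: "complex set \<Rightarrow> (complex \<Rightarrow> 'a::t2_space) \<Rightarrow> complex \<Rightarrow> 'a" where
  "ext_closure U f z = (if z \<in> U then f z else Lim (at z within U) f)"

definition C1_open :: "complex set \<Rightarrow> (complex \<Rightarrow> real) \<Rightarrow> bool" where
  "C1_open U f \<longleftrightarrow> (\<forall>z\<in>U. f differentiable (at z)) \<and> continuous_on U (grad f)"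

definition C2_open :: "complex set \<Rightarrow> (complex \<Rightarrow> real) \<Rightarrow> bool" where
  "C2_open U f \<longleftrightarrow> C1_open U f \<and> C1_open U (dX f) \<and> C1_open U (dY f)"

definition C1_closure :: "complex set \<Rightarrow> (complex \<Rightarrow> real) \<Rightarrow> bool" where
  "C1_closure U f \<longleftrightarrow> C1_open U f \<and> continuous_on (closure U) f \<and>
     continuous_on (closure U) (ext_closure U (grad f))"

definition harmonic :: "complex set \<Rightarrow> (complex \<Rightarrow> real) \<Rightarrow> bool" where
  "harmonic U f \<longleftrightarrow> C2_open U f \<and> (\<forall>z\<in>U. dX (dX f) z + dY (dY f) z = 0)"

definition conformal_bij :: "(complex \<Rightarrow> complex) \<Rightarrow> complex set \<Rightarrow> complex set \<Rightarrow> bool" where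
  "conformal_bij f U V \<longleftrightarrow> f holomorphic_on U \<and> bij_betw f U V"

text \<open>
  Conformality up to the boundary: \<open>f\<close> is given on \<open>closure U\<close>, maps \<open>U\<close> conformally onto \<open>V\<close>, and the
  complex derivative extends continuously and without zeros to \<open>closure U\<close>.
\<close>
definition conformal_bij_closure :: "(complex \<Rightarrow> complex) \<Rightarrow> complex set \<Rightarrow> complex set \<Rightarrow> bool" where
  "conformal_bij_closure f U V \<longleftrightarrow>
     conformal_bij f U V \<and> continuous_on (closure U) f \<and> bij_betw f (closure U) (closure V) \<and>
     continuous_on (closure U) (ext_closure U (deriv f)) \<and>
     (\<forall>z\<in>closure U. ext_closure U (deriv f) z \<noteq> 0)"

definition maps_infinity_to_infinity :: "(complex \<Rightarrow> complex) \<Rightarrow> complex set \<Rightarrow> bool" where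
  "maps_infinity_to_infinity f S \<longleftrightarrow>
     filterlim f at_infinity (inf at_infinity (principal S))"

definition lower_half_plane :: "complex set" where
  "lower_half_plane = {z. Im z < 0}"

section \<open>The solitary wave problem on deep water\<close>

text \<open>
  The curve is given by its two coordinate functions. When \<open>u\<close> is a strictly increasing bijection of
  the real line, as for all curves considered here, the curve is a graph and \<open>below u v\<close> is the open
  domain below it.
\<close>
definition below :: "(real \<Rightarrow> real) \<Rightarrow> (real \<Rightarrow> real) \<Rightarrow> complex set" where
  "below u v = {Z. \<exists>x. Re Z = u x \<and> Im Z < v x}"

text \<open>
  Finiteness of \<open>u'\<^sup>2 + v'\<^sup>2\<close> is implicit in \<open>u\<close> and \<open>v\<close> being differentiable functions with real values.
  The values of \<open>\<psi>\<close> outside \<open>closure (below u v)\<close> are irrelevant.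
\<close>
definition solitary_wave ::
  "(real \<Rightarrow> real) \<Rightarrow> (real \<Rightarrow> real) \<Rightarrow> real \<Rightarrow> (complex \<Rightarrow> real) \<Rightarrow> bool" where
  "solitary_wave u v \<mu> \<psi> \<longleftrightarrow>
     (let \<Omega> = below u v in
        u C1_differentiable_on UNIV \<and> v C1_differentiable_on UNIV \<and>
        (\<forall>x. deriv u x > 0) \<and>
        ((\<lambda>x. Complex (u x - x) (v x)) \<longlongrightarrow> 0) at_infinity \<and>
        C1_closure \<Omega> \<psi> \<and> C2_open \<Omega> \<psi> \<and> harmonic \<Omega> \<psi> \<and>
        (\<forall>x. \<psi> (Complex (u x) (v x)) = 0) \<and>
        ((\<lambda>Z. \<psi> Z - Im Z) \<longlongrightarrow> 0) (inf at_infinity (principal (closure \<Omega>))) \<and>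
        (\<forall>x. ((\<lambda>Z. (norm (grad \<psi> Z))\<^sup>2 + 2 * \<mu> * v x) \<longlongrightarrow> 1)
               (at (Complex (u x) (v x)) within \<Omega>)))"

text \<open>On the curve the gradient is understood as the boundary value of the gradient in the domain.\<close>
definition regular_solitary_wave ::
  "(real \<Rightarrow> real) \<Rightarrow> (real \<Rightarrow> real) \<Rightarrow> real \<Rightarrow> (complex \<Rightarrow> real) \<Rightarrow> bool" where
  "regular_solitary_wave u v \<mu> \<psi> \<longleftrightarrow> solitary_wave u v \<mu> \<psi> \<and>
     (\<forall>x. norm (ext_closure (below u v) (grad \<psi>) (Complex (u x) (v x))) > 0)"

definition babenko :: "real \<Rightarrow> (real \<Rightarrow> real) \<Rightarrow> bool" where
  "babenko \<mu> w \<longleftrightarrow>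
     (\<forall>x. hilbert (deriv w) x =
       \<mu> * (w x + w x * hilbert (deriv w) x + hilbert (\<lambda>t. w t * deriv w t) x))"

text \<open>\<open>inf (1 + \<H>w') > 0\<close>\<close>
definition inf_slope_pos :: "(real \<Rightarrow> real) \<Rightarrow> bool" where
  "inf_slope_pos w \<longleftrightarrow> (\<exists>c>0. \<forall>x. c \<le> 1 + hilbert (deriv w) x)"

text \<open>
  \<open>Im F\<^sup>-\<^sup>1(x + i0)\<close>, where \<open>F = \<phi> + i\<psi>\<close> is holomorphic on \<open>\<Omega>\<close> and taken on \<open>closure \<Omega>\<close> with its boundary
  values.
\<close>
definition surface_elevation :: "complex set \<Rightarrow> (complex \<Rightarrow> complex) \<Rightarrow> real \<Rightarrow> real" where
  "surface_elevation \<Omega> F x = Im (inv_into (closure \<Omega>) (ext_closure \<Omega> F) (complex_of_real x))"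

end

theory Submission
  imports Defs
begin

text \<open>
  One formula carries both directions. Let \<open>S w (\<zeta>) = 1/\<pi> \<integral> w t / (\<zeta> - t) dt\<close> be the Cauchy
  integral of the surface elevation, for \<open>\<zeta>\<close> in the lower half plane. The inverse \<open>G\<close> of the complex
  potential is \<open>\<zeta> + S w \<zeta>\<close>, up to a real constant.

  The Hilbert transform enters through the boundary values of \<open>S\<close>. For a square integrable,
  uniformly Hoelder continuous \<open>b\<close>, the function \<open>S b\<close> extends continuously to the real line with
  boundary values \<open>\<H>b + i b\<close>, and it tends to \<open>0\<close> at infinity, uniformly up to the boundary
  (\<open>continuous_on_cauchy_transform\<close>, \<open>cauchy_transform_tendsto_0\<close>); moreover \<open>(S w)' = S w'\<close>
  (\<open>DERIV_cauchy_transform_eq\<close>). A holomorphic function in the half plane that is continuous up to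
  the real line, real there, and tends to \<open>0\<close> at infinity vanishes
  (\<open>vanishing_real_boundary_values_imp_zero\<close>). Applied to differences, this
  shows that among the functions that tend to \<open>0\<close> each one is determined by the imaginary part \<open>b\<close> of
  its boundary values: if \<open>b\<close> is of the above kind, the function is \<open>S b\<close>, and its real part on the
  line is \<open>\<H>b\<close>.

  The equivalence of Bernoulli's condition and Babenko's equation is then algebra. On the line
  \<open>G' = 1 + \<H>w' + i w'\<close>, and Bernoulli's condition \<open>(1 - 2\<mu>w) \<bar>G'\<bar>\<^sup>2 = 1\<close> says that \<open>1/G'\<close> is
  \<open>(1 - 2\<mu>w)\<close> times the conjugate of \<open>G'\<close>. Its imaginary part is \<open>b = -(1 - 2\<mu>w) w'\<close>, so
  \<open>1/G' - 1 = S b\<close>, and the real part of this identity is Babenko's equation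
  (\<open>bernoulli_imp_babenko\<close>). Conversely, Babenko's equation says that \<open>1 + S b\<close> has the boundary
  values \<open>(1 - 2\<mu>w)\<close> times the conjugate of \<open>G'\<close>; then \<open>G' (1 + S b) - 1\<close> is real on the line, hence
  zero (\<open>babenko_imp_bernoulli\<close>).

  For the first direction the potential \<open>F = \<phi> + i\<psi>\<close> must be shown to be a bijection. Comparing \<open>\<psi>\<close>
  with its vertical translates by the maximum principle shows that \<open>\<psi>\<close> increases with \<open>Y\<close>, so that
  \<open>Re F' = \<psi>\<^sub>Y > 0\<close>. Hence each level line of \<open>\<psi>\<close> is a graph over the \<open>X\<close>-axis, and \<open>\<phi>\<close> increases
  along it. It runs from \<open>-\<infinity>\<close> to \<open>\<infinity>\<close>: on the level lines inside the domain because \<open>F' - 1\<close> is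
  controlled by the distance to the boundary, and on the free surface because there \<open>d\<phi>\<close> is
  \<open>\<bar>\<nabla>\<psi>\<bar>\<close> times the arc length and \<open>\<bar>\<nabla>\<psi>\<bar> \<rightarrow> 1\<close> (\<open>F_bij\<close>, \<open>F_bij_closure\<close>). The inverse is
  continuous up to the boundary (\<open>G_cont\<close>), and \<open>Im (G \<zeta> - \<zeta>)\<close> tends to \<open>0\<close>, which identifies it.

  For the second direction \<open>G\<close> is defined by the formula. By the minimum principle \<open>Re G' \<ge> c > 0\<close>,
  so \<open>G\<close> is injective on the closed half plane (\<open>G_inj\<close>), and a connectedness argument shows that
  its image is the domain below the curve (\<open>image_G\<close>); the stream function is \<open>Im G\<^sup>-\<^sup>1\<close>.
\<close>

section \<open>Square integrable, uniformly Hoelder continuous functions\<close>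

lemma tendsto_inf_at_infinity_iff:
  fixes f :: "'a::real_normed_vector \<Rightarrow> 'b::real_normed_vector"
  shows "(f \<longlongrightarrow> l) (inf at_infinity (principal S)) \<longleftrightarrow>
    (\<forall>e>0. \<exists>R. \<forall>z\<in>S. R \<le> norm z \<longrightarrow> norm (f z - l) < e)"
  unfolding tendsto_iff eventually_inf_principal eventually_at_infinity dist_norm by blast

lemma tendsto_at_infinity_iff_norm:
  fixes f :: "'a::real_normed_vector \<Rightarrow> 'b::real_normed_vector"
  shows "(f \<longlongrightarrow> l) at_infinity \<longleftrightarrow> (\<forall>e>0. \<exists>R. \<forall>z. R \<le> norm z \<longrightarrow> norm (f z - l) < e)"
  unfolding tendsto_iff eventually_at_infinity dist_norm by blast

lemma tendsto_at_infinity_sequentially: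
  fixes f :: "'a::real_normed_vector \<Rightarrow> 'b::real_normed_vector"
  assumes "\<And>Z. filterlim Z at_infinity sequentially \<Longrightarrow> (\<lambda>n. f (Z n)) \<longlonglongrightarrow> l"
  shows "(f \<longlongrightarrow> l) at_infinity"
proof (rule ccontr)
  assume "\<not> ?thesis"
  then obtain e where e: "e > 0" "\<And>R. \<exists>z. R \<le> norm z \<and> \<not> norm (f z - l) < e"
    unfolding tendsto_at_infinity_iff_norm by blast
  obtain Z where Z: "\<And>n::nat. real n \<le> norm (Z n)" "\<And>n. \<not> norm (f (Z n) - l) < e"
    using e(2)[of "real n" for n] by metis
  have "filterlim (\<lambda>n. norm (Z n)) at_top sequentially"
    by (rule filterlim_at_top_mono[OF filterlim_real_sequentially]) (use Z in auto)
  then have "filterlim Z at_infinity sequentially"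
    by (simp add: filterlim_at_infinity_conv_norm_at_top)
  from LIMSEQ_D[OF assms[OF this] e(1)] Z(2) show False by blast
qed

lemma integrable_abs_powr_unit:
  assumes "0 < \<alpha>"
  shows "integrable lborel (\<lambda>s::real. indicator {-1..1} s * \<bar>s\<bar> powr (\<alpha> - 1))"
proof -
  define f where "f = (\<lambda>s::real. indicator {0..1} s * s powr (\<alpha> - 1))"
  have "(\<lambda>x::real. x powr (\<alpha> - 1)) integrable_on {0..1}"
    using assms by (intro integrable_on_powr_from_0) auto
  then have "(\<lambda>x::real. x powr (\<alpha> - 1)) absolutely_integrable_on {0..1}"
    by (subst absolutely_integrable_on_iff_nonneg) auto
  then have "integrable lebesgue f"
    by (simp add: set_integrable_def f_def)
  moreover have "f \<in> borel_measurable lborel"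
    unfolding f_def by measurable
  ultimately have f: "integrable lborel f"
    using integrable_completion by blast
  then have "integrable lborel (\<lambda>s. f (0 + (-1) * s))"
    by (intro lborel_integrable_real_affine) auto
  then have i: "integrable lborel (\<lambda>s. f s + f (-s))" using f by simp
  show ?thesis
    by (rule Bochner_Integration.integrable_bound[OF i])
      (auto simp: f_def indicator_def abs_if)
qed

lemma integrable_inverse_square_tail:
  "integrable lborel (\<lambda>s::real. if \<bar>s\<bar> > 1 then 1 / s\<^sup>2 else 0)"
proof -
  define f where "f = (\<lambda>s::real. indicator {1..} s * s powr (-2))"
  have "(\<lambda>x::real. x powr (-2)) integrable_on {1..}"
    using has_integral_powr_to_inf[of "-2" 1] by (auto simp: integrable_on_def)
  then have "(\<lambda>x::real. x powr (-2)) absolutely_integrable_on {1..}"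
    by (subst absolutely_integrable_on_iff_nonneg) auto
  then have "integrable lebesgue f"
    by (simp add: set_integrable_def f_def)
  moreover have "f \<in> borel_measurable lborel"
    unfolding f_def by measurable
  ultimately have f: "integrable lborel f"
    using integrable_completion by blast
  then have "integrable lborel (\<lambda>s. f (0 + (-1) * s))"
    by (intro lborel_integrable_real_affine) auto
  then have i: "integrable lborel (\<lambda>s. f s + f (-s))" using f by simp
  show ?thesis
  proof (rule Bochner_Integration.integrable_bound[OF i], measurable, rule AE_I2)
    fix s :: real
    have "s powr (-2) = 1 / s\<^sup>2" if "s > 0" for s :: real
      using that by (simp add: powr_minus field_simps flip: powr_numeral)
    from this[of s] this[of "-s"]
    show "norm (if 1 < \<bar>s\<bar> then 1 / s\<^sup>2 else 0) \<le> norm (f s + f (-s))"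
      by (auto simp: f_def indicator_def abs_if split: if_splits)
  qed
qed

text \<open>
  The class is closed under linear combinations and products, and it contains both \<open>w\<close> and \<open>w'\<close>;
  square integrability makes the Cauchy integral converge at infinity, the Hoelder modulus makes
  its limit on the real line exist.
\<close>
definition l2_holder :: "real \<Rightarrow> (real \<Rightarrow> real) \<Rightarrow> bool" where
  "l2_holder \<alpha> b \<longleftrightarrow> square_integrable b \<and> (\<exists>B. \<forall>x. \<bar>b x\<bar> \<le> B) \<and>
     (\<exists>C. \<forall>x t. \<bar>x - t\<bar> \<le> 1 \<longrightarrow> \<bar>b x - b t\<bar> \<le> C * \<bar>x - t\<bar> powr \<alpha>)"

lemma l2_holder_bound:
  assumes "l2_holder \<alpha> b"
  obtains B where "B > 0" "\<And>x. \<bar>b x\<bar> \<le> B"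
proof -
  obtain B where "\<And>x. \<bar>b x\<bar> \<le> B" using assms by (auto simp: l2_holder_def)
  then show ?thesis using that[of "max B 1"] by (simp add: le_max_iff_disj)
qed

lemma l2_holder_modulus:
  assumes "l2_holder \<alpha> b"
  obtains C where "C > 0" "\<And>x t. \<bar>x - t\<bar> \<le> 1 \<Longrightarrow> \<bar>b x - b t\<bar> \<le> C * \<bar>x - t\<bar> powr \<alpha>"
proof -
  obtain C where C: "\<And>x t. \<bar>x - t\<bar> \<le> 1 \<Longrightarrow> \<bar>b x - b t\<bar> \<le> C * \<bar>x - t\<bar> powr \<alpha>"
    using assms by (auto simp: l2_holder_def)
  have "\<bar>b x - b t\<bar> \<le> max C 1 * \<bar>x - t\<bar> powr \<alpha>" if "\<bar>x - t\<bar> \<le> 1" for x t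
    using C[OF that] by (rule order_trans) (intro mult_right_mono, auto)
  then show ?thesis using that[of "max C 1"] by auto
qed

lemma l2_holder_unif_cont:
  assumes b: "l2_holder \<alpha> b" and "0 < \<alpha>" "0 < e"
  obtains d where "0 < d" "d \<le> 1" "\<And>x t. \<bar>x - t\<bar> \<le> d \<Longrightarrow> \<bar>b x - b t\<bar> < e"
proof -
  obtain C where C: "C > 0" "\<And>x t. \<bar>x - t\<bar> \<le> 1 \<Longrightarrow> \<bar>b x - b t\<bar> \<le> C * \<bar>x - t\<bar> powr \<alpha>"
    using l2_holder_modulus[OF b] by blast
  define d where "d = min 1 ((e / (2 * C)) powr (1 / \<alpha>))"
  have d: "0 < d" "d \<le> 1" using assms C by (auto simp: d_def)
  have "\<bar>b x - b t\<bar> < e" if "\<bar>x - t\<bar> \<le> d" for x t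
  proof -
    have "\<bar>x - t\<bar> powr \<alpha> \<le> ((e / (2 * C)) powr (1 / \<alpha>)) powr \<alpha>"
      using that assms by (intro powr_mono2) (auto simp: d_def)
    also have "\<dots> = e / (2 * C)" using assms C by (simp add: powr_powr)
    finally have "C * \<bar>x - t\<bar> powr \<alpha> \<le> C * (e / (2*C))" using C by (intro mult_left_mono) auto
    also have "\<dots> = e / 2" using C by simp
    finally show ?thesis using C(2)[of x t] that d assms by linarith
  qed
  with d that show ?thesis by blast
qed

lemma l2_holder_continuous:
  assumes b: "l2_holder \<alpha> b" and "0 < \<alpha>"
  shows "continuous_on UNIV b"
  unfolding continuous_on_iff dist_real_def
proof clarsimp
  fix x e :: real assume "0 < e"
  from l2_holder_unif_cont[OF b assms(2) this]
  obtain d where d: "0 < d" "d \<le> 1" "\<And>x t. \<bar>x - t\<bar> \<le> d \<Longrightarrow> \<bar>b x - b t\<bar> < e" by blast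
  then show "\<exists>d>0. \<forall>x'. \<bar>x' - x\<bar> < d \<longrightarrow> \<bar>b x' - b x\<bar> < e" by (intro exI[of _ d]) auto
qed

lemma l2_holder_measurable [measurable_dest]:
  assumes "l2_holder \<alpha> b"
  shows "b \<in> borel_measurable borel"
  using assms by (simp add: l2_holder_def square_integrable_def)

lemma l2_holder_integrable:
  assumes "l2_holder \<alpha> b"
  shows "integrable lborel (\<lambda>x. (b x)\<^sup>2)"
  using assms by (simp add: l2_holder_def square_integrable_def)

lemma integral_tail_tendsto_0:
  fixes f :: "real \<Rightarrow> real"
  assumes f: "integrable lborel f"
  shows "(\<lambda>n::nat. LINT s|lborel. indicator {s. \<bar>s\<bar> > real n} s * f s) \<longlonglongrightarrow> 0"
proof -
  have [measurable]: "f \<in> borel_measurable lborel" using f by auto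
  have "(\<lambda>n::nat. LINT s|lborel. indicator {s. \<bar>s\<bar> > real n} s * f s) \<longlonglongrightarrow> integral\<^sup>L lborel (\<lambda>s::real. 0)"
  proof (rule integral_dominated_convergence[where w = "\<lambda>s. \<bar>f s\<bar>"])
    show "AE s in lborel. (\<lambda>n. indicator {s. \<bar>s\<bar> > real n} s * f s) \<longlonglongrightarrow> 0"
    proof (rule AE_I2)
      fix s :: real
      have "\<forall>\<^sub>F n in sequentially. \<bar>s\<bar> \<le> real n"
        using filterlim_real_sequentially by (auto simp: filterlim_at_top)
      then have "\<forall>\<^sub>F n in sequentially. indicator {s. \<bar>s\<bar> > real n} s * f s = 0"
        by (rule eventually_mono) auto
      then show "(\<lambda>n. indicator {s. \<bar>s\<bar> > real n} s * f s) \<longlonglongrightarrow> 0" by (rule tendsto_eventually)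
    qed
  qed (use f in \<open>auto simp: indicator_def\<close>)
  then show ?thesis by simp
qed

text \<open>
  If \<open>\<bar>b x\<bar> \<ge> e\<close>, then \<open>\<bar>b\<bar> \<ge> e/2\<close> on an interval whose length does not depend on \<open>x\<close>. The integral
  of \<open>b\<^sup>2\<close> over this interval is bounded below, which is impossible far out.
\<close>
lemma l2_holder_tendsto_0:
  assumes b: "l2_holder \<alpha> b" and "0 < \<alpha>"
  shows "(b \<longlongrightarrow> 0) at_infinity"
  unfolding tendsto_at_infinity_iff_norm
proof (intro allI impI)
  fix e :: real assume "e > 0"
  then have "e / 2 > 0" by simp
  from l2_holder_unif_cont[OF b assms(2) this]
  obtain d where d: "0 < d" "d \<le> 1" "\<And>x t. \<bar>x - t\<bar> \<le> d \<Longrightarrow> \<bar>b x - b t\<bar> < e / 2" by blast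
  have [measurable]: "b \<in> borel_measurable borel" using b by (rule l2_holder_measurable)
  note b2 = l2_holder_integrable[OF b]
  have pos: "0 < d * (e/2)\<^sup>2" using d \<open>e > 0\<close> by simp
  obtain N :: nat where N: "\<bar>LINT s|lborel. indicator {s. \<bar>s\<bar> > real N} s * (b s)\<^sup>2\<bar> < d * (e/2)\<^sup>2"
    using LIMSEQ_D[OF integral_tail_tendsto_0[OF b2] pos] by auto
  have "norm (b x - 0) < e" if x: "real N + 1 < norm x" for x
  proof (rule ccontr)
    assume "\<not> norm (b x - 0) < e"
    then have bx: "\<bar>b x\<bar> \<ge> e" by simp
    have bt: "(e/2)\<^sup>2 \<le> (b t)\<^sup>2" if "\<bar>x - t\<bar> \<le> d" for t
    proof -
      have "\<bar>e / 2\<bar> \<le> \<bar>b t\<bar>" using d(3)[OF that] bx \<open>e > 0\<close> by linarith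
      then show ?thesis by (simp only: abs_le_square_iff)
    qed
    have "(LINT s|lborel. indicator {x..x+d} s * (e/2)\<^sup>2) \<le> (LINT s|lborel. indicator {s. \<bar>s\<bar> > real N} s * (b s)\<^sup>2)"
    proof (rule integral_mono)
      show "integrable lborel (\<lambda>s. indicator {s. \<bar>s\<bar> > real N} s * (b s)\<^sup>2)"
        by (rule Bochner_Integration.integrable_bound[OF b2]) (auto simp: indicator_def)
      show "indicator {x..x+d} s * (e/2)\<^sup>2 \<le> indicator {s. \<bar>s\<bar> > real N} s * (b s)\<^sup>2" if "s \<in> space lborel" for s
        using bt[of s] x d by (auto simp: indicator_def)
      show "integrable lborel (\<lambda>s. indicator {x..x+d} s * (e/2)\<^sup>2)"
        using d by (intro integrable_mult_left integrable_real_indicator) (auto simp: emeasure_lborel_Icc)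
    qed
    also have "(LINT s|lborel. indicator {x..x+d} s * (e/2)\<^sup>2) = d * (e/2)\<^sup>2"
      using d by simp
    finally show False using N by linarith
  qed
  then show "\<exists>R. \<forall>z. R \<le> norm z \<longrightarrow> norm (b z - 0) < e"
    by (intro exI[of _ "real N + 2"]) auto
qed

section \<open>The regularised Cauchy kernel\<close>

text \<open>
  After the substitution \<open>t = x - s\<close> the Cauchy integral at \<open>x + iy\<close> has the kernel \<open>1 / (s + iy)\<close>.
  Subtracting \<open>b x\<close> for \<open>\<bar>s\<bar> \<le> 1\<close> makes the integrand integrable uniformly in \<open>y\<close>, down to
  \<open>y = 0\<close>. The subtracted term is integrated explicitly later.
\<close>
definition pv_kernel :: "(real \<Rightarrow> real) \<Rightarrow> complex \<Rightarrow> real \<Rightarrow> complex" where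
  "pv_kernel b z s =
     of_real (b (Re z - s) - (if \<bar>s\<bar> \<le> 1 then b (Re z) else 0)) / (of_real s + \<i> * of_real (Im z))"

definition pv_integral :: "(real \<Rightarrow> real) \<Rightarrow> complex \<Rightarrow> complex" where
  "pv_integral b z = (LINT s|lborel. pv_kernel b z s)"

lemma norm_kernel_pole_ge: "\<bar>s\<bar> \<le> norm (of_real s + \<i> * of_real y :: complex)"
  "\<bar>y\<bar> \<le> norm (of_real s + \<i> * of_real y :: complex)"
  using abs_Re_le_cmod[of "of_real s + \<i> * of_real y"] abs_Im_le_cmod[of "of_real s + \<i> * of_real y"]
  by auto

lemma kernel_pole_nonzero: "s \<noteq> 0 \<Longrightarrow> of_real s + \<i> * of_real y \<noteq> (0::complex)"
  by (auto simp: complex_eq_iff)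

lemma pv_kernel_measurable:
  assumes "l2_holder \<alpha> b"
  shows "pv_kernel b z \<in> borel_measurable borel"
proof -
  have [measurable]: "b \<in> borel_measurable borel" using assms by (rule l2_holder_measurable)
  show ?thesis unfolding pv_kernel_def[abs_def] by measurable
qed

lemma norm_pv_kernel:
  "norm (pv_kernel b z s) \<le> \<bar>b (Re z - s) - (if \<bar>s\<bar> \<le> 1 then b (Re z) else 0)\<bar> / \<bar>s\<bar>"
proof (cases "s = 0")
  case True then show ?thesis by (simp add: pv_kernel_def)
next
  case False
  then show ?thesis unfolding pv_kernel_def norm_divide norm_of_real
    by (intro divide_left_mono norm_kernel_pole_ge mult_pos_pos) (auto simp: complex_eq_iff)
qed

lemma norm_pv_kernel_near:
  assumes "\<And>x t. \<bar>x - t\<bar> \<le> 1 \<Longrightarrow> \<bar>b x - b t\<bar> \<le> C * \<bar>x - t\<bar> powr \<alpha>" "\<bar>s\<bar> \<le> 1"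
  shows "norm (pv_kernel b z s) \<le> C * \<bar>s\<bar> powr (\<alpha> - 1)"
proof (cases "s = 0")
  case False
  have "norm (pv_kernel b z s) \<le> (C * \<bar>s\<bar> powr \<alpha>) / \<bar>s\<bar>"
    using norm_pv_kernel[of b z s] assms(1)[of "Re z - s" "Re z"] assms(2)
    by (smt (verit) divide_right_mono)
  also have "\<dots> = C * \<bar>s\<bar> powr (\<alpha> - 1)" using False by (simp add: powr_diff)
  finally show ?thesis .
qed (simp add: pv_kernel_def)

text \<open>
  The free weight \<open>\<delta>\<close> allows the two terms to be made small one after the other: the first by \<open>\<delta>\<close>,
  the second by restricting to large \<open>\<bar>s\<bar>\<close>.
\<close>
lemma norm_pv_kernel_far:
  assumes "\<bar>s\<bar> > 1" "\<delta> > 0"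
  shows "norm (pv_kernel b z s) \<le> \<delta> / 2 * (b (Re z - s))\<^sup>2 + 1 / (2 * \<delta>) * (1 / s\<^sup>2)"
proof -
  define p q where "p = \<bar>b (Re z - s)\<bar>" and "q = 1 / \<bar>s\<bar>"
  have "0 \<le> (\<delta> * p - q)\<^sup>2 / (2 * \<delta>)" using assms by simp
  also have "\<dots> = \<delta> / 2 * p\<^sup>2 + 1 / (2 * \<delta>) * q\<^sup>2 - p * q"
    using assms by (simp add: power2_eq_square field_simps)
  finally have "p * q \<le> \<delta> / 2 * p\<^sup>2 + 1 / (2 * \<delta>) * q\<^sup>2" by simp
  moreover have "norm (pv_kernel b z s) \<le> p * q"
    using norm_pv_kernel[of b z s] assms by (simp add: p_def q_def)
  ultimately show ?thesis by (simp add: p_def q_def power_divide)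
qed

lemma integrable_shifted_square:
  assumes "l2_holder \<alpha> b"
  shows "integrable lborel (\<lambda>s. (b (x - s))\<^sup>2)"
    and "(LINT s|lborel. (b (x - s))\<^sup>2) = (LINT s|lborel. (b s)\<^sup>2)"
  using lborel_integrable_real_affine[OF l2_holder_integrable[OF assms], of "-1" x]
    lborel_integral_real_affine[of "-1" "\<lambda>s. (b s)\<^sup>2" x] by auto

lemma integrable_pv_kernel:
  assumes b: "l2_holder \<alpha> b" and "0 < \<alpha>"
  shows "integrable lborel (pv_kernel b z)"
proof -
  obtain C where C: "C > 0" "\<And>x t. \<bar>x - t\<bar> \<le> 1 \<Longrightarrow> \<bar>b x - b t\<bar> \<le> C * \<bar>x - t\<bar> powr \<alpha>"
    using l2_holder_modulus[OF b] by blast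
  define g where "g s = C * (indicator {-1..1} s * \<bar>s\<bar> powr (\<alpha> - 1)) + (1/2 * (b (Re z - s))\<^sup>2 +
     1/2 * (if \<bar>s\<bar> > 1 then 1 / s\<^sup>2 else 0))" for s
  have "integrable lborel g"
    unfolding g_def
    by (intro Bochner_Integration.integrable_add integrable_mult_right integrable_abs_powr_unit
        integrable_shifted_square[OF b] integrable_inverse_square_tail assms)
  then show ?thesis
  proof (rule Bochner_Integration.integrable_bound)
    show "AE s in lborel. norm (pv_kernel b z s) \<le> norm (g s)"
    proof (rule AE_I2)
      fix s
      have "norm (pv_kernel b z s) \<le> g s"
        using norm_pv_kernel_near[OF C(2), of s z] norm_pv_kernel_far[of s 1 b z] C(1)
        by (cases "\<bar>s\<bar> \<le> 1") (auto simp: g_def abs_if split: if_splits intro!: add_increasing2)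
      then show "norm (pv_kernel b z s) \<le> norm (g s)" by simp
    qed
  qed (use pv_kernel_measurable[OF b] in simp)
qed

text \<open>
  The error is uniform in \<open>z\<close> since the integral of \<open>b\<^sup>2\<close> is invariant under translation. The truncated
  integrals have an integrable majorant independent of \<open>z\<close>, which the full integral lacks, so
  continuity and the limit at infinity are first proved for the truncated integrals, by dominated
  convergence.
\<close>
lemma pv_integral_truncation:
  assumes b: "l2_holder \<alpha> b" and "0 < \<alpha>" "0 < e"
  obtains M :: nat where "M \<ge> 1"
    "\<And>z. norm (pv_integral b z - (LINT s|lborel. indicator {-real M..real M} s *\<^sub>R pv_kernel b z s)) < e"
proof -
  have [measurable]: "b \<in> borel_measurable borel" using b by (rule l2_holder_measurable)
  define L where "L = (LINT s|lborel. (b s)\<^sup>2)"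
  have L: "L \<ge> 0" unfolding L_def by (intro integral_nonneg_AE) auto
  define \<delta> where "\<delta> = e / (L + 1)"
  have \<delta>: "\<delta> > 0" "\<delta> * L \<le> e" using assms L by (auto simp: \<delta>_def field_simps)
  define q where "q = (\<lambda>s::real. if \<bar>s\<bar> > 1 then 1 / s\<^sup>2 else 0)"
  have q: "integrable lborel q" unfolding q_def by (rule integrable_inverse_square_tail)
  have "\<delta> * e > 0" using \<delta> assms by simp
  from LIMSEQ_D[OF integral_tail_tendsto_0[OF q] this] obtain N :: nat where
    N: "\<And>n. n \<ge> N \<Longrightarrow> \<bar>LINT s|lborel. indicator {s. \<bar>s\<bar> > real n} s * q s\<bar> < \<delta> * e" by auto
  define M where "M = max N 1"
  have M: "M \<ge> 1" "(LINT s|lborel. indicator {s. \<bar>s\<bar> > real M} s * q s) < \<delta> * e"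
    using N[of M] by (auto simp: M_def)
  have "norm (pv_integral b z - (LINT s|lborel. indicator {-real M..real M} s *\<^sub>R pv_kernel b z s)) < e" for z
  proof -
    have ik: "integrable lborel (pv_kernel b z)" by (rule integrable_pv_kernel[OF b assms(2)])
    have [measurable]: "pv_kernel b z \<in> borel_measurable borel" by (rule pv_kernel_measurable[OF b])
    have i1: "integrable lborel (\<lambda>s. indicator {-real M..real M} s *\<^sub>R pv_kernel b z s)"
      by (rule Bochner_Integration.integrable_bound[OF ik]) (auto simp: indicator_def)
    have i2: "integrable lborel (\<lambda>s. indicator {s. \<bar>s\<bar> > real M} s * q s)"
      by (rule Bochner_Integration.integrable_bound[OF q]) (auto simp: indicator_def q_def)
    have "norm (pv_integral b z - (LINT s|lborel. indicator {-real M..real M} s *\<^sub>R pv_kernel b z s))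
        = norm (LINT s|lborel. pv_kernel b z s - indicator {-real M..real M} s *\<^sub>R pv_kernel b z s)"
      unfolding pv_integral_def by (subst Bochner_Integration.integral_diff[OF ik i1]) auto
    also have "\<dots> \<le> (LINT s|lborel. norm (pv_kernel b z s - indicator {-real M..real M} s *\<^sub>R pv_kernel b z s))"
      by (rule integral_norm_bound)
    also have "\<dots> \<le> (LINT s|lborel. \<delta> / 2 * (b (Re z - s))\<^sup>2 + 1 / (2 * \<delta>) * (indicator {s. \<bar>s\<bar> > real M} s * q s))"
    proof (rule integral_mono)
      show "norm (pv_kernel b z s - indicator {-real M..real M} s *\<^sub>R pv_kernel b z s)
         \<le> \<delta> / 2 * (b (Re z - s))\<^sup>2 + 1 / (2 * \<delta>) * (indicator {s. \<bar>s\<bar> > real M} s * q s)" for s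
        using norm_pv_kernel_far[of s \<delta> b z] \<delta> M(1)
        by (auto simp: indicator_def q_def abs_if mult_ac split: if_splits)
    qed (intro Bochner_Integration.integrable_diff Bochner_Integration.integrable_add integrable_norm
        ik i1 i2 integrable_mult_right integrable_shifted_square[OF b])+
    also have "\<dots> = \<delta> / 2 * L + 1 / (2 * \<delta>) * (LINT s|lborel. indicator {s. \<bar>s\<bar> > real M} s * q s)"
      by (subst Bochner_Integration.integral_add)
        (auto simp: L_def integrable_shifted_square[OF b] i2 intro!: integrable_mult_right)
    also have "\<dots> < \<delta> / 2 * L + 1 / (2 * \<delta>) * (\<delta> * e)"
      using M(2) \<delta> by (intro add_strict_left_mono mult_strict_left_mono) auto
    also have "\<dots> \<le> e" using \<delta> by simp
    finally show ?thesis .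
  qed
  with M that show ?thesis by blast
qed

lemma integrable_truncated_bound:
  assumes "0 < \<alpha>"
  shows "integrable lborel (\<lambda>s::real. C * (indicator {-1..1} s * \<bar>s\<bar> powr (\<alpha> - 1)) + B * indicator {-real M..real M} s)"
  by (intro Bochner_Integration.integrable_add integrable_mult_right integrable_abs_powr_unit assms) auto

lemma truncated_pv_tendsto:
  assumes b: "l2_holder \<alpha> b" and "0 < \<alpha>"
    and lim: "\<And>s. s \<noteq> 0 \<Longrightarrow> (\<lambda>n. pv_kernel b (Z n) s) \<longlonglongrightarrow> k s"
    and [measurable]: "k \<in> borel_measurable borel"
  shows "(\<lambda>n. LINT s|lborel. indicator {-real M..real M} s *\<^sub>R pv_kernel b (Z n) s)
    \<longlonglongrightarrow> (LINT s|lborel. indicator {-real M..real M} s *\<^sub>R k s)"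
proof -
  obtain C where C: "C > 0" "\<And>x t. \<bar>x - t\<bar> \<le> 1 \<Longrightarrow> \<bar>b x - b t\<bar> \<le> C * \<bar>x - t\<bar> powr \<alpha>"
    using l2_holder_modulus[OF b] by blast
  obtain B where B: "B > 0" "\<And>x. \<bar>b x\<bar> \<le> B" using l2_holder_bound[OF b] by blast
  have [measurable]: "pv_kernel b z \<in> borel_measurable borel" for z by (rule pv_kernel_measurable[OF b])
  show ?thesis
  proof (rule integral_dominated_convergence[OF _ _ integrable_truncated_bound[OF assms(2), of C B M]])
    show "AE s in lborel. (\<lambda>n. indicator {-real M..real M} s *\<^sub>R pv_kernel b (Z n) s)
        \<longlonglongrightarrow> indicator {-real M..real M} s *\<^sub>R k s"
      using AE_lborel_singleton[of 0] by eventually_elim (auto intro!: tendsto_intros lim)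
    show "AE s in lborel. norm (indicator {-real M..real M} s *\<^sub>R pv_kernel b (Z n) s)
        \<le> C * (indicator {-1..1} s * \<bar>s\<bar> powr (\<alpha> - 1)) + B * indicator {-real M..real M} s" for n
    proof (rule AE_I2)
      fix s
      have "norm (pv_kernel b (Z n) s) \<le> B" if "\<bar>s\<bar> > 1"
      proof -
        have "norm (pv_kernel b (Z n) s) \<le> \<bar>b (Re (Z n) - s)\<bar> / \<bar>s\<bar>"
          using norm_pv_kernel[of b "Z n" s] that by simp
        also have "\<dots> \<le> \<bar>b (Re (Z n) - s)\<bar> / 1" using that by (intro divide_left_mono) auto
        finally show ?thesis using B(2)[of "Re (Z n) - s"] by simp
      qed
      then show "norm (indicator {-real M..real M} s *\<^sub>R pv_kernel b (Z n) s)
        \<le> C * (indicator {-1..1} s * \<bar>s\<bar> powr (\<alpha> - 1)) + B * indicator {-real M..real M} s"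
        using norm_pv_kernel_near[OF C(2), of s "Z n"] C(1) B(1)
        by (cases "\<bar>s\<bar> \<le> 1") (auto simp: indicator_def abs_if split: if_splits intro: add_increasing2)
    qed
  qed measurable
qed

lemma pv_kernel_continuous:
  assumes b: "l2_holder \<alpha> b" and "0 < \<alpha>" and "s \<noteq> 0"
  shows "continuous_on UNIV (\<lambda>z. pv_kernel b z s)"
proof -
  have c: "continuous_on UNIV b" by (rule l2_holder_continuous[OF assms(1,2)])
  then have "continuous_on UNIV (\<lambda>z. b (Re z - s) - (if \<bar>s\<bar> \<le> 1 then b (Re z) else 0))"
    by (cases "\<bar>s\<bar> \<le> 1") (auto intro!: continuous_intros continuous_on_compose2[OF c])
  then show ?thesis unfolding pv_kernel_def
    by (intro continuous_on_divide continuous_on_of_real)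
      (auto intro!: continuous_intros simp: kernel_pole_nonzero[OF assms(3)])
qed

lemma pv_integral_continuous:
  assumes b: "l2_holder \<alpha> b" and "0 < \<alpha>"
  shows "continuous_on UNIV (pv_integral b)"
proof (rule uniform_limit_theorem)
  define J where "J M z = (LINT s|lborel. indicator {-real M..real M} s *\<^sub>R pv_kernel b z s)" for M and z :: complex
  \<comment> \<open>The truncations are indexed by their uniform error \<open>e\<close>, and the limit is taken as \<open>e\<close> tends to \<open>0\<close>.\<close>
  show "uniform_limit UNIV (\<lambda>e z. J (SOME M. \<forall>z. norm (pv_integral b z - J M z) < e) z) (pv_integral b) (at_right 0)"
  proof (rule uniform_limitI)
    fix e :: real assume e: "e > 0"
    have "\<forall>x. dist (J (SOME M. \<forall>z. norm (pv_integral b z - J M z) < d) x) (pv_integral b x) < e"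
      if d: "0 < d" "d < e" for d
    proof
      fix x
      have "\<exists>M. \<forall>z. norm (pv_integral b z - J M z) < d"
        using pv_integral_truncation[OF b assms(2) d(1)] unfolding J_def by metis
      from someI_ex[OF this] d
      show "dist (J (SOME M. \<forall>z. norm (pv_integral b z - J M z) < d) x) (pv_integral b x) < e"
        by (smt (verit) dist_norm norm_minus_commute)
    qed
    then show "\<forall>\<^sub>F d in at_right 0. \<forall>x\<in>UNIV. dist (J (SOME M. \<forall>z. norm (pv_integral b z - J M z) < d) x) (pv_integral b x) < e"
      using e unfolding eventually_at_right_field by auto
  qed
  have "continuous_on UNIV (J M)" for M
    unfolding continuous_on_sequentially J_def o_def
  proof clarify
    fix Z :: "nat \<Rightarrow> complex" and z assume Z: "Z \<longlonglongrightarrow> z"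
    show "(\<lambda>n. LINT s|lborel. indicator {-real M..real M} s *\<^sub>R pv_kernel b (Z n) s)
        \<longlonglongrightarrow> (LINT s|lborel. indicator {-real M..real M} s *\<^sub>R pv_kernel b z s)"
    proof (rule truncated_pv_tendsto[OF b assms(2) _ pv_kernel_measurable[OF b]])
      fix s :: real assume "s \<noteq> 0"
      from continuous_on_tendsto_compose[OF pv_kernel_continuous[OF b assms(2) this] Z]
      show "(\<lambda>n. pv_kernel b (Z n) s) \<longlonglongrightarrow> pv_kernel b z s" by simp
    qed
  qed
  then show "\<forall>\<^sub>F e in at_right 0. continuous_on UNIV (J (SOME M. \<forall>z. norm (pv_integral b z - J M z) < e))"
    by simp
qed simp

text \<open>
  If \<open>\<bar>Re z\<bar>\<close> is large then the numerator is small since \<open>b\<close> tends to \<open>0\<close>; otherwise \<open>\<bar>Im z\<bar>\<close> is large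
  and with it the denominator.
\<close>
lemma pv_kernel_tendsto_0:
  assumes b: "l2_holder \<alpha> b" and "0 < \<alpha>" and s: "s \<noteq> 0"
  shows "((\<lambda>z. pv_kernel b z s) \<longlongrightarrow> 0) at_infinity"
  unfolding tendsto_at_infinity_iff_norm
proof (intro allI impI)
  fix e :: real assume e: "e > 0"
  obtain B where B: "B > 0" "\<And>x. \<bar>b x\<bar> \<le> B" using l2_holder_bound[OF b] by blast
  obtain N where N: "\<And>t. N \<le> \<bar>t\<bar> \<Longrightarrow> \<bar>b t\<bar> < e * \<bar>s\<bar> / 2"
  proof -
    have "e * \<bar>s\<bar> / 2 > 0" using e s by simp
    then show ?thesis using l2_holder_tendsto_0[OF b assms(2)] that
      unfolding tendsto_at_infinity_iff_norm by (metis diff_zero real_norm_def)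
  qed
  show "\<exists>R. \<forall>z. R \<le> norm z \<longrightarrow> norm (pv_kernel b z s - 0) < e"
  proof (intro exI[of _ "\<bar>N\<bar> + \<bar>s\<bar> + 2 * B / e + 1"] allI impI)
    fix z :: complex assume z: "\<bar>N\<bar> + \<bar>s\<bar> + 2 * B / e + 1 \<le> norm z"
    define r where "r = \<bar>b (Re z - s) - (if \<bar>s\<bar> \<le> 1 then b (Re z) else 0)\<bar>"
    define D where "D = norm (of_real s + \<i> * of_real (Im z) :: complex)"
    have D: "\<bar>s\<bar> \<le> D" "\<bar>Im z\<bar> \<le> D" unfolding D_def by (rule norm_kernel_pole_ge)+
    have k: "norm (pv_kernel b z s) = r / D" by (simp only: pv_kernel_def norm_divide norm_of_real r_def D_def)
    have "r < e * D"
    proof (cases "\<bar>Re z\<bar> \<ge> \<bar>N\<bar> + \<bar>s\<bar>")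
      case True
      have "N \<le> \<bar>Re z\<bar>" "N \<le> \<bar>Re z - s\<bar>" using True by linarith+
      then have "r < e * \<bar>s\<bar>"
        using N[of "Re z"] N[of "Re z - s"] unfolding r_def by (cases "\<bar>s\<bar> \<le> 1") simp_all
      also have "\<dots> \<le> e * D" using D e by simp
      finally show ?thesis .
    next
      case False
      then have "\<bar>Im z\<bar> > 2 * B / e" using z cmod_le[of z] by linarith
      then have "2 * B < e * \<bar>Im z\<bar>" using e by (simp add: field_simps)
      also have "\<dots> \<le> e * D" using D e by simp
      finally show ?thesis using B(2)[of "Re z"] B(2)[of "Re z - s"] unfolding r_def by auto
    qed
    moreover have "D > 0" using D s by linarith
    ultimately show "norm (pv_kernel b z s - 0) < e" by (simp add: k field_simps)
  qed
qed

lemma pv_integral_tendsto_0: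
  assumes b: "l2_holder \<alpha> b" and "0 < \<alpha>"
  shows "(pv_integral b \<longlongrightarrow> 0) at_infinity"
proof (rule tendsto_at_infinity_sequentially)
  fix Z :: "nat \<Rightarrow> complex" assume Z: "filterlim Z at_infinity sequentially"
  show "(\<lambda>n. pv_integral b (Z n)) \<longlonglongrightarrow> 0"
  proof (rule LIMSEQ_I)
    fix e :: real assume "e > 0"
    then have e2: "e / 2 > 0" by simp
    from pv_integral_truncation[OF b assms(2) this] obtain M :: nat where
      M: "\<And>z. norm (pv_integral b z - (LINT s|lborel. indicator {-real M..real M} s *\<^sub>R pv_kernel b z s)) < e / 2" by metis
    have "(\<lambda>n. LINT s|lborel. indicator {-real M..real M} s *\<^sub>R pv_kernel b (Z n) s)
       \<longlonglongrightarrow> (LINT s|lborel. indicator {-real M..real M} s *\<^sub>R (0::complex))"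
      by (rule truncated_pv_tendsto[OF b assms(2)])
        (auto intro: filterlim_compose[OF pv_kernel_tendsto_0[OF b assms(2)] Z])
    from LIMSEQ_D[OF this e2] obtain n0 where
      n0: "\<And>n. n \<ge> n0 \<Longrightarrow> norm (LINT s|lborel. indicator {-real M..real M} s *\<^sub>R pv_kernel b (Z n) s) < e / 2"
      by auto
    have "norm (pv_integral b (Z n) - 0) < e" if "n \<ge> n0" for n
      using norm_triangle_sub[of "pv_integral b (Z n)" "LINT s|lborel. indicator {-real M..real M} s *\<^sub>R pv_kernel b (Z n) s"]
        M[of "Z n"] n0[OF that] by simp
    then show "\<exists>no. \<forall>n\<ge>no. norm (pv_integral b (Z n) - 0) < e" by blast
  qed
qed

section \<open>The Cauchy transform in the lower half plane\<close>

text \<open>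
  The contribution of the subtracted term: \<open>ln (s\<^sup>2 + y\<^sup>2) / 2 - i arctan (s/y)\<close> is a primitive. As
  \<open>y\<close> increases to \<open>0\<close> the value tends to \<open>i\<pi>\<close>; this jump puts \<open>i b\<close> into the boundary values.
\<close>
lemma integral_inverse_pole:
  assumes y: "y < 0"
  shows "integrable lborel (\<lambda>s. indicator {-1..1} s *\<^sub>R (1 / (of_real s + \<i> * of_real y)) :: complex)"
    and "(LINT s|lborel. indicator {-1..1} s *\<^sub>R (1 / (of_real s + \<i> * of_real y))) = \<i> * of_real (pi + 2 * arctan y)"
proof -
  define F where "F s = of_real (ln (s\<^sup>2 + y\<^sup>2) / 2) - \<i> * of_real (arctan (s / y))" for s
  have pos: "s\<^sup>2 + y\<^sup>2 > 0" for s using y by (simp add: sum_power2_gt_zero_iff)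
  have nz: "of_real s + \<i> * of_real y \<noteq> (0::complex)" for s using y by (auto simp: complex_eq_iff)
  have "(F has_vector_derivative 1 / (of_real s + \<i> * of_real y)) (at s within {-1..1})" for s
  proof -
    have "((\<lambda>s. ln (s\<^sup>2 + y\<^sup>2) / 2) has_real_derivative s / (s\<^sup>2 + y\<^sup>2)) (at s within {-1..1})"
    proof -
      have "(ln has_real_derivative 1 / (s\<^sup>2 + y\<^sup>2)) (at (s\<^sup>2 + y\<^sup>2))"
        by (rule DERIV_ln_divide[OF pos])
      moreover have "((\<lambda>s. s\<^sup>2 + y\<^sup>2) has_real_derivative 2 * s) (at s within {-1..1})"
        by (auto intro!: derivative_eq_intros)
      ultimately have "((\<lambda>s. ln (s\<^sup>2 + y\<^sup>2)) has_real_derivative 1 / (s\<^sup>2 + y\<^sup>2) * (2 * s)) (at s within {-1..1})"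
        by (rule DERIV_chain2)
      moreover have "(1 / c * (2 * s)) / 2 = s / c" for c :: real by simp
      ultimately show ?thesis using DERIV_cdivide[of _ _ s "{-1..1}" 2] by metis
    qed
    moreover have "((\<lambda>s. arctan (s / y)) has_real_derivative y / (s\<^sup>2 + y\<^sup>2)) (at s within {-1..1})"
    proof -
      have "((\<lambda>s. arctan (s / y)) has_real_derivative (1 / y) * inverse (1 + (s / y)\<^sup>2)) (at s within {-1..1})"
        using y by (auto intro!: derivative_eq_intros)
      also have "(1 / y) * inverse (1 + (s / y)\<^sup>2) = y / (s\<^sup>2 + y\<^sup>2)"
        using y pos[of s] by (simp add: field_simps power2_eq_square)
      finally show ?thesis .
    qed
    ultimately have "(F has_vector_derivative of_real (s / (s\<^sup>2 + y\<^sup>2)) - \<i> * of_real (y / (s\<^sup>2 + y\<^sup>2))) (at s within {-1..1})"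
      unfolding F_def
      by (intro derivative_intros has_vector_derivative_of_real has_vector_derivative_mult_right)
        (auto simp: has_real_derivative_iff_has_vector_derivative)
    also have "of_real (s / (s\<^sup>2 + y\<^sup>2)) - \<i> * of_real (y / (s\<^sup>2 + y\<^sup>2)) = 1 / (of_real s + \<i> * of_real y)"
      
    proof -
      have "p * c / c\<^sup>2 = p / c" for p c :: real by (simp add: power2_eq_square)
      then show ?thesis using nz[of s] by (simp add: complex_eq_iff Re_divide Im_divide)
    qed
    finally show ?thesis .
  qed
  then have "has_bochner_integral lborel (\<lambda>s. indicator {-1..1} s *\<^sub>R (1 / (of_real s + \<i> * of_real y))) (F 1 - F (-1))"
    using nz by (intro has_bochner_integral_FTC_Icc) (auto intro!: continuous_intros)
  moreover have "F 1 - F (-1) = \<i> * of_real (pi + 2 * arctan y)"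
  proof -
    have "arctan (1 / y) = sgn y * pi / 2 - arctan y" using y by (intro Transcendental.arctan_inverse) simp
    then have "arctan (1 / y) = - pi / 2 - arctan y" unfolding sgn_neg[OF y] by simp
    then show ?thesis by (simp add: F_def arctan_minus complex_eq_iff)
  qed
  ultimately show "integrable lborel (\<lambda>s. indicator {-1..1} s *\<^sub>R (1 / (of_real s + \<i> * of_real y)) :: complex)"
    and "(LINT s|lborel. indicator {-1..1} s *\<^sub>R (1 / (of_real s + \<i> * of_real y))) = \<i> * of_real (pi + 2 * arctan y)"
    by (auto simp: has_bochner_integral_iff)
qed

text \<open>
  The values for \<open>Im z \<ge> 0\<close> are meaningful for \<open>Im z = 0\<close> only, where they are the boundary values
  from below.
\<close>
definition cauchy_transform :: "(real \<Rightarrow> real) \<Rightarrow> complex \<Rightarrow> complex" where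
  "cauchy_transform b z =
     (if Im z < 0 then 1 / of_real pi * (LINT t|lborel. of_real (b t) / (z - of_real t))
      else Complex (hilbert b (Re z)) (b (Re z)))"

lemma cauchy_integral_below:
  assumes b: "l2_holder \<alpha> b" "0 < \<alpha>" and z: "Im z < 0"
  shows "integrable lborel (\<lambda>t. of_real (b t) / (z - of_real t))"
    and "(LINT t|lborel. of_real (b t) / (z - of_real t)) =
      pv_integral b z + \<i> * of_real (b (Re z) * (pi + 2 * arctan (Im z)))"
proof -
  let ?p = "\<lambda>s. of_real s + \<i> * of_real (Im z) :: complex"
  let ?f = "\<lambda>t. of_real (b t) / (z - of_real t) :: complex"
  have eq: "?f (Re z + (-1) * s) = pv_kernel b z s + of_real (b (Re z)) * (indicator {-1..1} s *\<^sub>R (1 / ?p s))" for s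
  proof -
    have "z - of_real (Re z + (-1) * s) = ?p s" by (simp add: complex_eq_iff)
    then show ?thesis by (auto simp: pv_kernel_def indicator_def abs_if diff_divide_distrib split: if_splits)
  qed
  note i = integrable_pv_kernel[OF b, of z] integral_inverse_pole[OF z]
  have "integrable lborel (\<lambda>s. ?f (Re z + (-1) * s))"
    unfolding eq by (intro Bochner_Integration.integrable_add integrable_mult_right i)
  then show "integrable lborel ?f"
    using lborel_integrable_real_affine_iff[of "-1" ?f "Re z"] by simp
  have "(LINT t|lborel. ?f t) = (LINT s|lborel. ?f (Re z + (-1) * s))"
    using lborel_integral_real_affine[of "-1" ?f "Re z"] by simp
  also have "\<dots> = pv_integral b z + of_real (b (Re z)) * (\<i> * of_real (pi + 2 * arctan (Im z)))"
    unfolding eq pv_integral_def i(3)[symmetric]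
    by (subst Bochner_Integration.integral_add[OF i(1) integrable_mult_right[OF i(2)]])
      (simp only: integral_mult_right_zero)
  finally show "(LINT t|lborel. ?f t) = pv_integral b z + \<i> * of_real (b (Re z) * (pi + 2 * arctan (Im z)))"
    by simp
qed

text \<open>
  On the real line the subtracted term contributes nothing to the truncated integral in the
  definition of the Hilbert transform, because \<open>1/s\<close> is odd. What remains is dominated by the
  regularised kernel, so the truncation can be removed.
\<close>
lemma pv_integral_real:
  assumes b: "l2_holder \<alpha> b" "0 < \<alpha>"
  shows "pv_integral b (of_real x) = of_real (pi * hilbert b x)"
proof -
  define k where "k s = (b (x - s) - (if \<bar>s\<bar> \<le> 1 then b x else 0)) / s" for s
  have kk: "pv_kernel b (of_real x) = (\<lambda>s. of_real (k s))"
    by (auto simp: pv_kernel_def k_def fun_eq_iff)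
  have ik: "integrable lborel k"
    using integrable_pv_kernel[OF b, of "of_real x"] unfolding kk complex_of_real_integrable_eq .
  then have [measurable]: "k \<in> borel_measurable lborel" by auto
  have [measurable]: "b \<in> borel_measurable borel" using b(1) by (rule l2_holder_measurable)
  let ?T = "\<lambda>\<epsilon>. LINT t : {t. \<bar>x - t\<bar> > \<epsilon>} | lborel. b t / (x - t)"
  have T: "?T \<epsilon> = (LINT s|lborel. indicator {s. \<epsilon> < \<bar>s\<bar>} s * k s)" if e: "0 < \<epsilon>" "\<epsilon> < 1" for \<epsilon>
  proof -
    define o1 where "o1 s = indicator {s. \<epsilon> < \<bar>s\<bar> \<and> \<bar>s\<bar> \<le> 1} s * (1 / s)" for s :: real
    have [measurable]: "o1 \<in> borel_measurable borel" unfolding o1_def[abs_def] by measurable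
    have i1: "integrable lborel o1"
    proof (rule Bochner_Integration.integrable_bound)
      show "integrable lborel (\<lambda>s. 1 / \<epsilon> * indicator {-1..1::real} s)" by (intro integrable_mult_right) simp
      show "AE s in lborel. norm (o1 s) \<le> norm (1 / \<epsilon> * indicator {-1..1::real} s)"
        using e by (auto simp: o1_def indicator_def abs_if field_simps)
    qed simp
    have "(LINT s|lborel. o1 s) = (LINT s|lborel. o1 (0 + (-1) * s))"
      using lborel_integral_real_affine[of "-1" o1 0] by simp
    also have "(\<lambda>s. o1 (0 + (-1) * s)) = (\<lambda>s. - o1 s)"
      by (auto simp: o1_def indicator_def)
    also have "(LINT s|lborel. - o1 s) = - (LINT s|lborel. o1 s)" by simp
    finally have o0: "(LINT s|lborel. o1 s) = 0" by linarith
    let ?g = "\<lambda>t. indicator {t. \<bar>x - t\<bar> > \<epsilon>} t *\<^sub>R (b t / (x - t))"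
    have i2: "integrable lborel (\<lambda>s. indicator {s. \<epsilon> < \<bar>s\<bar>} s * k s)"
      by (rule Bochner_Integration.integrable_bound[OF ik]) (auto simp: indicator_def)
    have "?T \<epsilon> = (LINT s|lborel. ?g (x + (-1) * s))"
      unfolding set_lebesgue_integral_def using lborel_integral_real_affine[of "-1" ?g x] by simp
    also have "(\<lambda>s. ?g (x + (-1) * s)) = (\<lambda>s. indicator {s. \<epsilon> < \<bar>s\<bar>} s * k s + b x * o1 s)"
      by (auto simp: fun_eq_iff k_def o1_def indicator_def diff_divide_distrib)
    also have "(LINT s|lborel. \<dots> s) = (LINT s|lborel. indicator {s. \<epsilon> < \<bar>s\<bar>} s * k s) + b x * 0"
      unfolding o0[symmetric] by (subst Bochner_Integration.integral_add) (auto intro!: i2 i1 integrable_mult_right)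
    finally show ?thesis by simp
  qed
  have "((\<lambda>\<epsilon>. LINT s|lborel. indicator {s. \<epsilon> < \<bar>s\<bar>} s * k s) \<longlongrightarrow> (LINT s|lborel. k s)) (at_right 0)"
    unfolding filterlim_at_right_to_top
  proof (rule integral_dominated_convergence_at_top[where w = "\<lambda>s. \<bar>k s\<bar>"])
    show "AE s in lborel. ((\<lambda>t. indicator {s. inverse t < \<bar>s\<bar>} s * k s) \<longlongrightarrow> k s) at_top"
    proof (rule AE_mp[OF AE_lborel_singleton[of 0]], rule AE_I2, rule impI)
      fix s :: real assume s: "s \<noteq> 0"
      have "((\<lambda>t::real. inverse t) \<longlongrightarrow> 0) at_top" by (rule tendsto_inverse_0_at_top) (rule filterlim_ident)
      from order_tendstoD(2)[OF this, of "\<bar>s\<bar>"] s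
      have "\<forall>\<^sub>F t in at_top. inverse t < \<bar>s\<bar>" by simp
      then have "\<forall>\<^sub>F t in at_top. indicator {s. inverse t < \<bar>s\<bar>} s * k s = k s"
        by eventually_elim simp
      then show "((\<lambda>t. indicator {s. inverse t < \<bar>s\<bar>} s * k s) \<longlongrightarrow> k s) at_top" by (rule tendsto_eventually)
    qed
  qed (use ik in \<open>auto simp: indicator_def intro!: always_eventually\<close>)
  then have "(?T \<longlongrightarrow> (LINT s|lborel. k s)) (at_right 0)"
  proof (rule Lim_transform_eventually)
    show "\<forall>\<^sub>F \<epsilon> in at_right 0. (LINT s|lborel. indicator {s. \<epsilon> < \<bar>s\<bar>} s * k s) = ?T \<epsilon>"
      unfolding eventually_at_right_field using T by (intro exI[of _ 1]) auto
  qed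
  then have "Lim (at_right 0) ?T = (LINT s|lborel. k s)"
    by (intro tendsto_Lim) auto
  then show ?thesis
    unfolding pv_integral_def kk hilbert_def by simp
qed

text \<open>
  The right-hand side is continuous in the whole plane. This single formula for the interior and the
  boundary yields the Plemelj formula, that is, the continuity of the transform up to the real line.
\<close>
lemma cauchy_transform_eq:
  assumes b: "l2_holder \<alpha> b" "0 < \<alpha>" and z: "Im z \<le> 0"
  shows "cauchy_transform b z =
     (pv_integral b z + \<i> * of_real (b (Re z) * (pi + 2 * arctan (Im z)))) / of_real pi"
proof (cases "Im z < 0")
  case True
  then show ?thesis by (simp add: cauchy_transform_def cauchy_integral_below(2)[OF b])
next
  case False
  then have "z = of_real (Re z)" using z by (simp add: complex_eq_iff)
  then obtain x where x: "z = of_real x" by blast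
  show ?thesis
    by (simp add: x cauchy_transform_def pv_integral_real[OF b] complex_eq_iff add_divide_distrib)
qed

lemma cauchy_transform_real [simp]:
  "cauchy_transform b (of_real x) = Complex (hilbert b x) (b x)"
  by (simp add: cauchy_transform_def)

theorem continuous_on_cauchy_transform:
  assumes b: "l2_holder \<alpha> b" "0 < \<alpha>"
  shows "continuous_on {z. Im z \<le> 0} (cauchy_transform b)"
proof -
  have c: "continuous_on UNIV b" by (rule l2_holder_continuous[OF b])
  have "continuous_on {z. Im z \<le> 0} (\<lambda>z. (pv_integral b z + \<i> * of_real (b (Re z) * (pi + 2 * arctan (Im z)))) / of_real pi)"
    by (intro continuous_intros continuous_on_subset[OF pv_integral_continuous[OF b]]
        continuous_on_compose2[OF c]) auto
  then show ?thesis by (rule continuous_on_eq) (simp add: cauchy_transform_eq[OF b])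
qed

text \<open>
  In the remaining term \<open>b (Re z) (\<pi> + 2 arctan (Im z))\<close> one of the two bounded factors is small when
  \<open>\<bar>z\<bar>\<close> is large: the first if \<open>\<bar>Re z\<bar>\<close> is large, the second if \<open>Im z\<close> is close to \<open>-\<infinity>\<close>.
\<close>
theorem cauchy_transform_tendsto_0:
  assumes b: "l2_holder \<alpha> b" "0 < \<alpha>"
  shows "(cauchy_transform b \<longlongrightarrow> 0) (inf at_infinity (principal {z. Im z \<le> 0}))"
  unfolding tendsto_inf_at_infinity_iff
proof (intro allI impI)
  fix e :: real assume e: "e > 0"
  obtain B where B: "B > 0" "\<And>x. \<bar>b x\<bar> \<le> B" using l2_holder_bound[OF b(1)] by blast
  obtain R1 where R1: "\<And>z. R1 \<le> norm z \<Longrightarrow> norm (pv_integral b z) < e"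
    using pv_integral_tendsto_0[OF b] e unfolding tendsto_at_infinity_iff_norm by (metis diff_zero)
  have e2: "e / (4 * pi) > 0" "e / (2 * B) > 0" using e B by auto
  obtain R2 where R2: "\<And>x. R2 \<le> \<bar>x\<bar> \<Longrightarrow> \<bar>b x\<bar> < e / (4 * pi)"
    using l2_holder_tendsto_0[OF b] e2(1) unfolding tendsto_at_infinity_iff_norm by (metis diff_zero real_norm_def)
  have "((\<lambda>y. pi + 2 * arctan y) \<longlongrightarrow> pi + 2 * (- (pi / 2))) at_bot"
    by (intro tendsto_intros tendsto_arctan_at_bot)
  then have "((\<lambda>y. pi + 2 * arctan y) \<longlongrightarrow> 0) at_bot" by simp
  from tendstoD[OF this e2(2)] obtain R3 where R3: "\<And>y. y \<le> R3 \<Longrightarrow> \<bar>pi + 2 * arctan y\<bar> < e / (2 * B)"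
    unfolding eventually_at_bot_linorder by (auto simp: dist_real_def)
  show "\<exists>R. \<forall>z\<in>{z. Im z \<le> 0}. R \<le> norm z \<longrightarrow> norm (cauchy_transform b z - 0) < e"
  proof (intro exI ballI impI)
    fix z assume z: "z \<in> {z. Im z \<le> 0}" and R: "\<bar>R1\<bar> + \<bar>R2\<bar> + \<bar>R3\<bar> \<le> norm z"
    have "\<bar>b (Re z) * (pi + 2 * arctan (Im z))\<bar> \<le> e"
    proof (cases "R2 \<le> \<bar>Re z\<bar>")
      case True
      have "\<bar>pi + 2 * arctan (Im z)\<bar> \<le> 2 * pi"
        using arctan_lbound[of "Im z"] arctan_ubound[of "Im z"] by linarith
      then have "\<bar>b (Re z)\<bar> * \<bar>pi + 2 * arctan (Im z)\<bar> \<le> (e / (4 * pi)) * (2 * pi)"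
        using R2[OF True] e by (intro mult_mono) auto
      then show ?thesis using e by (simp add: abs_mult)
    next
      case False
      then have "Im z \<le> R3" using R cmod_le[of z] z by auto
      then have "\<bar>b (Re z)\<bar> * \<bar>pi + 2 * arctan (Im z)\<bar> \<le> B * (e / (2 * B))"
        using R3[of "Im z"] B by (intro mult_mono) (auto intro: less_imp_le)
      then show ?thesis using e B(1) by (simp add: abs_mult)
    qed
    then have "norm (\<i> * of_real (b (Re z) * (pi + 2 * arctan (Im z))) :: complex) \<le> e"
      unfolding norm_mult norm_of_real by simp
    moreover have "norm (pv_integral b z) < e" using R1[of z] R by linarith
    ultimately have "norm (pv_integral b z + \<i> * of_real (b (Re z) * (pi + 2 * arctan (Im z)))) < 2 * e"
      using norm_triangle_ineq[of "pv_integral b z" "\<i> * of_real (b (Re z) * (pi + 2 * arctan (Im z)))"] by linarith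
    then have "norm (cauchy_transform b z) < 2 * e / pi"
      using z by (simp add: cauchy_transform_eq[OF b] norm_divide divide_strict_right_mono)
    also have "\<dots> \<le> 2 * e / 2" using e pi_ge_two by (intro divide_left_mono) auto
    finally show "norm (cauchy_transform b z - 0) < e" by simp
  qed
qed

lemma DERIV_cauchy_transform:
  assumes b: "l2_holder \<alpha> b" "0 < \<alpha>" and z: "Im z < 0"
  shows "(cauchy_transform b has_field_derivative
     - (1 / of_real pi * (LINT t|lborel. of_real (b t) / (z - of_real t)\<^sup>2))) (at z)"
    and "integrable lborel (\<lambda>t. of_real (b t) / (z - of_real t)\<^sup>2)"
proof -
  \<comment> \<open>Half the distance from \<open>z\<close> to the real line: for increments up to \<open>d\<close> the shifted
    denominators stay at least \<open>d\<close> in modulus.\<close>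
  define d where "d = - Im z / 2"
  have d: "d > 0" using z by (simp add: d_def)
  have [measurable]: "b \<in> borel_measurable borel" using b(1) by (rule l2_holder_measurable)
  note i = cauchy_integral_below(1)[OF b]
  have dist: "2 * d \<le> norm (z - of_real t)" for t
    using abs_Im_le_cmod[of "z - of_real t"] z by (simp add: d_def)
  have bound: "norm (of_real (b t) / ((z + h - of_real t) * (z - of_real t)) :: complex)
     \<le> norm (1 / of_real d * (of_real (b t) / (z - of_real t)) :: complex)" if "norm h \<le> d" for t h
  proof -
    have "d \<le> norm (z + h - of_real t)"
      using dist[of t] that norm_triangle_ineq2[of "z - of_real t" "-h"] by (simp add: algebra_simps)
    then have "d * norm (z - of_real t) \<le> norm (z + h - of_real t) * norm (z - of_real t)"
      by (intro mult_right_mono) auto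
    moreover have "0 < norm (z - of_real t)" "0 < norm (z + h - of_real t)"
      using d dist[of t] \<open>d \<le> norm (z + h - of_real t)\<close> by linarith+
    ultimately have "\<bar>b t\<bar> / (norm (z + h - of_real t) * norm (z - of_real t)) \<le> \<bar>b t\<bar> / (d * norm (z - of_real t))"
      using d by (intro divide_left_mono mult_pos_pos) auto
    then show ?thesis using d by (simp add: norm_mult norm_divide)
  qed
  show i2: "integrable lborel (\<lambda>t. of_real (b t) / (z - of_real t)\<^sup>2)"
    by (rule Bochner_Integration.integrable_bound[OF integrable_mult_right[OF i[OF z], of "1 / of_real d"]])
      (use bound[of 0] d in \<open>auto simp: power2_eq_square\<close>)
  have below: "Im (z + h) < 0" if "norm h < d" for h
    using abs_Im_le_cmod[of h] that z by (auto simp: d_def)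
  let ?D = "\<lambda>h. - (1 / of_real pi * (LINT t|lborel. of_real (b t) / ((z + h - of_real t) * (z - of_real t))))"
  have quot: "(cauchy_transform b (z + h) - cauchy_transform b z) / h = ?D h" if h: "h \<noteq> 0" "norm h < d" for h
  proof -
    have "of_real (b t) / (z + h - of_real t) - of_real (b t) / (z - of_real t) =
      (- h) * (of_real (b t) / ((z + h - of_real t) * (z - of_real t)))" for t
    proof -
      have "z + h - of_real t \<noteq> 0" "z - of_real t \<noteq> 0"
        using below[OF h(2)] z by (auto simp: complex_eq_iff)
      then show ?thesis by (simp add: divide_simps) (simp add: algebra_simps)
    qed
    then have "(LINT t|lborel. of_real (b t) / (z + h - of_real t)) - (LINT t|lborel. of_real (b t) / (z - of_real t))
      = (- h) * (LINT t|lborel. of_real (b t) / ((z + h - of_real t) * (z - of_real t)))"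
      by (subst Bochner_Integration.integral_diff[symmetric, OF i[OF below[OF h(2)]] i[OF z]])
        (simp only: integral_mult_right_zero)
    then show ?thesis using h(1) below[OF h(2)] z
      by (simp add: cauchy_transform_def diff_divide_distrib[symmetric])
  qed
  have "((\<lambda>h. LINT t|lborel. of_real (b t) / ((z + h - of_real t) * (z - of_real t))) \<longlongrightarrow>
      (LINT t|lborel. of_real (b t) / (z - of_real t)\<^sup>2)) (at 0 within ball 0 d)"
    unfolding tendsto_at_iff_sequentially o_def
  proof (intro allI impI)
    fix X assume X: "\<forall>i. X i \<in> ball 0 d - {0}" "X \<longlonglongrightarrow> (0::complex)"
    show "(\<lambda>n. LINT t|lborel. of_real (b t) / ((z + X n - of_real t) * (z - of_real t)))
       \<longlonglongrightarrow> (LINT t|lborel. of_real (b t) / (z - of_real t)\<^sup>2)"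
    proof (rule integral_dominated_convergence[where
          w = "\<lambda>t. norm (1 / of_real d * (of_real (b t) / (z - of_real t)) :: complex)"])
      show "AE t in lborel. (\<lambda>n. of_real (b t) / ((z + X n - of_real t) * (z - of_real t)))
          \<longlonglongrightarrow> of_real (b t) / (z - of_real t)\<^sup>2"
      proof (rule AE_I2)
        fix t :: real
        have "z - of_real t \<noteq> 0" using z by (auto simp: complex_eq_iff)
        then show "(\<lambda>n. of_real (b t) / ((z + X n - of_real t) * (z - of_real t)))
          \<longlonglongrightarrow> of_real (b t) / (z - of_real t)\<^sup>2"
          unfolding power2_eq_square by (auto intro!: tendsto_eq_intros X(2))
      qed
      show "AE t in lborel. norm (of_real (b t) / ((z + X n - of_real t) * (z - of_real t)))
         \<le> norm (1 / of_real d * (of_real (b t) / (z - of_real t)) :: complex)" for n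
        using X(1) by (intro AE_I2 bound) (auto simp: less_imp_le)
      show "integrable lborel (\<lambda>t. norm (1 / of_real d * (of_real (b t) / (z - of_real t)) :: complex))"
        by (intro integrable_norm integrable_mult_right i z)
    qed measurable
  qed
  then have "(?D \<longlongrightarrow> - (1 / of_real pi * (LINT t|lborel. of_real (b t) / (z - of_real t)\<^sup>2))) (at 0 within ball 0 d)"
    by (intro tendsto_intros)
  then have "(?D \<longlongrightarrow> - (1 / of_real pi * (LINT t|lborel. of_real (b t) / (z - of_real t)\<^sup>2))) (at 0)"
    using d by (subst (asm) at_within_open) auto
  then have "((\<lambda>h. (cauchy_transform b (z + h) - cauchy_transform b z) / h) \<longlongrightarrow>
     - (1 / of_real pi * (LINT t|lborel. of_real (b t) / (z - of_real t)\<^sup>2))) (at 0)"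
  proof (rule Lim_transform_eventually)
    show "\<forall>\<^sub>F h in at 0. ?D h = (cauchy_transform b (z + h) - cauchy_transform b z) / h"
      unfolding eventually_at using d quot by (intro exI[of _ d]) auto
  qed
  then show "(cauchy_transform b has_field_derivative
     - (1 / of_real pi * (LINT t|lborel. of_real (b t) / (z - of_real t)\<^sup>2))) (at z)"
    unfolding DERIV_def .
qed

lemma holomorphic_on_cauchy_transform:
  assumes b: "l2_holder \<alpha> b" "0 < \<alpha>"
  shows "cauchy_transform b holomorphic_on {z. Im z < 0}"
  using DERIV_cauchy_transform(1)[OF b]
  by (auto simp: holomorphic_on_open open_halfspace_Im_lt)

text \<open>
  Integration by parts: \<open>w t / (z - t)\<close> vanishes at both ends of the real line, so the integrals of
  \<open>w' t / (z - t)\<close> and of \<open>- w t / (z - t)\<^sup>2\<close> agree.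
\<close>
lemma DERIV_cauchy_transform_eq:
  assumes w: "l2_holder \<alpha> w" "0 < \<alpha>" and w': "l2_holder \<alpha> w'"
    and deriv: "\<And>x. (w has_real_derivative w' x) (at x)" and z: "Im z < 0"
  shows "(cauchy_transform w has_field_derivative cauchy_transform w' z) (at z)"
proof -
  let ?f = "\<lambda>t. of_real (w' t) / (z - of_real t) + of_real (w t) / (z - of_real t)\<^sup>2"
  let ?F = "\<lambda>t. of_real (w t) / (z - of_real t)"
  have nz: "z - of_real t \<noteq> 0" for t using z by (auto simp: complex_eq_iff)
  have c: "continuous_on UNIV w" "continuous_on UNIV w'"
    by (auto intro: l2_holder_continuous w w')
  note i1 = cauchy_integral_below(1)[OF w' w(2) z]
  note i2 = DERIV_cauchy_transform(2)[OF w z]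
  obtain B where B: "B > 0" "\<And>x. \<bar>w x\<bar> \<le> B" using l2_holder_bound[OF w(1)] by blast
  have lim: "(?F \<longlongrightarrow> 0) at_infinity"
  proof -
    have "(w \<longlongrightarrow> 0) at_infinity" by (rule l2_holder_tendsto_0[OF w])
    then have "((\<lambda>t. \<bar>w t\<bar> / (- Im z)) \<longlongrightarrow> 0) at_infinity"
      using z by (auto intro!: tendsto_eq_intros)
    then show ?thesis
    proof (rule Lim_null_comparison[rotated], intro always_eventually allI)
      fix t
      have "- Im z \<le> norm (z - of_real t)" using abs_Im_le_cmod[of "z - of_real t"] z by simp
      then show "norm (?F t) \<le> \<bar>w t\<bar> / (- Im z)"
        using z nz[of t] unfolding norm_divide norm_of_real by (intro divide_left_mono mult_pos_pos) auto
    qed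
  qed
  have "(LBINT t=-\<infinity>..\<infinity>. ?f t) = 0 - 0"
  proof (rule interval_integral_FTC_integrable)
    show "(?F has_vector_derivative ?f t) (at t)" for t
    proof -
      have "((\<lambda>t. of_real (w t)) has_vector_derivative (of_real (w' t) :: complex)) (at t)"
        using deriv[of t] by (intro has_vector_derivative_of_real)
          (simp add: has_real_derivative_iff_has_vector_derivative)
      moreover have "((\<lambda>t. 1 / (z - of_real t)) has_vector_derivative 1 / (z - of_real t)\<^sup>2) (at t)"
      proof -
        have "((\<lambda>u. 1 / (z - u)) has_field_derivative 1 / (z - of_real t)\<^sup>2) (at (of_real t))"
          using nz[of t] by (auto intro!: derivative_eq_intros simp: power2_eq_square)
        moreover have "(complex_of_real has_vector_derivative 1) (at t)"
          using has_vector_derivative_of_real[OF DERIV_ident] by simp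
        ultimately have "((\<lambda>u. 1 / (z - u)) \<circ> complex_of_real has_vector_derivative 1 * (1 / (z - of_real t)\<^sup>2)) (at t)"
          by (intro field_vector_diff_chain_at)
        then show ?thesis by (simp add: o_def)
      qed
      ultimately have "((\<lambda>t. of_real (w t) * (1 / (z - of_real t))) has_vector_derivative
         (of_real (w t) * (1 / (z - of_real t)\<^sup>2) + of_real (w' t) * (1 / (z - of_real t)))) (at t)"
        by (rule has_vector_derivative_mult)
      then show ?thesis by (simp add: add.commute)
    qed
    show "isCont ?f t" for t
      using c nz[of t] by (intro continuous_intros) (auto simp: continuous_on_eq_continuous_at)
    show "set_integrable lborel (einterval (-\<infinity>) \<infinity>) ?f"
      using i1 i2 by (simp add: set_integrable_def)
    show "((?F \<circ> real_of_ereal) \<longlongrightarrow> 0) (at_right (- \<infinity>))"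
      unfolding ereal_tendsto_simps by (rule tendsto_mono[OF at_bot_le_at_infinity lim])
    show "((?F \<circ> real_of_ereal) \<longlongrightarrow> 0) (at_left \<infinity>)"
      unfolding ereal_tendsto_simps by (rule tendsto_mono[OF at_top_le_at_infinity lim])
  qed simp
  then have "(LINT t|lborel. ?f t) = 0"
    by (simp add: interval_lebesgue_integral_def set_lebesgue_integral_def)
  then have "(LINT t|lborel. of_real (w' t) / (z - of_real t)) + (LINT t|lborel. of_real (w t) / (z - of_real t)\<^sup>2) = 0"
    by (subst (asm) Bochner_Integration.integral_add[OF i1 i2]) auto
  then have "cauchy_transform w' z = - (1 / of_real pi * (LINT t|lborel. of_real (w t) / (z - of_real t)\<^sup>2))"
    using z by (simp add: cauchy_transform_def add_eq_0_iff)
  then show ?thesis using DERIV_cauchy_transform(1)[OF w z] by simp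
qed

lemma hilbert_linear:
  assumes b: "l2_holder \<alpha> b" "l2_holder \<alpha> d" "0 < \<alpha>" and pq: "l2_holder \<alpha> (\<lambda>t. p * b t + q * d t)"
  shows "hilbert (\<lambda>t. p * b t + q * d t) x = p * hilbert b x + q * hilbert d x"
proof -
  have "pv_kernel (\<lambda>t. p * b t + q * d t) (of_real x) =
     (\<lambda>s. of_real p * pv_kernel b (of_real x) s + of_real q * pv_kernel d (of_real x) s)"
    by (simp add: fun_eq_iff pv_kernel_def add_divide_distrib diff_divide_distrib algebra_simps)
  then have "pv_integral (\<lambda>t. p * b t + q * d t) (of_real x) =
     of_real p * pv_integral b (of_real x) + of_real q * pv_integral d (of_real x)"
    unfolding pv_integral_def
    by (simp add: integrable_pv_kernel[OF b(1,3)] integrable_pv_kernel[OF b(2,3)] Bochner_Integration.integral_add)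
  then have "complex_of_real (pi * hilbert (\<lambda>t. p * b t + q * d t) x) =
      of_real (p * (pi * hilbert b x) + q * (pi * hilbert d x))"
    unfolding pv_integral_real[OF pq b(3)] pv_integral_real[OF b(1,3)] pv_integral_real[OF b(2,3)]
    by simp
  then have "pi * hilbert (\<lambda>t. p * b t + q * d t) x = pi * (p * hilbert b x + q * hilbert d x)"
    unfolding of_real_eq_iff by (simp add: algebra_simps)
  then show ?thesis by simp
qed

section \<open>Weak derivatives\<close>

text \<open>
  A continuously differentiable function that is positive exactly on \<open>(-1,1)\<close>; its dilations serve
  as mollifiers and as test functions.
\<close>
definition bump :: "real \<Rightarrow> real" where "bump s = (max 0 (1 - s\<^sup>2))\<^sup>2"

lemma DERIV_square_pos_part: "((\<lambda>p. (max 0 p)\<^sup>2) has_real_derivative 2 * max 0 p) (at p)"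
proof -
  consider "p > 0" | "p < 0" | "p = 0" by linarith
  then show ?thesis
  proof cases
    case 1
    have "((\<lambda>p. p\<^sup>2) has_real_derivative 2 * max 0 p) (at p)"
      using 1 by (auto intro!: derivative_eq_intros)
    then show ?thesis
      by (rule has_field_derivative_transform_within_open[of _ _ _ "{0<..}"]) (use 1 in auto)
  next
    case 2
    have "((\<lambda>p. 0) has_real_derivative 2 * max 0 p) (at p)"
      using 2 by (auto intro!: derivative_eq_intros)
    then show ?thesis
      by (rule has_field_derivative_transform_within_open[of _ _ _ "{..<0}"]) (use 2 in auto)
  next
    case 3
    have "((\<lambda>h::real. (max 0 h)\<^sup>2 / h) \<longlongrightarrow> 0) (at 0)"
    proof (rule Lim_null_comparison, intro always_eventually allI)
      show "norm ((max 0 h)\<^sup>2 / h) \<le> \<bar>h\<bar>" for h :: real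
        by (cases "h > 0") (auto simp: power2_eq_square max_def)
      show "((\<lambda>h::real. \<bar>h\<bar>) \<longlongrightarrow> 0) (at 0)"
        using tendsto_rabs[OF tendsto_ident_at[of "0::real" UNIV]] by simp
    qed
    with 3 show ?thesis by (simp add: DERIV_def)
  qed
qed

lemma DERIV_bump: "(bump has_real_derivative - 4 * s * max 0 (1 - s\<^sup>2)) (at s)"
proof -
  have "((\<lambda>s::real. 1 - s\<^sup>2) has_real_derivative - 2 * s) (at s)"
    by (auto intro!: derivative_eq_intros)
  from DERIV_chain2[OF DERIV_square_pos_part this] show ?thesis
    by (simp add: bump_def[abs_def] mult_ac)
qed

lemma bump_props:
  shows bump_ge_0: "0 \<le> bump s" and bump_le_1: "bump s \<le> 1"
    and bump_outside: "\<bar>s\<bar> \<ge> 1 \<Longrightarrow> bump s = 0"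
    and continuous_on_bump: "continuous_on A bump"
    and integrable_bump: "integrable lborel bump"
    and integral_bump_pos: "0 < (LINT s|lborel. bump s)"
proof -
  show "0 \<le> bump s" for s by (simp add: bump_def)
  show le1: "bump s \<le> 1" for s unfolding bump_def by (rule power_le_one) auto
  show out: "bump s = 0" if "\<bar>s\<bar> \<ge> 1" for s
  proof -
    have "1 \<le> s\<^sup>2" using that abs_le_square_iff[of 1 s] by simp
    then show ?thesis by (simp add: bump_def)
  qed
  show c: "continuous_on A bump" for A unfolding bump_def[abs_def] by (intro continuous_intros)
  have ind: "(\<lambda>s. indicator {-1..1} s *\<^sub>R bump s) = bump"
  proof
    fix s :: real
    have "s \<in> {-1..1} \<or> 1 \<le> \<bar>s\<bar>" by auto
    then show "indicator {-1..1} s *\<^sub>R bump s = bump s" using out[of s] by auto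
  qed
  show i: "integrable lborel bump"
    using borel_integrable_compact[OF compact_Icc c, of "-1" 1] by (simp only: ind)
  have "(LINT s|lborel. 1/4 * indicator {-1/2..1/2::real} s) \<le> (LINT s|lborel. bump s)"
  proof (rule integral_mono[OF _ i])
    show "1/4 * indicator {-1/2..1/2} s \<le> bump s" for s :: real
    proof (cases "s \<in> {-1/2..1/2}")
      case True
      then have "s\<^sup>2 \<le> (1/2)\<^sup>2" by (intro abs_le_square_iff[THEN iffD1]) auto
      then have "s\<^sup>2 \<le> 1/4" by (simp add: power_divide)
      then have "1/2 \<le> max 0 (1 - s\<^sup>2)" by linarith
      then have "(1/2)\<^sup>2 \<le> bump s" unfolding bump_def by (rule power_mono) simp
      moreover have "(1/2)\<^sup>2 = (1/4 :: real)" by (simp add: power2_eq_square)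
      ultimately show ?thesis using True by (simp del: power_divide)
    qed (simp add: bump_def)
    show "integrable lborel (\<lambda>s. 1 / 4 * indicator {- 1 / 2..1 / 2::real} s :: real)"
      by (intro integrable_mult_right) simp
  qed
  then show "0 < (LINT s|lborel. bump s)" by simp
qed

lemma bump_measurable [measurable]: "bump \<in> borel_measurable borel"
  using continuous_on_bump by (rule borel_measurable_continuous_onI)

text \<open>
  The classical derivative \<open>w'\<close> and the weak derivative \<open>g\<close> have the same integral against every test
  function. With a translated and dilated bump as the test function this becomes an identity between
  mollifications.
\<close>
lemma mollified_weak_derivative:
  fixes w w' g :: "real \<Rightarrow> real"
  assumes deriv: "\<And>x. (w has_real_derivative w' x) (at x)" and w': "continuous_on UNIV w'"
    and g: "square_integrable g"
    and weak: "\<And>\<eta>. \<eta> C1_differentiable_on UNIV \<Longrightarrow> compact (closure {x. \<eta> x \<noteq> 0}) \<Longrightarrow>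
          (LINT x | lborel. w x * deriv \<eta> x) = - (LINT x | lborel. g x * \<eta> x)"
    and a: "a > 0"
  shows "(LINT s|lborel. w' (x - s / a) * bump s) = (LINT s|lborel. g (x - s / a) * bump s)"
proof -
  define \<eta> where "\<eta> t = bump (a * (x - t))" for t
  define \<eta>' where "\<eta>' t = 4 * a * (a * (x - t)) * max 0 (1 - (a * (x - t))\<^sup>2)" for t
  have d: "(\<eta> has_real_derivative \<eta>' t) (at t)" for t
  proof -
    have "((\<lambda>t. a * (x - t)) has_real_derivative - a) (at t)" by (auto intro!: derivative_eq_intros)
    from DERIV_chain2[OF DERIV_bump this] show ?thesis by (simp add: \<eta>_def[abs_def] \<eta>'_def mult_ac)
  qed
  have c: "continuous_on A w" "continuous_on A w'" "continuous_on A \<eta>" "continuous_on A \<eta>'" for A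
  proof -
    show "continuous_on A w" "continuous_on A \<eta>"
      using deriv d by (meson DERIV_continuous_on has_field_derivative_at_within)+
    show "continuous_on A w'" using w' by (rule continuous_on_subset) simp
    show "continuous_on A \<eta>'" unfolding \<eta>'_def by (intro continuous_intros)
  qed
  have der: "deriv \<eta> = \<eta>'" using d by (auto simp: fun_eq_iff DERIV_imp_deriv)
  let ?l = "x - 1 / a" and ?r = "x + 1 / a"
  have out: "\<eta> t = 0" "\<eta>' t = 0" if "t \<le> ?l \<or> ?r \<le> t" for t
  proof -
    have "1 \<le> \<bar>a * (x - t)\<bar>" using that a by (auto simp: field_simps)
    then have "1 \<le> (a * (x - t))\<^sup>2" using abs_le_square_iff[of 1 "a * (x - t)"] by simp
    then show "\<eta> t = 0" "\<eta>' t = 0"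
      using \<open>1 \<le> \<bar>a * (x - t)\<bar>\<close> by (auto simp: \<eta>_def \<eta>'_def bump_outside)
  qed
  have C1: "\<eta> C1_differentiable_on UNIV"
    unfolding C1_differentiable_on_def using d c(4)
    by (intro exI[of _ \<eta>']) (auto simp: has_real_derivative_iff_has_vector_derivative)
  have "closure {t. \<eta> t \<noteq> 0} \<subseteq> {?l..?r}"
  proof (rule closure_minimal)
    show "{t. \<eta> t \<noteq> 0} \<subseteq> {?l..?r}"
    proof
      fix t assume "t \<in> {t. \<eta> t \<noteq> 0}"
      then have "\<not> (t \<le> ?l \<or> ?r \<le> t)" using out(1)[of t] by auto
      then show "t \<in> {?l..?r}" by auto
    qed
  qed simp
  then have "compact (closure {t. \<eta> t \<noteq> 0})"
    by (meson closed_closure compact_Icc compact_closure bounded_subset compact_imp_bounded compact_eq_bounded_closed)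
  from weak[OF C1 this] have weak': "(LINT t|lborel. w t * \<eta>' t) = - (LINT t|lborel. g t * \<eta> t)"
    by (simp add: der)
  have ind: "(\<lambda>t. indicator {?l..?r} t *\<^sub>R (f t * \<eta> t)) = (\<lambda>t. f t * \<eta> t)"
     "(\<lambda>t. indicator {?l..?r} t *\<^sub>R (f t * \<eta>' t)) = (\<lambda>t. f t * \<eta>' t)" for f :: "real \<Rightarrow> real"
  proof -
    have "indicator {?l..?r} t *\<^sub>R (f t * \<eta> t) = f t * \<eta> t \<and> indicator {?l..?r} t *\<^sub>R (f t * \<eta>' t) = f t * \<eta>' t" for t
    proof (cases "t \<in> {?l..?r}")
      case False
      then have "t \<le> ?l \<or> ?r \<le> t" by auto
      from out[OF this] show ?thesis by simp
    qed simp
    then show "(\<lambda>t. indicator {?l..?r} t *\<^sub>R (f t * \<eta> t)) = (\<lambda>t. f t * \<eta> t)"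
     "(\<lambda>t. indicator {?l..?r} t *\<^sub>R (f t * \<eta>' t)) = (\<lambda>t. f t * \<eta>' t)" by (simp_all only: fun_eq_iff) blast+
  qed
  have i1: "integrable lborel (\<lambda>t. w' t * \<eta> t)"
    using borel_integrable_compact[OF compact_Icc, of ?l ?r "\<lambda>t. w' t * \<eta> t"]
    by (simp only: ind) (auto intro!: continuous_intros c)
  have i2: "integrable lborel (\<lambda>t. w t * \<eta>' t)"
    using borel_integrable_compact[OF compact_Icc, of ?l ?r "\<lambda>t. w t * \<eta>' t"]
    by (simp only: ind) (auto intro!: continuous_intros c)
  have "has_bochner_integral lborel (\<lambda>t. indicator {?l..?r} t *\<^sub>R (w' t * \<eta> t + w t * \<eta>' t)) (w ?r * \<eta> ?r - w ?l * \<eta> ?l)"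
  proof (rule has_bochner_integral_FTC_Icc)
    show "((\<lambda>t. w t * \<eta> t) has_vector_derivative w' t * \<eta> t + w t * \<eta>' t) (at t within {?l..?r})" for t
      using DERIV_mult[OF deriv d, of t]
      by (auto simp: has_real_derivative_iff_has_vector_derivative[symmetric] mult.commute add.commute
          intro: has_field_derivative_at_within)
  qed (use a in \<open>auto intro!: continuous_intros c\<close>)
  then have "(LINT t|lborel. w' t * \<eta> t + w t * \<eta>' t) = 0"
    using out[of ?l] out[of ?r] unfolding scaleR_add_right fun_cong[OF ind(1)] fun_cong[OF ind(2)]
    by (simp add: has_bochner_integral_iff)
  then have eq: "(LINT t|lborel. w' t * \<eta> t) = (LINT t|lborel. g t * \<eta> t)"
    using weak' by (simp add: Bochner_Integration.integral_add[OF i1 i2])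
  have sub: "(LINT t|lborel. f t * \<eta> t) = 1 / a * (LINT s|lborel. f (x - s / a) * bump s)" for f :: "real \<Rightarrow> real"
  proof -
    have "(LINT t|lborel. f t * \<eta> t) = \<bar>- 1 / a\<bar> *\<^sub>R (LINT s|lborel. f (x + (- 1 / a) * s) * \<eta> (x + (- 1 / a) * s))"
      using a by (intro lborel_integral_real_affine) auto
    also have "(\<lambda>s. f (x + (- 1 / a) * s) * \<eta> (x + (- 1 / a) * s)) = (\<lambda>s. f (x - s / a) * bump s)"
      using a by (simp add: \<eta>_def)
    finally show ?thesis using a by simp
  qed
  show ?thesis using eq a unfolding sub by simp
qed

text \<open>
  The integral of \<open>(f - m)\<^sup>2\<close> against the bump is nonnegative for the mean value \<open>m\<close> of \<open>f\<close>.
\<close>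
lemma jensen_bump:
  fixes f :: "real \<Rightarrow> real"
  assumes [measurable]: "f \<in> borel_measurable borel" and f: "integrable lborel (\<lambda>s. (f s)\<^sup>2)"
  shows "integrable lborel (\<lambda>s. (f s)\<^sup>2 * bump s)"
    "(LINT s|lborel. f s * bump s)\<^sup>2 \<le> (LINT s|lborel. bump s) * (LINT s|lborel. (f s)\<^sup>2 * bump s)"
proof -
  define K where "K = (LINT s|lborel. bump s)"
  have K: "K > 0" unfolding K_def by (rule integral_bump_pos)
  show i2: "integrable lborel (\<lambda>s. (f s)\<^sup>2 * bump s)"
    by (rule Bochner_Integration.integrable_bound[OF f])
      (auto simp: abs_mult bump_ge_0 bump_le_1 mult_left_le)
  have i1: "integrable lborel (\<lambda>s. f s * bump s)"
  proof (rule Bochner_Integration.integrable_bound[OF Bochner_Integration.integrable_add[OF i2 integrable_bump]])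
    show "AE s in lborel. norm (f s * bump s) \<le> norm ((f s)\<^sup>2 * bump s + bump s)"
    proof (rule AE_I2)
      fix s
      have "0 \<le> (\<bar>f s\<bar> - 1)\<^sup>2" by simp
      then have "2 * \<bar>f s\<bar> \<le> (f s)\<^sup>2 + 1" by (simp add: power2_eq_square algebra_simps)
      then have "\<bar>f s\<bar> * bump s \<le> ((f s)\<^sup>2 + 1) * bump s" using bump_ge_0[of s] by (intro mult_right_mono) auto
      then show "norm (f s * bump s) \<le> norm ((f s)\<^sup>2 * bump s + bump s)"
        using bump_ge_0[of s] by (simp add: abs_mult distrib_right)
    qed
  qed simp
  define m where "m = (LINT s|lborel. f s * bump s) / K"
  have "0 \<le> (LINT s|lborel. (f s - m)\<^sup>2 * bump s)"
    by (intro integral_nonneg_AE) (auto simp: bump_ge_0)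
  also have "(\<lambda>s. (f s - m)\<^sup>2 * bump s) = (\<lambda>s. ((f s)\<^sup>2 * bump s - 2 * m * (f s * bump s)) + m\<^sup>2 * bump s)"
    by (simp add: fun_eq_iff power2_eq_square algebra_simps)
  also have "(LINT s|lborel. \<dots> s) = (LINT s|lborel. (f s)\<^sup>2 * bump s) - 2 * m * (m * K) + m\<^sup>2 * K"
    using K i1 i2 integrable_bump
    by (subst Bochner_Integration.integral_add) (auto simp: m_def K_def Bochner_Integration.integral_diff)
  finally have "m\<^sup>2 * K \<le> (LINT s|lborel. (f s)\<^sup>2 * bump s)" by (simp add: power2_eq_square mult_ac)
  then have "K * (m\<^sup>2 * K) \<le> K * (LINT s|lborel. (f s)\<^sup>2 * bump s)" using K by simp
  moreover have "(LINT s|lborel. f s * bump s) = m * K" using K by (simp add: m_def)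
  ultimately show "(LINT s|lborel. f s * bump s)\<^sup>2 \<le> (LINT s|lborel. bump s) * (LINT s|lborel. (f s)\<^sup>2 * bump s)"
    by (simp add: K_def power2_eq_square mult_ac)
qed

text \<open>
  The mollifications of \<open>w'\<close> are those of the weak derivative \<open>g\<close>, so their \<open>L\<^sup>2\<close> norms are bounded by
  that of \<open>g\<close>. They converge to \<open>w'\<close> pointwise, because \<open>w'\<close> is continuous, and Fatou's lemma bounds
  the \<open>L\<^sup>2\<close> norm of \<open>w'\<close>.
\<close>
lemma weak_derivative_square_integrable:
  fixes w w' g :: "real \<Rightarrow> real"
  assumes deriv: "\<And>x. (w has_real_derivative w' x) (at x)" and w': "continuous_on UNIV w'"
    and bounded: "\<And>x. \<bar>w' x\<bar> \<le> B"
    and g: "square_integrable g"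
    and weak: "\<And>\<eta>. \<eta> C1_differentiable_on UNIV \<Longrightarrow> compact (closure {x. \<eta> x \<noteq> 0}) \<Longrightarrow>
          (LINT x | lborel. w x * deriv \<eta> x) = - (LINT x | lborel. g x * \<eta> x)"
  shows "square_integrable w'"
proof -
  have [measurable]: "w' \<in> borel_measurable borel" using w' by (rule borel_measurable_continuous_onI)
  have [measurable]: "g \<in> borel_measurable borel" and g2: "integrable lborel (\<lambda>s. (g s)\<^sup>2)"
    using g by (auto simp: square_integrable_def)
  define K where "K = (LINT s|lborel. bump s)"
  have K: "K > 0" unfolding K_def by (rule integral_bump_pos)
  define m where "m n x = (LINT s|lborel. w' (x - s / real (Suc n)) * bump s)" for n x
  have [measurable]: "m n \<in> borel_measurable borel" for n
    unfolding m_def by measurable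
  have lim: "(\<lambda>n. m n x) \<longlonglongrightarrow> (LINT s|lborel. w' x * bump s)" for x
    unfolding m_def
  proof (rule integral_dominated_convergence[where w = "\<lambda>s. B * bump s"])
    show "AE s in lborel. (\<lambda>n. w' (x - s / real (Suc n)) * bump s) \<longlonglongrightarrow> w' x * bump s"
    proof (rule AE_I2)
      fix s
      have "(\<lambda>n. x - s / real (Suc n)) \<longlonglongrightarrow> x - 0"
        by (intro tendsto_intros LIMSEQ_Suc[OF lim_const_over_n])
      from continuous_on_tendsto_compose[OF w' this] show "(\<lambda>n. w' (x - s / real (Suc n)) * bump s) \<longlonglongrightarrow> w' x * bump s"
        by (intro tendsto_intros) simp
    qed
    show "AE s in lborel. norm (w' (x - s / real (Suc n)) * bump s) \<le> B * bump s" for n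
      using bounded bump_ge_0 by (auto simp: abs_mult intro!: mult_right_mono)
    show "integrable lborel (\<lambda>s. B * bump s)" by (intro integrable_mult_right integrable_bump)
  qed measurable
  have bound: "ennreal ((m n x)\<^sup>2) \<le> ennreal K * (\<integral>\<^sup>+s. ennreal ((g (x - s / real (Suc n)))\<^sup>2) * ennreal (bump s) \<partial>lborel)" for n x
  proof -
    let ?f = "\<lambda>s. g (x - s / real (Suc n))"
    have i: "integrable lborel (\<lambda>s. (?f s)\<^sup>2)"
      using lborel_integrable_real_affine[OF g2, of "- 1 / real (Suc n)" x] by simp
    have [measurable]: "?f \<in> borel_measurable borel" by measurable
    have "m n x = (LINT s|lborel. ?f s * bump s)"
      unfolding m_def by (rule mollified_weak_derivative[OF deriv w' g weak]) auto
    then have "(m n x)\<^sup>2 \<le> K * (LINT s|lborel. (?f s)\<^sup>2 * bump s)"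
      using jensen_bump(2)[OF _ i] by (simp add: K_def)
    then have "ennreal ((m n x)\<^sup>2) \<le> ennreal (K * (LINT s|lborel. (?f s)\<^sup>2 * bump s))"
      by (rule ennreal_leI)
    also have "\<dots> = ennreal K * ennreal (LINT s|lborel. (?f s)\<^sup>2 * bump s)"
      using K by (intro ennreal_mult) (auto intro!: integral_nonneg_AE simp: bump_ge_0)
    also have "ennreal (LINT s|lborel. (?f s)\<^sup>2 * bump s) = (\<integral>\<^sup>+s. ennreal ((?f s)\<^sup>2 * bump s) \<partial>lborel)"
      using jensen_bump(1)[OF _ i] by (intro nn_integral_eq_integral[symmetric]) (auto simp: bump_ge_0)
    also have "\<dots> = (\<integral>\<^sup>+s. ennreal ((?f s)\<^sup>2) * ennreal (bump s) \<partial>lborel)"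
      by (simp add: ennreal_mult bump_ge_0)
    finally show ?thesis .
  qed
  define G where "G = (\<integral>\<^sup>+x. ennreal ((g x)\<^sup>2) \<partial>lborel)"
  have G: "G < \<infinity>" using g2 by (simp add: G_def nn_integral_eq_integral)
  have total: "(\<integral>\<^sup>+x. ennreal ((m n x)\<^sup>2) \<partial>lborel) \<le> ennreal K * (G * ennreal K)" for n
  proof -
    have "(\<integral>\<^sup>+x. ennreal ((m n x)\<^sup>2) \<partial>lborel) \<le>
      (\<integral>\<^sup>+x. ennreal K * (\<integral>\<^sup>+s. ennreal ((g (x - s / real (Suc n)))\<^sup>2) * ennreal (bump s) \<partial>lborel) \<partial>lborel)"
      by (intro nn_integral_mono bound)
    also have "\<dots> = ennreal K * (\<integral>\<^sup>+x. (\<integral>\<^sup>+s. ennreal ((g (x - s / real (Suc n)))\<^sup>2) * ennreal (bump s) \<partial>lborel) \<partial>lborel)"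
      by (rule nn_integral_cmult) measurable
    also have "(\<integral>\<^sup>+x. (\<integral>\<^sup>+s. ennreal ((g (x - s / real (Suc n)))\<^sup>2) * ennreal (bump s) \<partial>lborel) \<partial>lborel) =
      (\<integral>\<^sup>+s. (\<integral>\<^sup>+x. ennreal ((g (x - s / real (Suc n)))\<^sup>2) * ennreal (bump s) \<partial>lborel) \<partial>lborel)"
      by (rule lborel_pair.Fubini'[symmetric]) measurable
    also have "\<dots> = (\<integral>\<^sup>+s. G * ennreal (bump s) \<partial>lborel)"
    proof (rule nn_integral_cong)
      fix s :: real
      have "(\<integral>\<^sup>+x. ennreal ((g (x - s / real (Suc n)))\<^sup>2) * ennreal (bump s) \<partial>lborel) =
        (\<integral>\<^sup>+x. ennreal ((g (x - s / real (Suc n)))\<^sup>2) \<partial>lborel) * ennreal (bump s)"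
        by (rule nn_integral_multc) measurable
      also have "(\<integral>\<^sup>+x. ennreal ((g (x - s / real (Suc n)))\<^sup>2) \<partial>lborel) = G"
        unfolding G_def using nn_integral_real_affine[of "\<lambda>x. ennreal ((g x)\<^sup>2)" 1 "- s / real (Suc n)"]
        by (simp add: add.commute)
      finally show "(\<integral>\<^sup>+x. ennreal ((g (x - s / real (Suc n)))\<^sup>2) * ennreal (bump s) \<partial>lborel) = G * ennreal (bump s)" .
    qed
    also have "\<dots> = G * (\<integral>\<^sup>+s. ennreal (bump s) \<partial>lborel)" by (rule nn_integral_cmult) measurable
    also have "(\<integral>\<^sup>+s. ennreal (bump s) \<partial>lborel) = ennreal K"
      unfolding K_def by (rule nn_integral_eq_integral[OF integrable_bump]) (simp add: bump_ge_0)
    finally show ?thesis .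
  qed
  have "(\<integral>\<^sup>+x. ennreal ((w' x * K)\<^sup>2) \<partial>lborel) = (\<integral>\<^sup>+x. liminf (\<lambda>n. ennreal ((m n x)\<^sup>2)) \<partial>lborel)"
  proof (rule nn_integral_cong)
    fix x
    have "(\<lambda>n. m n x) \<longlonglongrightarrow> w' x * K" using lim[of x] by (simp add: K_def)
    then have "(\<lambda>n. ennreal ((m n x)\<^sup>2)) \<longlonglongrightarrow> ennreal ((w' x * K)\<^sup>2)" by (intro tendsto_intros)
    then show "ennreal ((w' x * K)\<^sup>2) = liminf (\<lambda>n. ennreal ((m n x)\<^sup>2))"
      by (intro lim_imp_Liminf[symmetric]) auto
  qed
  also have "\<dots> \<le> liminf (\<lambda>n. \<integral>\<^sup>+x. ennreal ((m n x)\<^sup>2) \<partial>lborel)"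
    by (rule nn_integral_liminf) measurable
  also have "\<dots> \<le> ennreal K * (G * ennreal K)"
    by (rule order_trans[OF Liminf_le_Limsup Limsup_bounded]) (auto intro!: always_eventually total)
  also have "\<dots> < \<infinity>" using G by (simp add: ennreal_mult_less_top)
  finally have "integrable lborel (\<lambda>x. (w' x * K)\<^sup>2)"
    by (intro integrableI_bounded) auto
  then have "integrable lborel (\<lambda>x. (1 / K\<^sup>2) * (w' x * K)\<^sup>2)" by (intro integrable_mult_right)
  then show ?thesis using K by (simp add: square_integrable_def power_mult_distrib)
qed

lemma l2_holder_mult:
  assumes b: "l2_holder \<alpha> b" and d: "l2_holder \<alpha> d"
  shows "l2_holder \<alpha> (\<lambda>t. b t * d t)"
proof -
  obtain B D where B: "B > 0" "\<And>x. \<bar>b x\<bar> \<le> B" and D: "D > 0" "\<And>x. \<bar>d x\<bar> \<le> D"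
    using l2_holder_bound[OF b] l2_holder_bound[OF d] by metis
  obtain C E where C: "C > 0" "\<And>x t. \<bar>x - t\<bar> \<le> 1 \<Longrightarrow> \<bar>b x - b t\<bar> \<le> C * \<bar>x - t\<bar> powr \<alpha>"
    and E: "E > 0" "\<And>x t. \<bar>x - t\<bar> \<le> 1 \<Longrightarrow> \<bar>d x - d t\<bar> \<le> E * \<bar>x - t\<bar> powr \<alpha>"
    using l2_holder_modulus[OF b] l2_holder_modulus[OF d] by metis
  have [measurable]: "b \<in> borel_measurable borel" "d \<in> borel_measurable borel"
    using b d by (auto intro: l2_holder_measurable)
  have "integrable lborel (\<lambda>x. (b x * d x)\<^sup>2)"
  proof (rule Bochner_Integration.integrable_bound[OF integrable_mult_right[OF l2_holder_integrable[OF d], of "B\<^sup>2"]])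
    have "(b x)\<^sup>2 \<le> B\<^sup>2" for x using B abs_le_square_iff[of "b x" B] by simp
    then show "AE x in lborel. norm ((b x * d x)\<^sup>2) \<le> norm (B\<^sup>2 * (d x)\<^sup>2)"
      by (auto simp: power_mult_distrib intro!: mult_right_mono)
  qed simp
  moreover have "\<bar>b x * d x\<bar> \<le> B * D" for x
    unfolding abs_mult using B D by (intro mult_mono) auto
  moreover have "\<bar>b x * d x - b t * d t\<bar> \<le> (B * E + C * D) * \<bar>x - t\<bar> powr \<alpha>" if "\<bar>x - t\<bar> \<le> 1" for x t
  proof -
    have "b x * d x - b t * d t = b x * (d x - d t) + (b x - b t) * d t" by (simp add: algebra_simps)
    then have "\<bar>b x * d x - b t * d t\<bar> \<le> \<bar>b x\<bar> * \<bar>d x - d t\<bar> + \<bar>b x - b t\<bar> * \<bar>d t\<bar>"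
      by (metis abs_mult abs_triangle_ineq)
    also have "\<dots> \<le> B * (E * \<bar>x - t\<bar> powr \<alpha>) + (C * \<bar>x - t\<bar> powr \<alpha>) * D"
      using B D C(2)[OF that] E(2)[OF that] by (intro add_mono mult_mono) (auto simp: C(1) E(1) less_imp_le)
    finally show ?thesis by (simp add: algebra_simps)
  qed
  ultimately show ?thesis unfolding l2_holder_def square_integrable_def by (intro conjI exI allI impI) (assumption | simp)+
qed

lemma l2_holder_linear:
  assumes b: "l2_holder \<alpha> b" and d: "l2_holder \<alpha> d"
  shows "l2_holder \<alpha> (\<lambda>t. p * b t + q * d t)"
proof -
  obtain B D where B: "B > 0" "\<And>x. \<bar>b x\<bar> \<le> B" and D: "D > 0" "\<And>x. \<bar>d x\<bar> \<le> D"
    using l2_holder_bound[OF b] l2_holder_bound[OF d] by metis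
  obtain C E where C: "C > 0" "\<And>x t. \<bar>x - t\<bar> \<le> 1 \<Longrightarrow> \<bar>b x - b t\<bar> \<le> C * \<bar>x - t\<bar> powr \<alpha>"
    and E: "E > 0" "\<And>x t. \<bar>x - t\<bar> \<le> 1 \<Longrightarrow> \<bar>d x - d t\<bar> \<le> E * \<bar>x - t\<bar> powr \<alpha>"
    using l2_holder_modulus[OF b] l2_holder_modulus[OF d] by metis
  have [measurable]: "b \<in> borel_measurable borel" "d \<in> borel_measurable borel"
    using b d by (auto intro: l2_holder_measurable)
  have "integrable lborel (\<lambda>x. (p * b x + q * d x)\<^sup>2)"
  proof (rule Bochner_Integration.integrable_bound)
    show "integrable lborel (\<lambda>x. 2 * p\<^sup>2 * (b x)\<^sup>2 + 2 * q\<^sup>2 * (d x)\<^sup>2)"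
      by (intro Bochner_Integration.integrable_add integrable_mult_right l2_holder_integrable[OF b] l2_holder_integrable[OF d])
    have "(p * b x + q * d x)\<^sup>2 \<le> 2 * p\<^sup>2 * (b x)\<^sup>2 + 2 * q\<^sup>2 * (d x)\<^sup>2" for x
    proof -
      have "0 \<le> (p * b x - q * d x)\<^sup>2" by simp
      then show ?thesis by (simp add: power2_eq_square algebra_simps)
    qed
    then show "AE x in lborel. norm ((p * b x + q * d x)\<^sup>2) \<le> norm (2 * p\<^sup>2 * (b x)\<^sup>2 + 2 * q\<^sup>2 * (d x)\<^sup>2)"
      by auto
  qed simp
  moreover have "\<bar>p * b x + q * d x\<bar> \<le> \<bar>p\<bar> * B + \<bar>q\<bar> * D" for x
  proof -
    have "\<bar>p * b x\<bar> \<le> \<bar>p\<bar> * B" "\<bar>q * d x\<bar> \<le> \<bar>q\<bar> * D"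
      unfolding abs_mult using B D by (auto intro: mult_left_mono)
    then show ?thesis by linarith
  qed
  moreover have "\<bar>p * b x + q * d x - (p * b t + q * d t)\<bar> \<le> (\<bar>p\<bar> * C + \<bar>q\<bar> * E) * \<bar>x - t\<bar> powr \<alpha>" if "\<bar>x - t\<bar> \<le> 1" for x t
  proof -
    have "\<bar>p * (b x - b t)\<bar> \<le> \<bar>p\<bar> * (C * \<bar>x - t\<bar> powr \<alpha>)" "\<bar>q * (d x - d t)\<bar> \<le> \<bar>q\<bar> * (E * \<bar>x - t\<bar> powr \<alpha>)"
      unfolding abs_mult using C(2)[OF that] E(2)[OF that] by (auto intro: mult_left_mono)
    moreover have "p * b x + q * d x - (p * b t + q * d t) = p * (b x - b t) + q * (d x - d t)"
      by (simp add: algebra_simps)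
    moreover have "(\<bar>p\<bar> * C + \<bar>q\<bar> * E) * \<bar>x - t\<bar> powr \<alpha> = \<bar>p\<bar> * (C * \<bar>x - t\<bar> powr \<alpha>) + \<bar>q\<bar> * (E * \<bar>x - t\<bar> powr \<alpha>)"
      by (simp add: algebra_simps)
    ultimately show ?thesis by linarith
  qed
  ultimately show ?thesis unfolding l2_holder_def square_integrable_def by (intro conjI exI allI impI) (assumption | simp)+
qed

lemma H1_C1_holder_regularity:
  assumes "w \<in> H1 \<inter> C1_holder \<alpha>" "0 < \<alpha>" "\<alpha> < 1"
  shows "(w has_real_derivative deriv w x) (at x)"
    and "l2_holder \<alpha> w" and "l2_holder \<alpha> (deriv w)"
proof -
  obtain D where D: "\<And>x. (w has_vector_derivative D x) (at x)" "continuous_on UNIV D"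
    using assms by (auto simp: C1_holder_def C1_differentiable_on_def)
  then have d: "(w has_real_derivative D x) (at x)" for x
    by (simp add: has_real_derivative_iff_has_vector_derivative)
  have DD: "deriv w = D" using d by (auto simp: fun_eq_iff DERIV_imp_deriv)
  show "(w has_real_derivative deriv w x) (at x)" by (simp add: DD d)
  obtain B1 where B1: "\<And>x. \<bar>w x\<bar> \<le> B1"
    using assms by (auto simp: C1_holder_def bdd_above_def)
  obtain B2 where B2: "\<And>x. \<bar>D x\<bar> \<le> B2"
    using assms by (auto simp: C1_holder_def bdd_above_def DD)
  obtain C where C: "\<And>x t. x \<noteq> t \<Longrightarrow> \<bar>x - t\<bar> \<le> 1 \<Longrightarrow> \<bar>D x - D t\<bar> / \<bar>x - t\<bar> powr \<alpha> \<le> C"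
  proof -
    have "bdd_above {\<bar>D x - D t\<bar> / \<bar>x - t\<bar> powr \<alpha> | x t. x \<noteq> t \<and> \<bar>x - t\<bar> \<le> 1}"
      using assms by (simp add: C1_holder_def DD)
    then show ?thesis unfolding bdd_above_def using that by blast
  qed
  obtain g where g: "square_integrable g" "\<And>\<eta>. \<eta> C1_differentiable_on UNIV \<Longrightarrow> compact (closure {x. \<eta> x \<noteq> 0}) \<Longrightarrow>
          (LINT x | lborel. w x * deriv \<eta> x) = - (LINT x | lborel. g x * \<eta> x)"
    using assms by (auto simp: H1_def)
  have "square_integrable D"
    by (rule weak_derivative_square_integrable[OF d D(2) B2 g])
  moreover have "\<bar>D x - D t\<bar> \<le> C * \<bar>x - t\<bar> powr \<alpha>" if "\<bar>x - t\<bar> \<le> 1" for x t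
    using C[of x t] that by (cases "x = t") (auto simp: divide_simps mult_ac split: if_splits)
  ultimately show "l2_holder \<alpha> (deriv w)"
    unfolding l2_holder_def DD using B2 by blast
  have "\<bar>w x - w t\<bar> \<le> B2 * \<bar>x - t\<bar> powr \<alpha>" if "\<bar>x - t\<bar> \<le> 1" for x t
  proof -
    have "norm (w x - w t) \<le> B2 * norm (x - t)"
      using d B2 by (intro field_differentiable_bound[of UNIV]) auto
    moreover have "norm (x - t) \<le> \<bar>x - t\<bar> powr \<alpha>"
      using powr_mono'[of \<alpha> 1 "\<bar>x - t\<bar>"] that assms by (cases "x = t") auto
    then have "B2 * norm (x - t) \<le> B2 * \<bar>x - t\<bar> powr \<alpha>" using B2[of 0] by (intro mult_left_mono) auto
    ultimately show ?thesis by simp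
  qed
  moreover have "square_integrable w" using assms by (auto simp: H1_def)
  ultimately show "l2_holder \<alpha> w" unfolding l2_holder_def using B1 by blast
qed

section \<open>A maximum principle\<close>

text \<open>
  The maximum modulus principle for \<open>exp (- i f)\<close>, whose modulus is \<open>exp (Im f)\<close>, on the part of the
  domain inside a large disc.
\<close>
lemma Im_max_principle:
  assumes U: "open U" and f: "f holomorphic_on U" "continuous_on (closure U) f"
    and bd: "\<And>z. z \<in> frontier U \<Longrightarrow> Im (f z) \<le> 0"
    and infty: "\<And>e. e > 0 \<Longrightarrow> \<exists>R. \<forall>z\<in>closure U. R \<le> norm z \<longrightarrow> Im (f z) \<le> e"
    and z: "z \<in> U"
  shows "Im (f z) \<le> 0"
proof (rule field_le_epsilon)
  fix e :: real assume e: "e > 0"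
  from infty[OF e] obtain R where R: "\<And>z. z \<in> closure U \<Longrightarrow> R \<le> norm z \<Longrightarrow> Im (f z) \<le> e" by blast
  \<comment> \<open>The radius is larger than \<open>\<bar>z\<bar>\<close>, and on the circle the bound at infinity holds.\<close>
  define r where "r = max R (norm z) + 1"
  have r: "frontier (ball 0 r) = sphere (0::complex) r" 
  proof (rule frontier_ball)
    have "0 \<le> max R (norm z)" by (simp add: le_max_iff_disj)
    then show "0 < r" unfolding r_def by linarith
  qed
  define V where "V = U \<inter> ball 0 r"
  define g where "g z = exp (- \<i> * f z)" for z
  have g: "norm (g z) = exp (Im (f z))" for z by (simp add: g_def)
  have "norm (g z) \<le> exp e"
  proof (rule maximum_modulus_frontier[of g V])
    show "g holomorphic_on interior V"
      unfolding g_def using interior_subset[of V]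
      by (intro holomorphic_intros holomorphic_on_subset[OF f(1)]) (auto simp: V_def)
    show "continuous_on (closure V) g"
      unfolding g_def using closure_mono[of V U]
      by (intro continuous_intros continuous_on_subset[OF f(2)]) (auto simp: V_def)
    show "bounded V" unfolding V_def by (simp add: bounded_Int)
    show "z \<in> V" using z by (simp add: V_def r_def)
    show "norm (g x) \<le> exp e" if "x \<in> frontier V" for x
    proof -
      have x: "x \<in> closure U" "x \<in> frontier U \<or> norm x = r"
        using that closure_mono[of "U \<inter> ball 0 r" U] r unfolding V_def frontier_Int by auto
      from x(2) have "Im (f x) \<le> e"
      proof
        assume "x \<in> frontier U"
        then show ?thesis using bd[of x] e by linarith
      next
        assume "norm x = r"
        then show ?thesis using R[OF x(1)] by (simp add: r_def)
      qed
      then show ?thesis by (simp add: g)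
    qed
  qed
  then show "Im (f z) \<le> 0 + e" by (simp add: g)
qed

lemma real_valued_holomorphic_constant:
  assumes U: "open U" "connected U" and f: "f holomorphic_on U" and re: "\<And>z. z \<in> U \<Longrightarrow> Im (f z) = 0"
  shows "f constant_on U"
proof (rule ccontr)
  assume nc: "\<not> f constant_on U"
  then have "U \<noteq> {}" by (auto simp: constant_on_def)
  have "open (f ` U)" using open_mapping_thm[OF f U U(1) order_refl nc] .
  moreover have "interior (f ` U) = {}"
  proof -
    have "f ` U \<subseteq> {z. \<i> \<bullet> z = 0}" using re by (auto simp: inner_complex_def)
    then have "interior (f ` U) \<subseteq> interior {z. \<i> \<bullet> z = 0}" by (rule interior_mono)
    also have "\<dots> = {}" by (rule interior_hyperplane) simp
    finally show ?thesis by blast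
  qed
  ultimately show False using \<open>U \<noteq> {}\<close> by (auto simp: interior_open)
qed

section \<open>Domains below graphs\<close>

definition subgraph :: "(real \<Rightarrow> real) \<Rightarrow> complex set" where
  "subgraph h = {z. Im z < h (Re z)}"

lemma lower_half_plane_subgraph: "lower_half_plane = subgraph (\<lambda>_. 0)"
  by (simp add: lower_half_plane_def subgraph_def)

lemma subgraph_shift:
  "Im z \<le> h (Re z) \<Longrightarrow> \<delta> > 0 \<Longrightarrow> z - \<i> * of_real \<delta> \<in> subgraph h"
  by (simp add: subgraph_def)

context
  fixes h :: "real \<Rightarrow> real"
  assumes h: "continuous_on UNIV h"
begin

lemma continuous_height: "continuous_on A (\<lambda>z. h (Re z))"
  by (intro continuous_on_compose2[OF h] continuous_intros) auto

lemma open_subgraph: "open (subgraph h)"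
  unfolding subgraph_def by (intro open_Collect_less continuous_height continuous_intros)

lemma closure_subgraph: "closure (subgraph h) = {z. Im z \<le> h (Re z)}"
proof
  have "closed {z. Im z \<le> h (Re z)}"
    by (intro closed_Collect_le continuous_height continuous_intros)
  then show "closure (subgraph h) \<subseteq> {z. Im z \<le> h (Re z)}"
    by (intro closure_minimal) (auto simp: subgraph_def)
  show "{z. Im z \<le> h (Re z)} \<subseteq> closure (subgraph h)"
  proof clarify
    fix z assume z: "Im z \<le> h (Re z)"
    have "(\<lambda>n. z - \<i> * of_real (inverse (real (Suc n)))) \<longlonglongrightarrow> z - \<i> * of_real 0"
      by (intro tendsto_intros LIMSEQ_inverse_real_of_nat)
    moreover have "z - \<i> * of_real (inverse (real (Suc n))) \<in> subgraph h" for n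
      using z by (intro subgraph_shift) auto
    ultimately show "z \<in> closure (subgraph h)" unfolding closure_sequential by (intro exI conjI allI) auto
  qed
qed

lemma frontier_subgraph: "frontier (subgraph h) = {z. Im z = h (Re z)}"
  unfolding frontier_def closure_subgraph interior_open[OF open_subgraph]
  by (auto simp: subgraph_def)

lemma connected_subgraph: "connected (subgraph h)"
proof -
  have "connected ((\<lambda>z. z + \<i> * of_real (h (Re z))) ` {z. Im z < 0})"
    by (intro connected_continuous_image convex_connected convex_halfspace_Im_lt continuous_intros continuous_height)
  also have "(\<lambda>z. z + \<i> * of_real (h (Re z))) ` {z. Im z < 0} = subgraph h"
  proof (intro equalityI subsetI)
    fix z assume "z \<in> subgraph h"
    then show "z \<in> (\<lambda>z. z + \<i> * of_real (h (Re z))) ` {z. Im z < 0}"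
      by (intro image_eqI[of _ _ "z - \<i> * of_real (h (Re z))"]) (auto simp: subgraph_def)
  qed (auto simp: subgraph_def)
  finally show ?thesis .
qed

text \<open>
  The curve may run along the boundary, where \<open>F\<close> has no complex derivative. Shifted downwards by
  \<open>\<delta> > 0\<close> it lies in the open domain, where the fundamental theorem of calculus applies; both sides
  are continuous in \<open>\<delta>\<close> at \<open>0\<close>.
\<close>
lemma FTC_along_boundary_curve:
  fixes F D :: "complex \<Rightarrow> complex" and \<gamma> :: "real \<Rightarrow> complex"
  assumes F: "\<And>z. z \<in> subgraph h \<Longrightarrow> (F has_field_derivative D z) (at z)"
    and cF: "continuous_on (closure (subgraph h)) F" and cD: "continuous_on (closure (subgraph h)) D"
    and \<gamma>: "\<And>t. (\<gamma> has_vector_derivative \<gamma>' t) (at t)" and c\<gamma>': "continuous_on UNIV \<gamma>'"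
    and in_closure: "\<And>t. \<gamma> t \<in> closure (subgraph h)"
  shows "((\<lambda>t. F (\<gamma> t)) has_vector_derivative D (\<gamma> t) * \<gamma>' t) (at t)"
proof -
  let ?C = "closure (subgraph h)"
  have c\<gamma>: "continuous_on A \<gamma>" for A
    using \<gamma> by (meson continuous_at_imp_continuous_on has_vector_derivative_continuous)
  have sh: "\<gamma> t - \<i> * of_real \<delta> \<in> ?C" if "\<delta> \<ge> 0" for t \<delta>
    using in_closure[of t] that by (simp add: closure_subgraph)
  have sh': "\<gamma> t - \<i> * of_real \<delta> \<in> subgraph h" if "\<delta> > 0" for t \<delta>
    using in_closure[of t] that by (intro subgraph_shift) (simp_all add: closure_subgraph)
  have int: "F (\<gamma> b) = F (\<gamma> a) + integral {a..b} (\<lambda>t. D (\<gamma> t) * \<gamma>' t)" if "a \<le> b" for a b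
  proof -
    define p where "p \<delta> = F (\<gamma> b - \<i> * of_real \<delta>) - F (\<gamma> a - \<i> * of_real \<delta>) -
       integral (cbox a b) (\<lambda>t. D (\<gamma> t - \<i> * of_real \<delta>) * \<gamma>' t)" for \<delta>
    have "continuous_on {0..1} p"
    proof -
      have "continuous_on ({0..1} \<times> cbox a b) (\<lambda>(\<delta>, t). D (\<gamma> t - \<i> * of_real \<delta>) * \<gamma>' t)"
        unfolding split_beta
        by (intro continuous_intros continuous_on_compose2[OF cD] continuous_on_compose2[OF c\<gamma>[of UNIV]]
            continuous_on_compose2[OF c\<gamma>']) (auto intro!: sh)
      from integral_continuous_on_param[OF this] show ?thesis
        unfolding p_def
        by (intro continuous_intros continuous_on_compose2[OF cF]) (auto intro!: sh)
    qed
    moreover have "closure {0<..1} = {0..1::real}" by simp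
    moreover have "p \<delta> = 0" if \<delta>: "\<delta> \<in> {0<..1}" for \<delta>
    proof -
      have "((\<lambda>t. D (\<gamma> t - \<i> * of_real \<delta>) * \<gamma>' t) has_integral
         F (\<gamma> b - \<i> * of_real \<delta>) - F (\<gamma> a - \<i> * of_real \<delta>)) {a..b}"
      proof (rule fundamental_theorem_of_calculus[OF \<open>a \<le> b\<close>])
        fix t
        have "((\<lambda>t. \<gamma> t - \<i> * of_real \<delta>) has_vector_derivative \<gamma>' t) (at t within {a..b})"
          using \<gamma>[of t] by (auto intro!: derivative_eq_intros intro: has_vector_derivative_at_within)
        from field_vector_diff_chain_within[OF this has_field_derivative_at_within[OF F[OF sh']]]
        show "((\<lambda>t. F (\<gamma> t - \<i> * of_real \<delta>)) has_vector_derivative D (\<gamma> t - \<i> * of_real \<delta>) * \<gamma>' t) (at t within {a..b})"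
          using \<delta> by (simp add: o_def mult.commute)
      qed
      then show ?thesis by (simp add: p_def integral_unique)
    qed
    ultimately have "p 0 = 0"
      using continuous_constant_on_closure[of "{0<..1}" p 0 0] by auto
    then have "F (\<gamma> b) - F (\<gamma> a) = integral {a..b} (\<lambda>t. D (\<gamma> t) * \<gamma>' t)" by (simp add: p_def)
    then show ?thesis by (metis add.commute diff_add_cancel)
  qed
  have cont: "continuous_on A (\<lambda>t. D (\<gamma> t) * \<gamma>' t)" for A
    by (intro continuous_intros continuous_on_compose2[OF cD c\<gamma>] continuous_on_subset[OF c\<gamma>'])
      (auto intro: in_closure)
  have "((\<lambda>u. F (\<gamma> (t - 1)) + integral {t-1..u} (\<lambda>t. D (\<gamma> t) * \<gamma>' t)) has_vector_derivative 0 + D (\<gamma> t) * \<gamma>' t) (at t within {t-1..t+1})"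
    by (intro has_vector_derivative_add has_vector_derivative_const integral_has_vector_derivative cont) auto
  then have "((\<lambda>t. F (\<gamma> t)) has_vector_derivative D (\<gamma> t) * \<gamma>' t) (at t within {t-1..t+1})"
    by (intro has_vector_derivative_transform[of t "{t-1..t+1}" "\<lambda>t. F (\<gamma> t)"]) (auto intro!: int)
  then show ?thesis by (simp add: at_within_Icc_at)
qed

text \<open>
  The extension is obtained by integrating the derivative along vertical segments of length 1 that
  start inside the domain.
\<close>
lemma continuous_primitive_extension:
  fixes F D :: "complex \<Rightarrow> complex"
  assumes F: "\<And>z. z \<in> subgraph h \<Longrightarrow> (F has_field_derivative D z) (at z)"
    and cD: "continuous_on (closure (subgraph h)) D"
  obtains F1 where "continuous_on (closure (subgraph h)) F1" "\<And>z. z \<in> subgraph h \<Longrightarrow> F1 z = F z"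
proof -
  let ?C = "closure (subgraph h)"
  define F1 where "F1 z = F (z - \<i>) + integral (cbox 0 1) (\<lambda>t. D (z - \<i> + \<i> * of_real t) * \<i>)" for z
  have cF: "continuous_on (subgraph h) F"
    using F by (meson DERIV_continuous_on has_field_derivative_at_within)
  have "continuous_on (?C \<times> cbox 0 1) (\<lambda>(z, t). D (z - \<i> + \<i> * of_real t) * \<i>)"
    unfolding split_beta
    by (intro continuous_intros continuous_on_compose2[OF cD]) (auto simp: closure_subgraph)
  from integral_continuous_on_param[OF this] have "continuous_on ?C F1"
    unfolding F1_def
    by (intro continuous_intros continuous_on_compose2[OF cF])
      (use subgraph_shift[of _ h 1] in \<open>auto simp: closure_subgraph\<close>)
  moreover have "F1 z = F z" if z: "z \<in> subgraph h" for z
  proof -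
    have "((\<lambda>t. D (z - \<i> + \<i> * of_real t) * \<i>) has_integral
       F (z - \<i> + \<i> * of_real 1) - F (z - \<i> + \<i> * of_real 0)) {0..1}"
    proof (rule fundamental_theorem_of_calculus)
      fix t :: real assume t: "t \<in> {0..1}"
      have "((\<lambda>t. z - \<i> + \<i> * of_real t) has_vector_derivative 0 + \<i> * 1) (at t within {0..1})"
        by (intro derivative_intros has_vector_derivative_add has_vector_derivative_mult_right)
          (use has_vector_derivative_of_real[OF DERIV_ident] in auto)
      then have "((\<lambda>t. z - \<i> + \<i> * of_real t) has_vector_derivative \<i>) (at t within {0..1})" by simp
      moreover have "z - \<i> + \<i> * of_real t \<in> subgraph h" using z t by (simp add: subgraph_def)
      ultimately show "((\<lambda>t. F (z - \<i> + \<i> * of_real t)) has_vector_derivative D (z - \<i> + \<i> * of_real t) * \<i>) (at t within {0..1})"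
        using field_vector_diff_chain_within[OF _ has_field_derivative_at_within[OF F]]
        by (fastforce simp add: o_def mult.commute)
    qed simp
    from integral_unique[OF this] show ?thesis by (simp only: F1_def box_real) simp
  qed
  ultimately show ?thesis using that by blast
qed

end

section \<open>Uniqueness in the half plane\<close>

lemma closure_lower: "closure {z::complex. Im z < 0} = {z. Im z \<le> 0}"
  using closure_subgraph[of "\<lambda>_. 0"] by (simp add: subgraph_def)

lemma lower_half_plane_simps:
  "open lower_half_plane" "connected lower_half_plane"
  "closure lower_half_plane = {z. Im z \<le> 0}" "frontier lower_half_plane = {z. Im z = 0}"
  by (simp_all add: lower_half_plane_subgraph open_subgraph closure_subgraph connected_subgraph frontier_subgraph)

text \<open>
  The maximum principle for \<open>f\<close> and \<open>-f\<close> makes \<open>f\<close> real-valued, and nonconstant holomorphic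
  functions are open.
\<close>
lemma real_boundary_values_imp_constant:
  assumes f: "f holomorphic_on {z. Im z < 0}" "continuous_on {z. Im z \<le> 0} f"
    and bd: "\<And>x. Im (f (of_real x)) = 0"
    and infty: "((\<lambda>z. Im (f z)) \<longlongrightarrow> 0) (inf at_infinity (principal {z. Im z \<le> 0}))"
  obtains c where "\<And>z. Im z \<le> 0 \<Longrightarrow> f z = of_real c"
proof -
  have bd': "Im (f z) = 0" if "Im z = 0" for z
    using bd[of "Re z"] that by (simp add: complex_is_Real_iff of_real_Re)
  have lim: "\<exists>R. \<forall>z\<in>{z. Im z \<le> 0}. R \<le> norm z \<longrightarrow> \<bar>Im (f z)\<bar> < e" if "e > 0" for e
    using infty that unfolding tendsto_inf_at_infinity_iff by simp
  have 1: "Im (f z) \<le> 0" if "Im z < 0" for z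
  proof (rule Im_max_principle[of lower_half_plane f])
    show "\<exists>R. \<forall>z\<in>closure lower_half_plane. R \<le> norm z \<longrightarrow> Im (f z) \<le> e" if "e > 0" for e
      using lim[OF that] unfolding lower_half_plane_simps by fastforce
  qed (use f that bd' lower_half_plane_simps in \<open>auto simp: lower_half_plane_def\<close>)
  have 2: "Im (- f z) \<le> 0" if "Im z < 0" for z
  proof (rule Im_max_principle[of lower_half_plane "\<lambda>z. - f z"])
    show "\<exists>R. \<forall>z\<in>closure lower_half_plane. R \<le> norm z \<longrightarrow> Im (- f z) \<le> e" if "e > 0" for e
      using lim[OF that] unfolding lower_half_plane_simps by fastforce
  qed (use f that bd' lower_half_plane_simps in \<open>auto simp: lower_half_plane_def intro!: holomorphic_intros continuous_intros\<close>)
  have "Im (f z) = 0" if "z \<in> {z. Im z < 0}" for z using 1[of z] 2[of z] that by simp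
  then have "f constant_on {z. Im z < 0}"
    using f by (intro real_valued_holomorphic_constant open_halfspace_Im_lt convex_connected convex_halfspace_Im_lt)
  then obtain c where c: "\<And>z. Im z < 0 \<Longrightarrow> f z = c" by (auto simp: constant_on_def)
  then have c': "f z = c" if "Im z \<le> 0" for z
    using continuous_constant_on_closure[of "{z. Im z < 0}" f c z] f(2) that by (simp add: closure_lower)
  have "c = of_real (Re c)" using bd[of 0] c'[of 0] by (simp add: complex_eq_iff)
  with c' that show ?thesis by metis
qed

lemma vanishing_real_boundary_values_imp_zero:
  assumes f: "f holomorphic_on {z. Im z < 0}" "continuous_on {z. Im z \<le> 0} f"
    and bd: "\<And>x. Im (f (of_real x)) = 0"
    and infty: "(f \<longlongrightarrow> 0) (inf at_infinity (principal {z. Im z \<le> 0}))"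
    and z: "Im z \<le> 0"
  shows "f z = 0"
proof -
  have "((\<lambda>z. Im (f z)) \<longlongrightarrow> Im 0) (inf at_infinity (principal {z. Im z \<le> 0}))"
    by (intro tendsto_intros infty)
  then have "((\<lambda>z. Im (f z)) \<longlongrightarrow> 0) (inf at_infinity (principal {z. Im z \<le> 0}))" by simp
  from real_boundary_values_imp_constant[OF f bd this]
  obtain c where c: "\<And>z. Im z \<le> 0 \<Longrightarrow> f z = of_real c" by blast
  have "c = 0"
  proof (rule ccontr)
    assume "c \<noteq> 0"
    then have "0 < \<bar>c\<bar>" by simp
    then obtain R where "\<And>z. Im z \<le> 0 \<Longrightarrow> R \<le> norm z \<Longrightarrow> norm (f z - 0) < \<bar>c\<bar>"
      using infty unfolding tendsto_inf_at_infinity_iff by blast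
    from this[of "of_real \<bar>R\<bar>"] c[of "of_real \<bar>R\<bar>"] show False by (simp add: abs_ge_self)
  qed
  with c z show ?thesis by simp
qed

section \<open>Extensions to the closure and proper maps\<close>

lemma ext_closure_eq:
  fixes f :: "complex \<Rightarrow> 'a::t2_space"
  assumes D: "continuous_on (closure U) D" and eq: "\<And>z. z \<in> U \<Longrightarrow> f z = D z" and z: "z \<in> closure U"
  shows "ext_closure U f z = D z"
proof (cases "z \<in> U")
  case False
  then have nt: "at z within U \<noteq> bot"
    using z by (simp add: trivial_limit_within closure_def)
  have "(D \<longlongrightarrow> D z) (at z within closure U)" using D z by (simp add: continuous_on_def)
  then have "(D \<longlongrightarrow> D z) (at z within U)" by (rule tendsto_within_subset[OF _ closure_subset])
  then have "(f \<longlongrightarrow> D z) (at z within U)"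
    by (rule Lim_transform_eventually) (auto simp: eventually_at_filter eq)
  then show ?thesis using False nt by (simp add: ext_closure_def tendsto_Lim)
qed (simp add: ext_closure_def eq)

lemma continuous_on_ext_closure:
  fixes f :: "complex \<Rightarrow> 'a::t2_space"
  assumes D: "continuous_on (closure U) D" and eq: "\<And>z. z \<in> U \<Longrightarrow> f z = D z"
  shows "continuous_on (closure U) (ext_closure U f)"
  by (rule continuous_on_eq[OF D]) (simp add: ext_closure_eq[OF D eq])

lemma proper_image_locally_compact:
  fixes f :: "complex \<Rightarrow> complex"
  assumes S: "closed S" and proper: "maps_infinity_to_infinity f S"
  obtains K where "compact K" "K \<subseteq> S" "f ` S \<inter> ball y 1 \<subseteq> f ` K"
proof -
  have "\<forall>\<^sub>F z in inf at_infinity (principal S). norm y + 1 \<le> norm (f z)"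
  proof -
    have "norm y + 1 > 0" using norm_ge_zero[of y] by linarith
    then show ?thesis
      using proper[unfolded maps_infinity_to_infinity_def, THEN filterlim_at_infinity[OF order_refl, THEN iffD1]]
      by blast
  qed
  then obtain R where R: "\<And>z. z \<in> S \<Longrightarrow> R \<le> norm z \<Longrightarrow> norm y + 1 \<le> norm (f z)"
    unfolding eventually_inf_principal eventually_at_infinity by blast
  show ?thesis
  proof (rule that)
    show "compact (S \<inter> cball 0 R)" using S by (intro closed_Int_compact) auto
    show "f ` S \<inter> ball y 1 \<subseteq> f ` (S \<inter> cball 0 R)"
    proof clarify
      fix x assume x: "x \<in> S" "f x \<in> ball y 1"
      have "norm (f x) < norm y + 1"
        using x(2) norm_triangle_ineq2[of "f x" y] by (simp add: dist_norm norm_minus_commute)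
      then show "f x \<in> f ` (S \<inter> cball 0 R)" using R[OF x(1)] x by force
    qed
  qed auto
qed

text \<open>
  Near a given point the image of a proper map is the image of a compact set. Hence proper images of
  closed sets are closed, and inverses of proper injections are continuous.
\<close>
lemma closed_proper_image:
  fixes f :: "complex \<Rightarrow> complex"
  assumes S: "closed S" and f: "continuous_on S f" and proper: "maps_infinity_to_infinity f S"
  shows "closed (f ` S)"
proof -
  have "y \<in> f ` S" if y: "y \<in> closure (f ` S)" for y
  proof -
    obtain K where K: "compact K" "K \<subseteq> S" "f ` S \<inter> ball y 1 \<subseteq> f ` K"
      using proper_image_locally_compact[OF S proper] by blast
    have "y \<in> ball y 1 \<inter> closure (f ` S)" using y by simp
    also have "\<dots> \<subseteq> closure (ball y 1 \<inter> f ` S)" by (rule open_Int_closure_subset) simp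
    also have "\<dots> \<subseteq> closure (f ` K)" using K(3) by (intro closure_mono) auto
    also have "\<dots> = f ` K"
      using K f by (intro closure_closed compact_imp_closed compact_continuous_image) (auto intro: continuous_on_subset)
    finally show ?thesis using K(2) by blast
  qed
  then show ?thesis using closure_subset_eq by blast
qed

lemma continuous_on_inv_into_proper:
  fixes f :: "complex \<Rightarrow> complex"
  assumes S: "closed S" and f: "continuous_on S f" "inj_on f S"
    and proper: "maps_infinity_to_infinity f S"
  shows "continuous_on (f ` S) (inv_into S f)"
proof (rule continuous_on_eq_continuous_within[THEN iffD2], rule ballI)
  fix y assume y: "y \<in> f ` S"
  obtain K where K: "compact K" "K \<subseteq> S" "f ` S \<inter> ball y 1 \<subseteq> f ` K"
    using proper_image_locally_compact[OF S proper] by blast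
  have "continuous_on (f ` K) (inv_into S f)"
    using f K(1,2) by (intro continuous_on_inv) (auto intro: continuous_on_subset inv_into_f_f)
  moreover have "y \<in> f ` K" using K(3) y by auto
  ultimately have "continuous (at y within f ` K) (inv_into S f)"
    using continuous_on_eq_continuous_within by blast
  then have "continuous (at y within (f ` S \<inter> ball y 1)) (inv_into S f)"
    by (rule continuous_within_subset) (use K(3) in auto)
  then show "continuous (at y within f ` S) (inv_into S f)"
    by (subst at_within_nhd[of y "ball y 1" _ "f ` S \<inter> ball y 1"]) auto
qed

section \<open>The complex potential of a flow below a graph\<close>

text \<open>
  A maximum over \<open>[a,b]\<close> cannot be attained at a point \<open>x < b\<close>, because \<open>f\<close> is larger immediately to
  the right of \<open>x\<close>; so the only maximum is at \<open>b\<close>.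
\<close>
lemma locally_increasing_imp_strict_mono:
  fixes f :: "real \<Rightarrow> real"
  assumes c: "continuous_on UNIV f"
    and inc: "\<And>x. \<forall>\<^sub>F y in at x. 0 < (f y - f x) * (y - x)"
  shows "strict_mono f"
proof (rule strict_monoI, rule ccontr)
  fix a b :: real assume ab: "a < b" "\<not> f a < f b"
  have "compact {a..b}" "{a..b} \<noteq> {}" "continuous_on {a..b} f"
    using ab c by (auto intro: continuous_on_subset)
  from continuous_attains_sup[OF this] obtain m where
    m: "m \<in> {a..b}" "\<And>y. y \<in> {a..b} \<Longrightarrow> f y \<le> f m" by blast
  have notlt: "\<not> x < b" if x: "x \<in> {a..b}" "\<And>y. y \<in> {a..b} \<Longrightarrow> f y \<le> f x" for x
  proof
    assume "x < b"
    obtain d where d: "d > 0" "\<And>y. y \<noteq> x \<Longrightarrow> dist y x < d \<Longrightarrow> 0 < (f y - f x) * (y - x)"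
      using inc[of x] unfolding eventually_at by auto
    define y where "y = min b (x + d / 2)"
    have y: "x < y" "y \<le> b" "dist y x < d" using \<open>x < b\<close> d by (auto simp: y_def dist_real_def min_def)
    then have "0 < (f y - f x) * (y - x)" using d(2)[of y] by auto
    then have "f x < f y" using y by (simp add: zero_less_mult_iff)
    then show False using x(2)[of y] y x(1) by auto
  qed
  have "m = b" using notlt[OF m] m(1) by auto
  then have "f y \<le> f a" if "y \<in> {a..b}" for y using m(2)[OF that] ab(2) unfolding \<open>m = b\<close> by linarith
  from notlt[OF _ this] show False using ab by auto
qed

lemma surj_if_tends_to_infinities:
  fixes f :: "real \<Rightarrow> real"
  assumes c: "continuous_on UNIV f" and f: "filterlim f at_top at_top" "filterlim f at_bot at_bot"
  shows "\<exists>x. f x = y"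
proof -
  obtain b where b: "y \<le> f b" "b \<ge> 0"
    using f(1) unfolding filterlim_at_top eventually_at_top_linorder by (metis linear)
  obtain a where a: "f a \<le> y" "a \<le> 0"
    using f(2) unfolding filterlim_at_bot eventually_at_bot_linorder by (metis linear)
  have "continuous_on {a..b} f" using c by (rule continuous_on_subset) simp
  from IVT'[OF a(1) b(1) _ this] a b show ?thesis by auto
qed

text \<open>
  The kinematic part of the wave problem: \<open>F\<close> is the complex potential, extended to the closure, and
  \<open>D\<close> its derivative; \<open>Im F\<close> is the stream function. Bernoulli's condition is added later.
\<close>
locale deep_flow =
  fixes h :: "real \<Rightarrow> real" and F D :: "complex \<Rightarrow> complex"
  assumes h_cont: "continuous_on UNIV h"
    and h_vanish: "(h \<longlongrightarrow> 0) at_infinity"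
    and F_deriv: "\<And>z. z \<in> subgraph h \<Longrightarrow> (F has_field_derivative D z) (at z)"
    and F_cont: "continuous_on (closure (subgraph h)) F"
    and D_cont: "continuous_on (closure (subgraph h)) D"
    and F_real: "\<And>z. Im z = h (Re z) \<Longrightarrow> Im (F z) = 0"
    and F_asymp: "((\<lambda>z. Im (F z) - Im z) \<longlongrightarrow> 0) (inf at_infinity (principal (closure (subgraph h))))"
begin

lemmas clos = closure_subgraph[OF h_cont]
lemmas op = open_subgraph[OF h_cont]

lemma F_hol: "F holomorphic_on subgraph h"
  using F_deriv op holomorphic_on_open by blast

lemma h_small: assumes "e > 0" obtains N where "N > 0" "\<And>x. N \<le> \<bar>x\<bar> \<Longrightarrow> \<bar>h x\<bar> < e"
proof -
  obtain R where "\<And>x. R \<le> \<bar>x\<bar> \<Longrightarrow> \<bar>h x\<bar> < e"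
    using h_vanish assms unfolding tendsto_at_infinity_iff_norm by auto
  then show ?thesis using that[of "max R 1"] by auto
qed

lemma h_bound: obtains B where "B > 0" "\<And>x. \<bar>h x\<bar> \<le> B"
proof -
  obtain N where N: "N > 0" "\<And>x. N \<le> \<bar>x\<bar> \<Longrightarrow> \<bar>h x\<bar> < 1" using h_small[of 1] by auto
  have "bounded (h ` {-N..N})"
    by (intro compact_imp_bounded compact_continuous_image continuous_on_subset[OF h_cont]) auto
  then obtain b where "\<forall>x\<in>{-N..N}. \<bar>h x\<bar> \<le> b" unfolding bounded_iff by auto
  then have b: "\<bar>h x\<bar> \<le> b" if "x \<in> {-N..N}" for x using that by blast
  have "\<bar>h x\<bar> \<le> max b 1" for x
  proof (cases "N \<le> \<bar>x\<bar>")
    case True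
    from N(2)[OF this] show ?thesis by linarith
  next
    case False
    then have "x \<in> {-N..N}" by auto
    from b[OF this] show ?thesis by linarith
  qed
  then show ?thesis using that[of "max b 1"] by auto
qed

lemma asymp: assumes "e > 0" obtains R where "R > 0" "\<And>z. Im z \<le> h (Re z) \<Longrightarrow> R \<le> norm z \<Longrightarrow> \<bar>Im (F z) - Im z\<bar> < e"
proof -
  obtain R where R: "\<And>z. Im z \<le> h (Re z) \<Longrightarrow> R \<le> norm z \<Longrightarrow> \<bar>Im (F z) - Im z\<bar> < e"
    using F_asymp assms unfolding tendsto_inf_at_infinity_iff clos by auto
  show ?thesis by (rule that[of "max R 1"]) (auto intro: R)
qed

lemma asymp_bound: obtains M where "M > 0" "\<And>z. Im z \<le> h (Re z) \<Longrightarrow> \<bar>Im (F z) - Im z\<bar> \<le> M"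
proof -
  obtain R where R: "R > 0" "\<And>z. Im z \<le> h (Re z) \<Longrightarrow> R \<le> norm z \<Longrightarrow> \<bar>Im (F z) - Im z\<bar> < 1" using asymp[of 1] by auto
  have "bounded ((\<lambda>z. Im (F z) - Im z) ` (closure (subgraph h) \<inter> cball 0 R))"
    by (intro compact_imp_bounded compact_continuous_image closed_Int_compact continuous_intros
        continuous_on_subset[OF F_cont]) auto
  then obtain b where "\<forall>z\<in>{z. Im z \<le> h (Re z)} \<inter> cball 0 R. \<bar>Im (F z) - Im z\<bar> \<le> b"
    unfolding bounded_iff clos by auto
  then have b: "\<bar>Im (F z) - Im z\<bar> \<le> b" if "Im z \<le> h (Re z)" "norm z \<le> R" for z using that by simp
  have "\<bar>Im (F z) - Im z\<bar> \<le> max b 1" if "Im z \<le> h (Re z)" for z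
    using R(2)[OF that] b[OF that] by (cases "R \<le> norm z") (auto simp: le_max_iff_disj)
  then show ?thesis using that[of "max b 1"] by auto
qed

lemma Im_le_0: assumes "Im z \<le> h (Re z)" shows "Im (F z) \<le> 0"
proof (cases "Im z < h (Re z)")
  case True
  show ?thesis
  proof (rule Im_max_principle[OF op F_hol F_cont])
    show "Im (F z) \<le> 0" if "z \<in> frontier (subgraph h)" for z
      using that F_real[of z] by (simp add: frontier_subgraph[OF h_cont])
    show "\<exists>R. \<forall>z\<in>closure (subgraph h). R \<le> norm z \<longrightarrow> Im (F z) \<le> e" if e: "e > 0" for e
    proof -
      have e2: "e / 2 > 0" using e by simp
      obtain R where R: "R > 0" "\<And>z. Im z \<le> h (Re z) \<Longrightarrow> R \<le> norm z \<Longrightarrow> \<bar>Im (F z) - Im z\<bar> < e / 2"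
        using asymp[OF e2] by blast
      obtain N where N: "N > 0" "\<And>x. N \<le> \<bar>x\<bar> \<Longrightarrow> \<bar>h x\<bar> < e / 2" using h_small[OF e2] by blast
      obtain B where B: "B > 0" "\<And>x. \<bar>h x\<bar> \<le> B" using h_bound by blast
      have "Im (F z) \<le> e" if z: "Im z \<le> h (Re z)" "R + N + B + 1 \<le> norm z" for z
      proof -
        have "Im z \<le> e / 2"
        proof (cases "N \<le> \<bar>Re z\<bar>")
          case True then show ?thesis using N(2)[OF True] z(1) by linarith
        next
          case False
          then have "B + 1 < \<bar>Im z\<bar>" using z(2) cmod_le[of z] R(1) by linarith
          then show ?thesis using z(1) B(2)[of "Re z"] e2 by linarith
        qed
        then show ?thesis using R(2)[OF z(1)] z(2) N(1) B(1) by linarith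
      qed
      then show ?thesis unfolding clos by auto
    qed
    show "z \<in> subgraph h" using True by (simp add: subgraph_def)
  qed
next
  case False
  then show ?thesis using assms F_real[of z] by simp
qed

text \<open>
  The difference of the stream function shifted by \<open>\<delta>\<close> and the stream function itself is nonpositive
  on the surface by \<open>Im_le_0\<close>, and tends to \<open>-\<delta>\<close> at infinity.
\<close>
lemma Im_mono_weak:
  assumes z: "Im z \<le> h (Re z)" and \<delta>: "\<delta> > 0"
  shows "Im (F (z - \<i> * of_real \<delta>)) \<le> Im (F z)"
proof (cases "Im z < h (Re z)")
  case True
  let ?f = "\<lambda>z. F (z - \<i> * of_real \<delta>) - F z"
  have "Im (?f z) \<le> 0"
  proof (rule Im_max_principle[OF op, of ?f])
    show "?f holomorphic_on subgraph h"
    proof (intro holomorphic_intros F_hol)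
      show "(\<lambda>z. F (z - \<i> * of_real \<delta>)) holomorphic_on subgraph h"
        by (rule holomorphic_on_compose_gen[OF _ F_hol, of "\<lambda>z. z - \<i> * of_real \<delta>", unfolded o_def])
          (use \<delta> in \<open>auto intro!: holomorphic_intros simp: subgraph_def\<close>)
    qed
    show "continuous_on (closure (subgraph h)) ?f"
      by (intro continuous_intros F_cont continuous_on_compose2[OF F_cont])
        (use \<delta> in \<open>auto simp: clos\<close>)
    show "Im (?f z) \<le> 0" if "z \<in> frontier (subgraph h)" for z
      using that F_real[of z] Im_le_0[of "z - \<i> * of_real \<delta>"] \<delta> by (simp add: frontier_subgraph[OF h_cont])
    show "\<exists>R. \<forall>z\<in>closure (subgraph h). R \<le> norm z \<longrightarrow> Im (?f z) \<le> e" if e: "e > 0" for e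
    proof -
      obtain R where R: "R > 0" "\<And>z. Im z \<le> h (Re z) \<Longrightarrow> R \<le> norm z \<Longrightarrow> \<bar>Im (F z) - Im z\<bar> < e / 2"
        using asymp[of "e / 2"] e by auto
      have "Im (?f z) \<le> e" if z: "Im z \<le> h (Re z)" "R + \<delta> \<le> norm z" for z
      proof -
        have "norm z - norm (\<i> * of_real \<delta>) \<le> norm (z - \<i> * of_real \<delta>)" by (rule norm_triangle_ineq2)
        then have "R \<le> norm (z - \<i> * of_real \<delta>)" using z \<delta> by (simp add: norm_mult)
        from R(2)[OF _ this] z(1) \<delta> have "\<bar>Im (F (z - \<i> * of_real \<delta>)) - (Im z - \<delta>)\<bar> < e / 2" by simp
        moreover have "\<bar>Im (F z) - Im z\<bar> < e / 2" using R(2)[OF z(1)] z(2) \<delta> by simp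
        ultimately show ?thesis using \<delta> unfolding minus_complex.sel by linarith
      qed
      then show ?thesis unfolding clos by auto
    qed
    show "z \<in> subgraph h" using True by (simp add: subgraph_def)
  qed
  then show ?thesis by simp
next
  case False
  then show ?thesis using assms F_real[of z] Im_le_0[of "z - \<i> * of_real \<delta>"] by simp
qed

lemma vertical_derivative:
  assumes "Complex X t \<in> subgraph h"
  shows "((\<lambda>t. Im (F (Complex X t))) has_real_derivative Re (D (Complex X t))) (at t)"
proof -
  have "((\<lambda>t. Complex X t) has_vector_derivative \<i>) (at t)"
  proof -
    have "((\<lambda>t. of_real X + \<i> * of_real t) has_vector_derivative 0 + \<i> * 1) (at t)"
      by (intro derivative_intros has_vector_derivative_add has_vector_derivative_mult_right)
        (use has_vector_derivative_of_real[OF DERIV_ident] in auto)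
    then show ?thesis by (simp add: Complex_eq)
  qed
  from field_vector_diff_chain_at[OF this F_deriv[OF assms]]
  have "((\<lambda>t. F (Complex X t)) has_vector_derivative \<i> * D (Complex X t)) (at t)" by (simp add: o_def)
  then have "((\<lambda>t. Im (F (Complex X t))) has_vector_derivative Im (\<i> * D (Complex X t))) (at t)"
    by (rule bounded_linear.has_vector_derivative[OF bounded_linear_Im])
  then show ?thesis by (simp add: has_real_derivative_iff_has_vector_derivative)
qed

lemma Re_D_nonneg: assumes "z \<in> subgraph h" shows "0 \<le> Re (D z)"
proof (rule ccontr)
  assume neg: "\<not> 0 \<le> Re (D z)"
  have "((\<lambda>t. Im (F (Complex (Re z) t))) has_real_derivative Re (D z)) (at (Im z))"
    using vertical_derivative[of "Re z" "Im z"] assms by simp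
  from DERIV_neg_dec_left[OF this] neg obtain d where
    d: "d > 0" "\<And>k. 0 < k \<Longrightarrow> k < d \<Longrightarrow> Im (F z) < Im (F (Complex (Re z) (Im z - k)))"
    by (auto simp: not_le)
  have "Complex (Re z) (Im z - d / 2) = z - \<i> * of_real (d / 2)" by (simp add: complex_eq_iff)
  then show False using d(2)[of "d / 2"] Im_mono_weak[of z "d / 2"] assms d(1) by (auto simp: subgraph_def)
qed

lemma D_hol: "D holomorphic_on subgraph h"
proof -
  have "deriv F holomorphic_on subgraph h" using F_hol op by (rule holomorphic_deriv)
  then show ?thesis by (rule holomorphic_transform) (simp add: DERIV_imp_deriv F_deriv)
qed

text \<open>
  \<open>Re D\<close> is the vertical derivative of the stream function, so it is nonnegative. If it vanished
  somewhere, \<open>D\<close> would be constant by the open mapping theorem, and the stream function would not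
  decrease with the depth.
\<close>
lemma Re_D_pos: assumes z: "z \<in> subgraph h" shows "0 < Re (D z)"
proof (rule ccontr)
  assume "\<not> 0 < Re (D z)"
  then have D0: "Re (D z) = 0" using Re_D_nonneg[OF z] by simp
  have "D constant_on subgraph h"
  proof (rule ccontr)
    assume "\<not> D constant_on subgraph h"
    from open_mapping_thm[OF D_hol op connected_subgraph[OF h_cont] op order_refl this]
    have "open (D ` subgraph h)" .
    then obtain e where e: "e > 0" "ball (D z) e \<subseteq> D ` subgraph h"
      using z unfolding open_contains_ball by blast
    have "D z - of_real (e / 2) \<in> ball (D z) e" using e(1) by (simp add: dist_norm)
    then have "D z - of_real (e / 2) \<in> D ` subgraph h" using e(2) by blast
    then obtain y where "y \<in> subgraph h" "D y = D z - of_real (e / 2)" by fastforce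
    then show False using Re_D_nonneg[of y] D0 e(1) by simp
  qed
  then have Re0: "Re (D y) = 0" if "y \<in> subgraph h" for y
    using D0 z that unfolding constant_on_def by metis
  define T where "T = {..Im z}"
  have sub: "Complex (Re z) t \<in> subgraph h" if "t \<in> T" for t
    using that z by (auto simp: T_def subgraph_def)
  have "\<exists>c. \<forall>t\<in>T. Im (F (Complex (Re z) t)) = c"
  proof (rule has_field_derivative_zero_constant)
    show "((\<lambda>t. Im (F (Complex (Re z) t))) has_real_derivative 0) (at t within T)" if "t \<in> T" for t
      using vertical_derivative[OF sub[OF that]] Re0[OF sub[OF that]] by (simp add: has_field_derivative_at_within)
  qed (simp add: T_def)
  then obtain c where c: "\<And>t. t \<le> Im z \<Longrightarrow> Im (F (Complex (Re z) t)) = c" by (auto simp: T_def)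
  obtain M where M: "M > 0" "\<And>z. Im z \<le> h (Re z) \<Longrightarrow> \<bar>Im (F z) - Im z\<bar> \<le> M" using asymp_bound by blast
  define t where "t = min (Im z) (c - M - 1)"
  have "t \<in> T" by (simp add: t_def T_def)
  from sub[OF this] have "Im (Complex (Re z) t) \<le> h (Re (Complex (Re z) t))" by (simp add: subgraph_def)
  from M(2)[OF this] c[of t] show False by (simp add: t_def min_def split: if_splits)
qed

lemma Im_strict_mono:
  assumes "Y1 < Y2" "Y2 \<le> h X"
  shows "Im (F (Complex X Y1)) < Im (F (Complex X Y2))"
proof -
  define Y where "Y = (Y1 + Y2) / 2"
  have Y: "Y1 < Y" "Y < Y2" "Y < h X" using assms by (auto simp: Y_def)
  have "Im (F (Complex X Y1)) < Im (F (Complex X Y))"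
  proof (rule DERIV_pos_imp_increasing[OF Y(1)])
    fix t assume "Y1 \<le> t" "t \<le> Y"
    then have "Complex X t \<in> subgraph h" using Y by (simp add: subgraph_def)
    then show "\<exists>y. ((\<lambda>t. Im (F (Complex X t))) has_real_derivative y) (at t) \<and> 0 < y"
      using vertical_derivative Re_D_pos by blast
  qed
  also have "Complex X Y = Complex X Y2 - \<i> * of_real (Y2 - Y)" by (simp add: complex_eq_iff)
  also have "Im (F \<dots>) \<le> Im (F (Complex X Y2))"
    using Y assms by (intro Im_mono_weak) auto
  finally show ?thesis .
qed

lemma Im_neg: assumes "z \<in> subgraph h" shows "Im (F z) < 0"
proof -
  have "Im (F (Complex (Re z) (Im z))) < Im (F (Complex (Re z) (h (Re z))))"
    using assms by (intro Im_strict_mono) (auto simp: subgraph_def)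
  also have "\<dots> = 0" by (rule F_real) simp
  finally show ?thesis by simp
qed

lemma level_exists:
  assumes "\<eta> < 0" shows "\<exists>Y. Y < h X \<and> Im (F (Complex X Y)) = \<eta>"
proof -
  obtain M where M: "M > 0" "\<And>z. Im z \<le> h (Re z) \<Longrightarrow> \<bar>Im (F z) - Im z\<bar> \<le> M" using asymp_bound by blast
  define a where "a = min (h X) (\<eta> - M)"
  have "Im (F (Complex X a)) \<le> \<eta>"
  proof -
    have "a \<le> h X" "a \<le> \<eta> - M" by (auto simp: a_def)
    then show ?thesis using M(2)[of "Complex X a"] by simp
  qed
  moreover have "\<eta> \<le> Im (F (Complex X (h X)))" using F_real[of "Complex X (h X)"] assms by simp
  moreover have "a \<le> h X" by (simp add: a_def)
  moreover have "continuous_on {a..h X} (\<lambda>Y. Im (F (Complex X Y)))"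
    unfolding Complex_eq
    by (intro continuous_intros continuous_on_compose2[OF F_cont]) (auto simp: clos)
  ultimately obtain Y where Y: "Y \<le> h X" "Im (F (Complex X Y)) = \<eta>"
    using IVT'[of "\<lambda>Y. Im (F (Complex X Y))" a \<eta> "h X"] by auto
  moreover have "Y \<noteq> h X" using Y(2) F_real[of "Complex X (h X)"] assms by auto
  ultimately show ?thesis by (metis order_le_less)
qed

definition level :: "real \<Rightarrow> real \<Rightarrow> real" where
  "level \<eta> X = (SOME Y. Y < h X \<and> Im (F (Complex X Y)) = \<eta>)"

lemma level:
  assumes "\<eta> < 0"
  shows "level \<eta> X < h X" "Im (F (Complex X (level \<eta> X))) = \<eta>" "Complex X (level \<eta> X) \<in> subgraph h"
  using someI_ex[OF level_exists[OF assms]] by (auto simp: level_def subgraph_def)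

lemma level_unique:
  assumes "\<eta> < 0" "z \<in> subgraph h" "Im (F z) = \<eta>"
  shows "z = Complex (Re z) (level \<eta> (Re z))"
proof -
  note l = level[OF assms(1), of "Re z"]
  have "\<not> Im z < level \<eta> (Re z)" "\<not> level \<eta> (Re z) < Im z"
    using Im_strict_mono[of "Im z" "level \<eta> (Re z)" "Re z"] Im_strict_mono[of "level \<eta> (Re z)" "Im z" "Re z"]
      l assms by (auto simp: subgraph_def)
  then show ?thesis by (simp add: complex_eq_iff)
qed

lemma level_continuous: assumes "\<eta> < 0" shows "continuous_on UNIV (level \<eta>)"
  unfolding continuous_on_iff
proof clarify
  fix X e :: real assume e: "e > 0"
  let ?y = "level \<eta> X"
  \<comment> \<open>Points up to \<open>d\<close> above the level line are still in the domain.\<close>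
  define d where "d = min (e / 2) ((h X - ?y) / 2)"
  have "d \<le> e / 2" "d \<le> (h X - ?y) / 2" unfolding d_def by (rule min.cobounded1, rule min.cobounded2)
  moreover have "d > 0" using e level(1)[OF assms, of X] by (simp add: d_def)
  ultimately have d: "d > 0" "d < e" "?y + d < h X" using e by (simp_all add: field_simps)
  have lt: "Im (F (Complex X (?y - d))) < \<eta>" "\<eta> < Im (F (Complex X (?y + d)))"
    using Im_strict_mono[of "?y - d" ?y X] Im_strict_mono[of ?y "?y + d" X] d level[OF assms, of X] by auto
  have cont: "isCont (\<lambda>x. Im (F (Complex x Y))) X" if "Y < h X" for Y
  proof -
    have "isCont F (Complex X Y)"
      using F_deriv[of "Complex X Y"] that by (auto simp: subgraph_def intro: DERIV_isCont)
    moreover have "isCont (\<lambda>x. Complex x Y) X" unfolding Complex_eq by (intro continuous_intros)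
    ultimately have "isCont (\<lambda>x. F (Complex x Y)) X" by (intro isCont_o2[of X "\<lambda>x. Complex x Y" F]) auto
    then show ?thesis by (rule bounded_linear.isCont[OF bounded_linear_Im])
  qed
  have "\<forall>\<^sub>F x in nhds X. Im (F (Complex x (?y - d))) < \<eta>"
    using cont[of "?y - d"] d lt(1) level(1)[OF assms, of X]
    by (intro order_tendstoD(2)[of _ "Im (F (Complex X (?y - d)))"]) (auto simp: continuous_at tendsto_nhds_iff)
  moreover have "\<forall>\<^sub>F x in nhds X. \<eta> < Im (F (Complex x (?y + d)))"
    using cont[of "?y + d"] d lt(2)
    by (intro order_tendstoD(1)[of _ "Im (F (Complex X (?y + d)))"]) (auto simp: continuous_at tendsto_nhds_iff)
  moreover have "\<forall>\<^sub>F x in nhds X. ?y + d < h x"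
  proof -
    have "(h \<longlongrightarrow> h X) (nhds X)"
      using h_cont by (simp add: continuous_on_eq_continuous_at continuous_at tendsto_nhds_iff)
    from order_tendstoD(1)[OF this d(3)] show ?thesis .
  qed
  ultimately have "\<forall>\<^sub>F x in nhds X. dist (level \<eta> x) ?y < e"
  proof eventually_elim
    case (elim x)
    note l = level[OF assms, of x]
    have "\<not> level \<eta> x \<le> ?y - d" using Im_strict_mono[of "level \<eta> x" "?y - d" x] elim l d by (auto simp: order_le_less)
    moreover have "\<not> ?y + d \<le> level \<eta> x" using Im_strict_mono[of "?y + d" "level \<eta> x" x] elim l d by (auto simp: order_le_less)
    ultimately show ?case using d by (auto simp: dist_real_def)
  qed
  then show "\<exists>d>0. \<forall>x\<in>UNIV. dist x X < d \<longrightarrow> dist (level \<eta> x) ?y < e"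
    unfolding eventually_nhds_metric by auto
qed

lemma level_curve_continuous:
  assumes "\<eta> < 0" shows "continuous_on A (\<lambda>X. Complex X (level \<eta> X))"
  unfolding Complex_eq
  by (intro continuous_intros continuous_on_subset[OF level_continuous[OF assms]]) auto

text \<open>
  Between two nearby points of a level line \<open>F\<close> has a real increment \<open>r\<close>, and the difference quotient
  is close to \<open>D\<close>, which has positive real part; so \<open>r\<close> has the sign of the horizontal increment.
\<close>
lemma potential_on_level_strict_mono:
  assumes "\<eta> < 0" shows "strict_mono (\<lambda>X. Re (F (Complex X (level \<eta> X))))"
proof (rule locally_increasing_imp_strict_mono)
  have "continuous_on (subgraph h) F" using F_hol by (rule holomorphic_on_imp_continuous_on)
  then show "continuous_on UNIV (\<lambda>X. Re (F (Complex X (level \<eta> X))))"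
    by (intro continuous_intros continuous_on_compose2[OF _ level_curve_continuous[OF assms]])
      (auto intro: level assms)
  fix X
  let ?c = "\<lambda>X. Complex X (level \<eta> X)"
  let ?z = "?c X"
  have "((\<lambda>z. Re ((F z - F ?z) / (z - ?z))) \<longlongrightarrow> Re (D ?z)) (at ?z)"
    using F_deriv[OF level(3)[OF assms, of X]] unfolding has_field_derivative_iff by (intro tendsto_intros)
  from order_tendstoD(1)[OF this Re_D_pos[OF level(3)[OF assms]]]
  have "\<forall>\<^sub>F z in at ?z. 0 < Re ((F z - F ?z) / (z - ?z))" .
  moreover have "filterlim ?c (at ?z) (at X)"
  proof -
    have "(?c \<longlongrightarrow> ?z) (at X)"
      using level_curve_continuous[OF assms, of UNIV] by (simp add: continuous_on_def)
    then show ?thesis unfolding filterlim_at by (simp add: eventually_at_filter)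
  qed
  ultimately have "\<forall>\<^sub>F x in at X. 0 < Re ((F (?c x) - F ?z) / (?c x - ?z))"
    by (rule eventually_compose_filterlim)
  then have "\<forall>\<^sub>F x in at X. x \<noteq> X \<and> 0 < Re ((F (?c x) - F ?z) / (?c x - ?z))"
    by (auto simp: eventually_at_filter)
  then show "\<forall>\<^sub>F x in at X. 0 < (Re (F (?c x)) - Re (F ?z)) * (x - X)"
  proof eventually_elim
    case (elim x)
    have "Im (F (?c x) - F ?z) = 0" using level(2)[OF assms] by simp
    then have "Re ((F (?c x) - F ?z) / (?c x - ?z)) =
       (Re (F (?c x)) - Re (F ?z)) * (x - X) / ((x - X)\<^sup>2 + (level \<eta> x - level \<eta> X)\<^sup>2)"
      by (simp add: Re_divide)
    then show ?case using elim sum_power2_ge_zero[of "x - X" "level \<eta> x - level \<eta> X"]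
      by (auto simp: zero_less_divide_iff)
  qed
qed

text \<open>
  Only the imaginary part of \<open>F z - z\<close> is known to be bounded, so Cauchy's inequality is applied to
  \<open>g = exp (- i (F z - z))\<close>, whose modulus lies between \<open>exp (-M)\<close> and \<open>exp M\<close>; the derivative of \<open>g\<close>
  is \<open>- i (D - 1) g\<close>.
\<close>
lemma deriv_estimate:
  assumes M: "\<And>z. Im z \<le> h (Re z) \<Longrightarrow> \<bar>Im (F z) - Im z\<bar> \<le> M"
    and r: "r > 0" "cball z r \<subseteq> subgraph h"
  shows "norm (D z - 1) \<le> exp (2 * M) / r"
proof -
  define g where "g w = exp (- \<i> * (F w - w))" for w
  have ng: "norm (g w) = exp (Im (F w) - Im w)" for w by (simp add: g_def)
  have sub: "Im w \<le> h (Re w)" if "w \<in> cball z r" for w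
    using that r(2) by (force simp: subgraph_def)
  have dg: "(g has_field_derivative - \<i> * (D w - 1) * g w) (at w)" if "w \<in> cball z r" for w
    unfolding g_def using F_deriv[of w] that r(2)
    by (auto intro!: derivative_eq_intros)
  have "norm ((deriv ^^ 1) g z) \<le> fact 1 * exp M / r ^ 1"
  proof (rule Cauchy_inequality[of g z r "exp M" 1])
    show "g holomorphic_on ball z r"
      unfolding holomorphic_on_open[OF open_ball]
    proof (intro ballI exI)
      fix w assume "w \<in> ball z r"
      then have "w \<in> cball z r" by simp
      then show "(g has_field_derivative - \<i> * (D w - 1) * g w) (at w)" by (rule dg)
    qed
    show "continuous_on (cball z r) g"
      by (rule DERIV_continuous_on) (rule has_field_derivative_at_within[OF dg])
    show "norm (g x) \<le> exp M" if "norm (z - x) = r" for x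
      using M[OF sub, of x] that by (auto simp: ng dist_norm)
  qed (rule r)
  then have "norm (D z - 1) * norm (g z) \<le> exp M / r"
    using dg[of z] r(1) by (simp add: DERIV_imp_deriv norm_mult)
  moreover have "exp (- M) \<le> norm (g z)" using M[OF sub, of z] r(1) by (auto simp: ng)
  then have "norm (D z - 1) * exp (- M) \<le> norm (D z - 1) * norm (g z)" by (intro mult_left_mono) auto
  ultimately have "norm (D z - 1) * exp (- M) \<le> exp M / r" by linarith
  then have "norm (D z - 1) * exp (- M) * exp M \<le> exp M / r * exp M" by (intro mult_right_mono) auto
  moreover have "norm (D z - 1) * exp (- M) * exp M = norm (D z - 1)" by (simp add: exp_minus)
  moreover have "exp M / r * exp M = exp (2 * M) / r" unfolding mult_2 exp_add by simp
  ultimately show ?thesis by (simp only:)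
qed

text \<open>
  The point of the level line above \<open>X\<close> is reached from \<open>-iL\<close> by a horizontal segment at depth \<open>L\<close>,
  where \<open>\<bar>D - 1\<bar> \<le> 1/2\<close>, followed by a vertical segment of bounded length. For large \<open>\<bar>X\<bar>\<close> the latter
  stays at a distance \<open>\<bar>\<eta>\<bar>/4\<close> from the surface, because the surface is asymptotically flat and the
  level line tends to the height \<open>\<eta>\<close>; so \<open>D - 1\<close> is bounded on it.
\<close>
lemma potential_on_level_asymp:
  assumes \<eta>: "\<eta> < 0"
  obtains K where "\<And>X. \<bar>Re (F (Complex X (level \<eta> X))) - X\<bar> \<le> \<bar>X\<bar> / 2 + K"
proof -
  obtain M where M: "M > 0" "\<And>z. Im z \<le> h (Re z) \<Longrightarrow> \<bar>Im (F z) - Im z\<bar> \<le> M" using asymp_bound by blast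
  obtain B where B: "B > 0" "\<And>x. \<bar>h x\<bar> \<le> B" using h_bound by blast
  \<comment> \<open>At depth \<open>L\<close> the disc of radius \<open>2 exp (2M)\<close> lies in the domain, which gives the bound \<open>1/2\<close>; the
    other summands keep the level line above this depth.\<close>
  define L where "L = B + 2 * exp (2 * M) + M + \<bar>\<eta>\<bar> + 1"
  have dE: "((\<lambda>z. F z - z) has_field_derivative D z - 1) (at z)" if "z \<in> subgraph h" for z
    using F_deriv[OF that] by (auto intro!: derivative_eq_intros)
  have deep: "cball z (2 * exp (2 * M)) \<subseteq> subgraph h" if "Im z \<le> - L" for z
  proof
    fix w assume "w \<in> cball z (2 * exp (2 * M))"
    then have "\<bar>Im (z - w)\<bar> \<le> 2 * exp (2 * M)"
      using abs_Im_le_cmod[of "z - w"] by (simp add: dist_norm)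
    then have "Im w \<le> - L + 2 * exp (2 * M)" using that by simp
    then show "w \<in> subgraph h" using B(2)[of "Re w"] M(1) by (simp add: subgraph_def L_def)
  qed
  have "L > 0" unfolding L_def using B M by (intro add_nonneg_pos add_nonneg_nonneg) auto
  have horiz: "norm ((F (Complex X (-L)) - Complex X (-L)) - (F (Complex 0 (-L)) - Complex 0 (-L))) \<le> 1/2 * norm (Complex X (-L) - Complex 0 (-L))" for X
  proof (rule field_differentiable_bound[of "{z. Im z \<le> - L}" "\<lambda>z. F z - z"])
    show "((\<lambda>z. F z - z) has_field_derivative D z - 1) (at z within {z. Im z \<le> - L})" if "z \<in> {z. Im z \<le> - L}" for z
    proof -
      have "z \<in> cball z (2 * exp (2 * M))" by simp
      then have "z \<in> subgraph h" using deep[of z] that by blast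
      then show ?thesis by (rule has_field_derivative_at_within[OF dE])
    qed
    show "norm (D z - 1) \<le> 1/2" if "z \<in> {z. Im z \<le> - L}" for z
      using deriv_estimate[OF M(2), of "2 * exp (2 * M)" z] deep[of z] that by simp
  qed (auto simp: convex_halfspace_Im_le)
  have "\<bar>\<eta>\<bar> / 4 > 0" using \<eta> by simp
  from asymp[OF this] obtain R where R: "R > 0" "\<And>z. Im z \<le> h (Re z) \<Longrightarrow> R \<le> norm z \<Longrightarrow> \<bar>Im (F z) - Im z\<bar> < \<bar>\<eta>\<bar> / 4" by blast
  from h_small[OF \<open>\<bar>\<eta>\<bar> / 4 > 0\<close>] obtain N where N: "N > 0" "\<And>x. N \<le> \<bar>x\<bar> \<Longrightarrow> \<bar>h x\<bar> < \<bar>\<eta>\<bar> / 4" by blast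
  \<comment> \<open>The bound for \<open>\<bar>D - 1\<bar>\<close> at a distance \<open>\<bar>\<eta>\<bar>/4\<close> from the surface.\<close>
  define A where "A = exp (2 * M) / (\<bar>\<eta>\<bar> / 4)"
  have A: "A > 0" unfolding A_def using \<eta> by (intro divide_pos_pos) auto
  let ?c = "\<lambda>X. Complex X (level \<eta> X)"
  have lev: "- L \<le> level \<eta> X" for X
    using M(2)[of "?c X"] level[OF \<eta>, of X] B(1) by (simp add: L_def) (smt (verit) exp_gt_zero)
  have vert: "norm ((F (?c X) - ?c X) - (F (Complex X (-L)) - Complex X (-L))) \<le> A * norm (?c X - Complex X (-L))"
    if X: "R + N + \<bar>\<eta>\<bar> \<le> \<bar>X\<bar>" for X
  proof (rule field_differentiable_bound[of "closed_segment (Complex X (-L)) (?c X)" "\<lambda>z. F z - z"])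
    have "\<bar>X\<bar> \<le> norm (?c X)" using abs_Re_le_cmod[of "?c X"] by simp
    then have l: "level \<eta> X \<le> - 3 / 4 * \<bar>\<eta>\<bar>"
      using R(2)[of "?c X"] level[OF \<eta>, of X] X N(1) \<eta> by auto
    have seg: "Re z = X" "Im z \<le> level \<eta> X" if "z \<in> closed_segment (Complex X (-L)) (?c X)" for z
      using that lev[of X] by (auto simp: closed_segment_same_Re closed_segment_eq_real_ivl)
    have sub: "cball z (\<bar>\<eta>\<bar> / 4) \<subseteq> subgraph h" if z: "z \<in> closed_segment (Complex X (-L)) (?c X)" for z
    proof
      fix w assume "w \<in> cball z (\<bar>\<eta>\<bar> / 4)"
      then have "\<bar>Im (z - w)\<bar> \<le> \<bar>\<eta>\<bar> / 4" "\<bar>Re (z - w)\<bar> \<le> \<bar>\<eta>\<bar> / 4"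
        using abs_Im_le_cmod[of "z - w"] abs_Re_le_cmod[of "z - w"] by (simp_all add: dist_norm)
      then have "Im w \<le> - \<bar>\<eta>\<bar> / 2" "N \<le> \<bar>Re w\<bar>" using seg[OF z] l X R(1) \<eta> by auto
      then show "w \<in> subgraph h" using N(2)[of "Re w"] \<eta> by (auto simp: subgraph_def)
    qed
    have mem: "z \<in> cball z (\<bar>\<eta>\<bar> / 4)" for z by simp
    show "((\<lambda>z. F z - z) has_field_derivative D z - 1) (at z within closed_segment (Complex X (-L)) (?c X))"
      if "z \<in> closed_segment (Complex X (-L)) (?c X)" for z
      using has_field_derivative_at_within[OF dE[OF subsetD[OF sub[OF that] mem]]] .
    show "norm (D z - 1) \<le> A" if "z \<in> closed_segment (Complex X (-L)) (?c X)" for z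
      unfolding A_def using \<eta> by (intro deriv_estimate[OF M(2)] sub[OF that]) auto
  qed auto
  define E0 where "E0 = \<bar>Re (F (Complex 0 (-L)) - Complex 0 (-L))\<bar>"
  have far: "\<bar>Re (F (?c X)) - X\<bar> \<le> \<bar>X\<bar> / 2 + (E0 + A * (B + L))" if X: "R + N + \<bar>\<eta>\<bar> \<le> \<bar>X\<bar>" for X
  proof -
    have "norm (Complex X (-L) - Complex 0 (-L)) = \<bar>X\<bar>" by (simp add: cmod_def)
    then have 1: "\<bar>Re ((F (Complex X (-L)) - Complex X (-L)) - (F (Complex 0 (-L)) - Complex 0 (-L)))\<bar> \<le> \<bar>X\<bar> / 2"
      using horiz[of X] abs_Re_le_cmod[of "(F (Complex X (-L)) - Complex X (-L)) - (F (Complex 0 (-L)) - Complex 0 (-L))"] by linarith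
    have "norm (?c X - Complex X (-L)) \<le> B + L"
      using lev[of X] level(1)[OF \<eta>, of X] B(2)[of X] by (simp add: cmod_def)
    then have "A * norm (?c X - Complex X (-L)) \<le> A * (B + L)" using A by (intro mult_left_mono) auto
    then have 2: "\<bar>Re ((F (?c X) - ?c X) - (F (Complex X (-L)) - Complex X (-L)))\<bar> \<le> A * (B + L)"
      using vert[OF X] abs_Re_le_cmod[of "(F (?c X) - ?c X) - (F (Complex X (-L)) - Complex X (-L))"] by linarith
    from 1 2 show ?thesis unfolding E0_def minus_complex.sel complex.sel by linarith
  qed
  have "bounded ((\<lambda>X. Re (F (?c X)) - X) ` {- (R + N + \<bar>\<eta>\<bar>)..R + N + \<bar>\<eta>\<bar>})"
  proof (intro compact_imp_bounded compact_continuous_image continuous_intros)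
    show "continuous_on {- (R + N + \<bar>\<eta>\<bar>)..R + N + \<bar>\<eta>\<bar>} (\<lambda>X. F (?c X))"
      by (intro continuous_on_compose2[OF holomorphic_on_imp_continuous_on[OF F_hol] level_curve_continuous[OF \<eta>]])
        (auto intro: level \<eta>)
  qed auto
  then obtain b where "\<forall>X\<in>{- (R + N + \<bar>\<eta>\<bar>)..R + N + \<bar>\<eta>\<bar>}. \<bar>Re (F (?c X)) - X\<bar> \<le> b"
    unfolding bounded_iff by auto
  then have b: "\<bar>Re (F (?c X)) - X\<bar> \<le> b" if "X \<in> {- (R + N + \<bar>\<eta>\<bar>)..R + N + \<bar>\<eta>\<bar>}" for X
    using that by blast
  show ?thesis
  proof (rule that)
    fix X
    show "\<bar>Re (F (?c X)) - X\<bar> \<le> \<bar>X\<bar> / 2 + (\<bar>E0 + A * (B + L)\<bar> + \<bar>b\<bar>)"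
    proof (cases "R + N + \<bar>\<eta>\<bar> \<le> \<bar>X\<bar>")
      case True
      show ?thesis using far[OF True] by linarith
    next
      case False
      then have "X \<in> {- (R + N + \<bar>\<eta>\<bar>)..R + N + \<bar>\<eta>\<bar>}" by auto
      from b[OF this] show ?thesis by linarith
    qed
  qed
qed

lemma potential_on_level_surj:
  assumes \<eta>: "\<eta> < 0"
  shows "\<exists>X. Re (F (Complex X (level \<eta> X))) = \<xi>"
proof (rule surj_if_tends_to_infinities)
  let ?f = "\<lambda>X. Re (F (Complex X (level \<eta> X)))"
  show "continuous_on UNIV ?f"
    by (intro continuous_intros continuous_on_compose2[OF holomorphic_on_imp_continuous_on[OF F_hol] level_curve_continuous[OF \<eta>]])
      (auto intro: level \<eta>)
  obtain K where K: "\<And>X. \<bar>?f X - X\<bar> \<le> \<bar>X\<bar> / 2 + K" using potential_on_level_asymp[OF \<eta>] by blast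
  show "filterlim ?f at_top at_top"
    unfolding filterlim_at_top eventually_at_top_linorder
  proof (intro allI exI impI)
    fix Z x :: real assume "\<bar>2 * (Z + K)\<bar> \<le> x"
    then have "2 * (Z + K) \<le> x" "0 \<le> x" by linarith+
    moreover from \<open>0 \<le> x\<close> have "x - ?f x \<le> x / 2 + K" using K[of x] by (simp add: abs_le_iff)
    ultimately show "Z \<le> ?f x" by (simp add: field_simps)
  qed
  show "filterlim ?f at_bot at_bot"
    unfolding filterlim_at_bot eventually_at_bot_linorder
  proof (intro allI exI impI)
    fix Z x :: real assume "x \<le> - \<bar>2 * (Z - K)\<bar>"
    then have "x \<le> 2 * (Z - K)" "x \<le> 0" by linarith+
    moreover from \<open>x \<le> 0\<close> have "?f x - x \<le> - x / 2 + K" using K[of x] by (simp add: abs_le_iff)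
    ultimately show "?f x \<le> Z" by (simp add: field_simps)
  qed
qed

theorem F_bij: "bij_betw F (subgraph h) lower_half_plane"
  unfolding bij_betw_def
proof (intro conjI equalityI subsetI)
  show "inj_on F (subgraph h)"
  proof (rule inj_onI)
    fix z w assume zw: "z \<in> subgraph h" "w \<in> subgraph h" "F z = F w"
    define \<eta> where "\<eta> = Im (F z)"
    have \<eta>: "\<eta> < 0" using Im_neg[OF zw(1)] by (simp add: \<eta>_def)
    have z: "z = Complex (Re z) (level \<eta> (Re z))"
      by (rule level_unique[OF \<eta> zw(1)]) (simp add: \<eta>_def)
    have w: "w = Complex (Re w) (level \<eta> (Re w))"
      by (rule level_unique[OF \<eta> zw(2)]) (simp add: \<eta>_def zw(3))
    have "Re (F (Complex (Re z) (level \<eta> (Re z)))) = Re (F (Complex (Re w) (level \<eta> (Re w))))"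
      using zw(3) z w by simp
    then have "Re z = Re w" using strict_mono_eq[OF potential_on_level_strict_mono[OF \<eta>]] by simp
    then show "z = w" using z w by simp
  qed
  show "\<zeta> \<in> lower_half_plane" if "\<zeta> \<in> F ` subgraph h" for \<zeta>
    using that Im_neg by (auto simp: lower_half_plane_def)
  show "\<zeta> \<in> F ` subgraph h" if "\<zeta> \<in> lower_half_plane" for \<zeta>
  proof -
    have \<eta>: "Im \<zeta> < 0" using that by (simp add: lower_half_plane_def)
    obtain X where X: "Re (F (Complex X (level (Im \<zeta>) X))) = Re \<zeta>"
      using potential_on_level_surj[OF \<eta>] by blast
    have "F (Complex X (level (Im \<zeta>) X)) = \<zeta>"
      using X level(2)[OF \<eta>, of X] by (simp add: complex_eq_iff)
    then show ?thesis using level(3)[OF \<eta>, of X] by (metis image_eqI)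
  qed
qed

end

section \<open>The free surface and the inverse of the potential\<close>

lemma asymptotically_identity_tendsto:
  fixes u :: "real \<Rightarrow> real"
  assumes "((\<lambda>x. u x - x) \<longlongrightarrow> 0) at_infinity"
  shows "filterlim u at_top at_top" "filterlim u at_bot at_bot"
proof -
  obtain R where R: "\<And>x. R \<le> \<bar>x\<bar> \<Longrightarrow> \<bar>u x - x\<bar> < 1"
    using assms unfolding tendsto_at_infinity_iff_norm by (metis diff_zero real_norm_def zero_less_one)
  show "filterlim u at_top at_top"
    unfolding filterlim_at_top eventually_at_top_linorder
  proof (intro allI exI impI)
    fix Z x :: real assume "\<bar>R\<bar> + \<bar>Z\<bar> + 1 \<le> x"
    then show "Z \<le> u x" using R[of x] by linarith
  qed
  show "filterlim u at_bot at_bot"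
    unfolding filterlim_at_bot eventually_at_bot_linorder
  proof (intro allI exI impI)
    fix Z x :: real assume "x \<le> - (\<bar>R\<bar> + \<bar>Z\<bar> + 1)"
    then show "u x \<le> Z" using R[of x] by linarith
  qed
qed

text \<open>
  \<open>u\<close> is an increasing bijection of the real line with a continuous inverse, and \<open>h\<close> is \<open>v\<close> composed
  with this inverse.
\<close>
lemma curve_is_graph:
  fixes u v u' :: "real \<Rightarrow> real"
  assumes u: "\<And>x. (u has_real_derivative u' x) (at x)" "\<And>x. 0 < u' x"
    and v: "continuous_on UNIV v"
    and asymp: "((\<lambda>x. u x - x) \<longlongrightarrow> 0) at_infinity" "(v \<longlongrightarrow> 0) at_infinity"
  obtains h where "continuous_on UNIV h" "(h \<longlongrightarrow> 0) at_infinity" "\<And>x. h (u x) = v x"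
    "below u v = subgraph h" "\<And>X. \<exists>x. u x = X"
proof -
  have cu: "continuous_on UNIV u"
    using u(1) by (meson DERIV_continuous_on has_field_derivative_at_within)
  have sm: "u a < u b" if "a < b" for a b
    by (rule DERIV_pos_imp_increasing[OF that]) (use u in blast)
  have surj: "\<exists>x. u x = X" for X
    by (rule surj_if_tends_to_infinities[OF cu asymptotically_identity_tendsto[OF asymp(1)]])
  have inj: "u a = u b \<Longrightarrow> a = b" for a b using sm[of a b] sm[of b a] by (cases a b rule: linorder_cases) auto
  define s where "s = inv u"
  have us: "u (s X) = X" for X unfolding s_def using surj[of X] by (auto intro!: f_inv_into_f)
  have su: "s (u x) = x" for x using us[of "u x"] inj by blast
  have cs: "continuous_on UNIV s"
  proof (rule continuous_at_imp_continuous_on, rule ballI)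
    fix X
    have "isCont s (u (s X))"
      by (rule isCont_inverse_function[of 1]) (use su cu in \<open>auto simp: continuous_on_eq_continuous_at\<close>)
    then show "isCont s X" by (simp add: us)
  qed
  define h where "h X = v (s X)" for X
  have hu: "h (u x) = v x" for x by (simp add: h_def su)
  have ch: "continuous_on UNIV h" unfolding h_def by (rule continuous_on_compose2[OF v cs]) auto
  have "filterlim s at_infinity at_infinity"
  proof -
    obtain R where R: "\<And>x. R \<le> \<bar>x\<bar> \<Longrightarrow> \<bar>u x - x\<bar> < 1"
      using asymp(1) unfolding tendsto_at_infinity_iff_norm by (metis diff_zero real_norm_def zero_less_one)
    have "bounded (u ` {-\<bar>R\<bar>..\<bar>R\<bar>})"
      by (intro compact_imp_bounded compact_continuous_image continuous_on_subset[OF cu]) auto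
    then obtain b where "\<forall>x\<in>{-\<bar>R\<bar>..\<bar>R\<bar>}. \<bar>u x\<bar> \<le> b" unfolding bounded_iff by auto
    then have b: "\<bar>u x\<bar> \<le> b" if "\<bar>x\<bar> \<le> \<bar>R\<bar>" for x
    proof -
      have "x \<in> {-\<bar>R\<bar>..\<bar>R\<bar>}" using that by auto
      then show ?thesis using \<open>\<forall>x\<in>{-\<bar>R\<bar>..\<bar>R\<bar>}. \<bar>u x\<bar> \<le> b\<close> by blast
    qed
    show ?thesis
      unfolding filterlim_at_infinity[OF order_refl] eventually_at_infinity
    proof (intro allI impI exI)
      fix r X :: real assume r: "0 < r" and X: "r + 1 + \<bar>R\<bar> + \<bar>b\<bar> \<le> norm X"
      have "\<not> \<bar>s X\<bar> \<le> \<bar>R\<bar>" using b[of "s X"] X r by (auto simp: us)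
      then have "\<bar>X - s X\<bar> < 1" using R[of "s X"] by (simp add: us)
      then show "r \<le> norm (s X)" using X by simp
    qed
  qed
  then have h0: "(h \<longlongrightarrow> 0) at_infinity" unfolding h_def by (rule filterlim_compose[OF asymp(2)])
  have "below u v = subgraph h"
    unfolding below_def subgraph_def by (auto simp: hu) (metis us h_def)
  with that ch h0 hu surj show ?thesis by blast
qed

text \<open>
  Bernoulli's condition enters as the value of \<open>\<bar>D\<bar> = \<bar>\<nabla>\<psi>\<bar>\<close> on the surface, and regularity as
  \<open>D \<noteq> 0\<close> there.
\<close>
locale free_surface_flow = deep_flow +
  fixes u v u' v' :: "real \<Rightarrow> real" and \<mu> :: real
  assumes u_deriv: "\<And>x. (u has_real_derivative u' x) (at x)" and u'_pos: "\<And>x. 0 < u' x"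
    and u'_cont: "continuous_on UNIV u'"
    and v_deriv: "\<And>x. (v has_real_derivative v' x) (at x)" and v'_cont: "continuous_on UNIV v'"
    and u_asymp: "((\<lambda>x. u x - x) \<longlongrightarrow> 0) at_infinity" and v_asymp: "(v \<longlongrightarrow> 0) at_infinity"
    and h_u: "\<And>x. h (u x) = v x" and u_surj: "\<And>X. \<exists>x. u x = X"
    and D_surface: "\<And>x. D (Complex (u x) (v x)) \<noteq> 0"
    and bernoulli: "\<And>x. (norm (D (Complex (u x) (v x))))\<^sup>2 = 1 - 2 * \<mu> * v x"
begin

abbreviation \<gamma> where "\<gamma> x \<equiv> Complex (u x) (v x)"

lemma \<gamma>_closure: "\<gamma> x \<in> closure (subgraph h)"
  by (simp add: clos h_u)

lemma surface_cases:
  assumes "z \<in> closure (subgraph h)" "z \<notin> subgraph h"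
  obtains x where "z = \<gamma> x"
proof -
  obtain x where "u x = Re z" using u_surj by blast
  moreover have "Im z = h (Re z)" using assms(1)[unfolded clos] assms(2)[unfolded subgraph_def] by simp
  ultimately show ?thesis using that[of x] h_u[of x] by (simp add: complex_eq_iff)
qed

lemma F_\<gamma>: "F (\<gamma> x) = of_real (Re (F (\<gamma> x)))"
  using F_real[of "\<gamma> x"] by (simp add: complex_eq_iff h_u)

lemma surface_potential_deriv:
  shows "((\<lambda>x. Re (F (\<gamma> x))) has_real_derivative Re (D (\<gamma> x) * Complex (u' x) (v' x))) (at x)"
    and "Im (D (\<gamma> x) * Complex (u' x) (v' x)) = 0"
proof -
  have "(\<gamma> has_vector_derivative Complex (u' x) (v' x)) (at x)" for x
    unfolding Complex_eq
    by (intro has_vector_derivative_add has_vector_derivative_mult_right has_vector_derivative_of_real u_deriv v_deriv)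
  moreover have "continuous_on UNIV (\<lambda>x. Complex (u' x) (v' x))"
    unfolding Complex_eq by (intro continuous_intros u'_cont v'_cont)
  ultimately have d: "((\<lambda>x. F (\<gamma> x)) has_vector_derivative D (\<gamma> x) * Complex (u' x) (v' x)) (at x)"
    by (intro FTC_along_boundary_curve[OF h_cont, where F = F and D = D and \<gamma> = "\<lambda>x. \<gamma> x" and \<gamma>' = "\<lambda>x. Complex (u' x) (v' x)"]
        F_deriv F_cont D_cont \<gamma>_closure)
  have "((\<lambda>x. Im (F (\<gamma> x))) has_vector_derivative Im (D (\<gamma> x) * Complex (u' x) (v' x))) (at x)"
    by (rule bounded_linear.has_vector_derivative[OF bounded_linear_Im d])
  moreover have "(\<lambda>x. Im (F (\<gamma> x))) = (\<lambda>x. 0)" using F_real[of "\<gamma> x" for x] by (simp add: h_u)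
  ultimately have "((\<lambda>x. 0::real) has_vector_derivative Im (D (\<gamma> x) * Complex (u' x) (v' x))) (at x)" by simp
  then show "Im (D (\<gamma> x) * Complex (u' x) (v' x)) = 0"
    using vector_derivative_unique_at has_vector_derivative_const by blast
  show "((\<lambda>x. Re (F (\<gamma> x))) has_real_derivative Re (D (\<gamma> x) * Complex (u' x) (v' x))) (at x)"
    unfolding has_real_derivative_iff_has_vector_derivative
    by (rule bounded_linear.has_vector_derivative[OF bounded_linear_Re d])
qed

text \<open>
  The derivative \<open>r\<close> of the potential along the surface is real and nonzero. Dividing by the tangent
  shows that \<open>r\<close> has the sign of \<open>Re D\<close>, because \<open>u' > 0\<close>; and \<open>Re D\<close> is nonnegative by continuity.
\<close>
lemma Re_D_surface_pos: "0 < Re (D (\<gamma> x))" and surface_potential_deriv_pos: "0 < Re (D (\<gamma> x) * Complex (u' x) (v' x))"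
proof -
  let ?g = "Complex (u' x) (v' x)"
  define r where "r = Re (D (\<gamma> x) * ?g)"
  have g: "?g \<noteq> 0" using u'_pos[of x] by (simp add: complex_eq_iff)
  have dg: "D (\<gamma> x) * ?g = of_real r"
    using surface_potential_deriv(2)[of x] by (simp add: r_def complex_eq_iff)
  have "r \<noteq> 0" using dg g D_surface[of x] by auto
  have "D (\<gamma> x) * (?g * cnj ?g) = of_real r * cnj ?g" using dg by (simp flip: mult.assoc)
  then have "D (\<gamma> x) * of_real ((norm ?g)\<^sup>2) = of_real r * cnj ?g" by (simp add: complex_norm_square[symmetric])
  then have "Re (D (\<gamma> x) * of_real ((norm ?g)\<^sup>2)) = Re (of_real r * cnj ?g)" by simp
  then have eq: "Re (D (\<gamma> x)) * (norm ?g)\<^sup>2 = r * u' x" by (simp del: of_real_power)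
  have "0 \<le> Re (D (\<gamma> x))"
    by (rule continuous_ge_on_closure[of "subgraph h" "\<lambda>z. Re (D z)"])
      (auto intro!: continuous_intros D_cont \<gamma>_closure Re_D_nonneg)
  then have "0 \<le> r * u' x" unfolding eq[symmetric] by simp
  then have r: "0 < r" using u'_pos[of x] \<open>r \<noteq> 0\<close> by (simp add: zero_le_mult_iff)
  then show "0 < Re (D (\<gamma> x) * ?g)" by (simp add: r_def)
  have "0 < Re (D (\<gamma> x)) * (norm ?g)\<^sup>2" unfolding eq using r u'_pos[of x] by simp
  then show "0 < Re (D (\<gamma> x))" by (simp add: zero_less_mult_iff)
qed

lemma Re_D_pos_closure: "z \<in> closure (subgraph h) \<Longrightarrow> 0 < Re (D z)"
  using Re_D_pos Re_D_surface_pos surface_cases by metis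

lemma surface_potential_strict_mono: "strict_mono (\<lambda>x. Re (F (\<gamma> x)))"
proof (rule strict_monoI)
  fix a b :: real assume "a < b"
  then show "Re (F (\<gamma> a)) < Re (F (\<gamma> b))"
    by (rule DERIV_pos_imp_increasing) (use surface_potential_deriv(1) surface_potential_deriv_pos in blast)
qed

text \<open>
  Far out the speed on the surface is at least \<open>1/2\<close>, since \<open>v\<close> tends to \<open>0\<close> in Bernoulli's condition.
  So the potential grows at least half as fast as the horizontal coordinate.
\<close>
lemma surface_potential_surj: "\<exists>x. Re (F (\<gamma> x)) = \<xi>"
proof (rule surj_if_tends_to_infinities)
  let ?q = "\<lambda>x. Re (F (\<gamma> x))"
  let ?q' = "\<lambda>x. Re (D (\<gamma> x) * Complex (u' x) (v' x))"
  show "continuous_on UNIV ?q"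
    by (rule DERIV_continuous_on) (rule has_field_derivative_at_within[OF surface_potential_deriv(1)])
  have "((\<lambda>x. 2 * \<mu> * v x) \<longlongrightarrow> 2 * \<mu> * 0) at_infinity" by (intro tendsto_intros v_asymp)
  then have "((\<lambda>x. 2 * \<mu> * v x) \<longlongrightarrow> 0) at_infinity" by simp
  moreover have "(0::real) < 3 / 4" by simp
  ultimately obtain N0 where "\<And>x. N0 \<le> norm x \<Longrightarrow> norm (2 * \<mu> * v x - 0) < 3 / 4"
    unfolding tendsto_at_infinity_iff_norm by blast
  then have N0: "\<bar>2 * \<mu> * v x\<bar> < 3 / 4" if "N0 \<le> \<bar>x\<bar>" for x using that by simp
  define N where "N = max N0 1"
  have slope: "u' x / 2 \<le> ?q' x" if "N \<le> \<bar>x\<bar>" for x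
  proof -
    have "\<bar>2 * \<mu> * v x\<bar> < 3 / 4" using N0[of x] that by (simp add: N_def)
    then have "(1 / 2)\<^sup>2 \<le> (norm (D (\<gamma> x)))\<^sup>2" unfolding bernoulli by (simp add: power2_eq_square)
    then have d: "1 / 2 \<le> norm (D (\<gamma> x))" by (rule power2_le_imp_le) simp
    have "D (\<gamma> x) * Complex (u' x) (v' x) = of_real (?q' x)"
      using surface_potential_deriv(2)[of x] by (simp add: complex_eq_iff)
    then have "norm (D (\<gamma> x)) * norm (Complex (u' x) (v' x)) = ?q' x"
      using surface_potential_deriv_pos[of x] by (metis norm_mult norm_of_real abs_of_pos)
    moreover have "u' x \<le> norm (Complex (u' x) (v' x))"
      using complex_Re_le_cmod[of "Complex (u' x) (v' x)"] by simp
    then have "1 / 2 * u' x \<le> norm (D (\<gamma> x)) * norm (Complex (u' x) (v' x))"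
      using d u'_pos[of x] by (intro mult_mono) auto
    ultimately show ?thesis by simp
  qed
  have mono: "?q a - u a / 2 \<le> ?q b - u b / 2" if "a \<le> b" "N \<le> a \<or> b \<le> - N" for a b
  proof (rule DERIV_nonneg_imp_nondecreasing[OF that(1)])
    fix x assume "a \<le> x" "x \<le> b"
    then have "u' x / 2 \<le> ?q' x" using slope[of x] that(2) by auto
    moreover have "((\<lambda>x. ?q x - u x / 2) has_real_derivative ?q' x - u' x / 2) (at x)"
      by (intro DERIV_diff surface_potential_deriv(1) DERIV_cdivide u_deriv)
    ultimately show "\<exists>y. ((\<lambda>x. ?q x - u x / 2) has_real_derivative y) (at x) \<and> 0 \<le> y"
      by (intro exI[of _ "?q' x - u' x / 2"]) simp
  qed
  note ul = asymptotically_identity_tendsto[OF u_asymp]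
  show "filterlim ?q at_top at_top"
    unfolding filterlim_at_top
  proof
    fix Z
    have "\<forall>\<^sub>F x in at_top. 2 * (Z - (?q N - u N / 2)) \<le> u x" using ul(1) unfolding filterlim_at_top by blast
    with eventually_ge_at_top[of N] show "\<forall>\<^sub>F x in at_top. Z \<le> ?q x"
    proof eventually_elim
      case (elim x)
      then show ?case using mono[of N x] by (simp add: field_simps)
    qed
  qed
  show "filterlim ?q at_bot at_bot"
    unfolding filterlim_at_bot
  proof
    fix Z
    have "\<forall>\<^sub>F x in at_bot. u x \<le> 2 * (Z - (?q (-N) - u (-N) / 2))" using ul(2) unfolding filterlim_at_bot by blast
    with eventually_le_at_bot[of "-N"] show "\<forall>\<^sub>F x in at_bot. ?q x \<le> Z"
    proof eventually_elim
      case (elim x)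
      then show ?case using mono[of x "-N"] by (simp add: field_simps)
    qed
  qed
qed

theorem F_bij_closure: "bij_betw F (closure (subgraph h)) {z. Im z \<le> 0}"
  unfolding bij_betw_def
proof (intro conjI equalityI subsetI)
  note bij = F_bij[unfolded bij_betw_def lower_half_plane_def]
  show "inj_on F (closure (subgraph h))"
  proof (rule inj_onI)
    fix z w assume zw: "z \<in> closure (subgraph h)" "w \<in> closure (subgraph h)" "F z = F w"
    show "z = w"
    proof (cases "z \<in> subgraph h")
      case True
      then have "w \<in> subgraph h"
        using surface_cases[OF zw(2)] F_\<gamma> Im_neg[OF True] zw(3) by (metis Im_complex_of_real less_irrefl)
      with True bij zw(3) show ?thesis by (auto dest: inj_onD)
    next
      case False
      then obtain x where x: "z = \<gamma> x" using surface_cases[OF zw(1)] by blast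
      have "w \<notin> subgraph h" using Im_neg[of w] zw(3) x F_\<gamma>[of x] by (metis Im_complex_of_real less_irrefl)
      then obtain y where y: "w = \<gamma> y" using surface_cases[OF zw(2)] by blast
      have "Re (F (\<gamma> x)) = Re (F (\<gamma> y))" using zw(3) by (simp only: x y)
      then have "x = y" using strict_mono_eq[OF surface_potential_strict_mono, of x y] by simp
      then show ?thesis by (simp add: x y)
    qed
  qed
  show "\<zeta> \<in> {z. Im z \<le> 0}" if "\<zeta> \<in> F ` closure (subgraph h)" for \<zeta>
    using that Im_le_0 by (auto simp: clos)
  show "\<zeta> \<in> F ` closure (subgraph h)" if "\<zeta> \<in> {z. Im z \<le> 0}" for \<zeta>
  proof (cases "Im \<zeta> = 0")
    case True
    obtain x where "Re (F (\<gamma> x)) = Re \<zeta>" using surface_potential_surj by blast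
    then have "F (\<gamma> x) = \<zeta>" using F_\<gamma>[of x] True by (simp add: complex_eq_iff)
    then show ?thesis using \<gamma>_closure by blast
  next
    case False
    then have "\<zeta> \<in> F ` subgraph h" using that bij by auto
    then show ?thesis using closure_subset by blast
  qed
qed

abbreviation G where "G \<equiv> inv_into (closure (subgraph h)) F"

lemma F_G: "Im \<zeta> \<le> 0 \<Longrightarrow> F (G \<zeta>) = \<zeta>"
  using F_bij_closure by (auto simp: bij_betw_def intro!: f_inv_into_f)

lemma G_closure: "Im \<zeta> \<le> 0 \<Longrightarrow> G \<zeta> \<in> closure (subgraph h)"
  using F_bij_closure by (auto simp: bij_betw_def intro!: inv_into_into)

lemma G_F: "z \<in> closure (subgraph h) \<Longrightarrow> G (F z) = z"
  using F_bij_closure by (auto simp: bij_betw_def intro: inv_into_f_f)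

lemma F_inj_closure: "z \<in> closure (subgraph h) \<Longrightarrow> w \<in> closure (subgraph h) \<Longrightarrow> F z = F w \<Longrightarrow> z = w"
  using F_bij_closure by (auto simp: bij_betw_def dest: inj_onD)

lemma F_below: "z \<in> closure (subgraph h) \<Longrightarrow> Im (F z) < 0 \<longleftrightarrow> z \<in> subgraph h"
  using Im_neg surface_cases F_\<gamma> by (metis Im_complex_of_real less_irrefl)

text \<open>
  The continuity of the inverse at \<open>F z0\<close>, also for \<open>z0\<close> on the surface. The part \<open>B\<close> of the lower half
  plane near \<open>F z0\<close> is connected and misses the image of the circle of radius \<open>\<epsilon>\<close> about \<open>z0\<close>. Hence it
  splits into the images of points inside and of points outside the circle; both are open, and the
  first is nonempty.
\<close>
lemma G_local:
  assumes z0: "z0 \<in> closure (subgraph h)" and \<epsilon>: "\<epsilon> > 0"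
  obtains \<rho> where "\<rho> > 0" "\<And>z. z \<in> closure (subgraph h) \<Longrightarrow> dist (F z0) (F z) < \<rho> \<Longrightarrow> dist z0 z \<le> \<epsilon>"
proof -
  define K where "K = F ` (closure (subgraph h) \<inter> sphere z0 \<epsilon>)"
  have "compact K" unfolding K_def
    by (intro compact_continuous_image continuous_on_subset[OF F_cont] closed_Int_compact) auto
  moreover have "F z0 \<notin> K"
    using F_inj_closure[OF z0] \<epsilon> by (auto simp: K_def)
  ultimately have "open (- K)" "F z0 \<in> - K" by (auto intro: compact_imp_closed)
  then obtain \<rho> where \<rho>: "\<rho> > 0" "ball (F z0) \<rho> \<inter> K = {}"
    unfolding open_contains_ball by (metis disjoint_eq_subset_Compl)
  define B where "B = {z. Im z < 0} \<inter> ball (F z0) \<rho>"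
  define A1 where "A1 = F ` (subgraph h \<inter> ball z0 \<epsilon>)"
  define A2 where "A2 = F ` (subgraph h - cball z0 \<epsilon>)"
  have inj: "inj_on F (subgraph h)" using F_bij by (simp add: bij_betw_def)
  have oA: "open A1" "open A2" unfolding A1_def A2_def
    by (intro open_mapping_thm3 holomorphic_on_subset[OF F_hol] inj_on_subset[OF inj] open_Int open_Diff op; auto)+
  \<comment> \<open>Points of the closure are limits of points of the domain from below; this reduces
    statements about surface points to interior points.\<close>
  have approach: "\<exists>d>0. \<forall>\<delta>. 0 < \<delta> \<longrightarrow> \<delta> < d \<longrightarrow> z - \<i> * of_real \<delta> \<in> subgraph h \<and> dist (F z0) (F (z - \<i> * of_real \<delta>)) < \<rho>"
    if z: "z \<in> closure (subgraph h)" "dist (F z0) (F z) < \<rho>" for z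
  proof -
    have "\<rho> - dist (F z0) (F z) > 0" using z by simp
    then obtain d where d: "d > 0" "\<And>w. w \<in> closure (subgraph h) \<Longrightarrow> dist w z < d \<Longrightarrow> dist (F w) (F z) < \<rho> - dist (F z0) (F z)"
      using F_cont z(1) unfolding continuous_on_iff by blast
    have "z - \<i> * of_real \<delta> \<in> subgraph h \<and> dist (F z0) (F (z - \<i> * of_real \<delta>)) < \<rho>" if "0 < \<delta>" "\<delta> < d" for \<delta>
    proof
      show m: "z - \<i> * of_real \<delta> \<in> subgraph h" using z(1) that by (intro subgraph_shift) (auto simp: clos)
      have "dist (F (z - \<i> * of_real \<delta>)) (F z) < \<rho> - dist (F z0) (F z)"
        using that m closure_subset by (intro d(2)) (auto simp: dist_norm norm_mult)
      then show "dist (F z0) (F (z - \<i> * of_real \<delta>)) < \<rho>"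
        using dist_triangle2[of "F z0" "F (z - \<i> * of_real \<delta>)" "F z"] by (simp add: dist_commute)
    qed
    with d(1) show ?thesis by blast
  qed
  have "connected B" unfolding B_def by (intro convex_connected convex_Int convex_halfspace_Im_lt convex_ball)
  moreover have "A1 \<inter> A2 \<inter> B = {}"
    using inj by (auto simp: A1_def A2_def dest!: inj_onD)
  moreover have "B \<subseteq> A1 \<union> A2"
  proof
    fix \<zeta> assume \<zeta>: "\<zeta> \<in> B"
    then obtain z where z: "z \<in> subgraph h" "\<zeta> = F z"
      using F_bij by (auto simp: bij_betw_def lower_half_plane_def B_def)
    have "dist z0 z \<noteq> \<epsilon>"
    proof
      assume "dist z0 z = \<epsilon>"
      then have "F z \<in> K" using z(1) closure_subset[of "subgraph h"] by (auto simp: K_def)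
      then show False using \<zeta> z(2) \<rho>(2) by (auto simp: B_def)
    qed
    then show "\<zeta> \<in> A1 \<union> A2" using z by (auto simp: A1_def A2_def)
  qed
  ultimately have "A1 \<inter> B = {} \<or> A2 \<inter> B = {}" using connectedD[OF _ oA] by blast
  moreover have "A1 \<inter> B \<noteq> {}"
  proof -
    obtain d where d: "d > 0" "\<And>\<delta>. 0 < \<delta> \<Longrightarrow> \<delta> < d \<Longrightarrow> z0 - \<i> * of_real \<delta> \<in> subgraph h \<and> dist (F z0) (F (z0 - \<i> * of_real \<delta>)) < \<rho>"
      using approach[OF z0] \<rho>(1) by auto
    define \<delta> where "\<delta> = min d \<epsilon> / 2"
    have \<delta>: "0 < \<delta>" "\<delta> < d" "\<delta> < \<epsilon>" using d(1) \<epsilon> by (auto simp: \<delta>_def min_def)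
    have "z0 - \<i> * of_real \<delta> \<in> subgraph h \<inter> ball z0 \<epsilon>"
      using d(2)[OF \<delta>(1,2)] \<delta> by (auto simp: dist_norm norm_mult)
    then have "F (z0 - \<i> * of_real \<delta>) \<in> A1 \<inter> B"
      using d(2)[OF \<delta>(1,2)] Im_neg by (auto simp: A1_def B_def)
    then show ?thesis by blast
  qed
  ultimately have A2B: "A2 \<inter> B = {}" by blast
  have int: "dist z0 z \<le> \<epsilon>" if "z \<in> subgraph h" "dist (F z0) (F z) < \<rho>" for z
  proof (rule ccontr)
    assume "\<not> dist z0 z \<le> \<epsilon>"
    then have "F z \<in> A2 \<inter> B" using that Im_neg by (auto simp: A2_def B_def)
    then show False using A2B by blast
  qed
  show ?thesis
  proof (rule that[OF \<rho>(1)])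
    fix z assume z: "z \<in> closure (subgraph h)" "dist (F z0) (F z) < \<rho>"
    from approach[OF this] obtain d where d: "d > 0" "\<And>\<delta>. 0 < \<delta> \<Longrightarrow> \<delta> < d \<Longrightarrow> z - \<i> * of_real \<delta> \<in> subgraph h \<and> dist (F z0) (F (z - \<i> * of_real \<delta>)) < \<rho>" by blast
    show "dist z0 z \<le> \<epsilon>"
    proof (rule field_le_epsilon)
      fix e :: real assume e: "e > 0"
      define \<delta> where "\<delta> = min d e / 2"
      have \<delta>: "0 < \<delta>" "\<delta> < d" "\<delta> < e" using d(1) e by (auto simp: \<delta>_def min_def)
      have "dist z0 (z - \<i> * of_real \<delta>) \<le> \<epsilon>" using d(2)[OF \<delta>(1,2)] int by blast
      moreover have "dist (z - \<i> * of_real \<delta>) z = \<delta>" using \<delta> by (simp add: dist_norm norm_mult)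
      ultimately show "dist z0 z \<le> \<epsilon> + e"
        using dist_triangle[of z0 z "z - \<i> * of_real \<delta>"] \<delta>(3) by linarith
    qed
  qed
qed

lemma G_cont: "continuous_on {z. Im z \<le> 0} G"
  unfolding continuous_on_iff
proof clarify
  fix \<zeta> :: complex and e :: real assume \<zeta>: "Im \<zeta> \<le> 0" and e: "e > 0"
  then have "e / 2 > 0" by simp
  from G_local[OF G_closure[OF \<zeta>] this] obtain \<rho> where
    \<rho>: "\<rho> > 0" "\<And>z. z \<in> closure (subgraph h) \<Longrightarrow> dist (F (G \<zeta>)) (F z) < \<rho> \<Longrightarrow> dist (G \<zeta>) z \<le> e / 2" by blast
  have "dist (G \<xi>) (G \<zeta>) < e" if "Im \<xi> \<le> 0" "dist \<xi> \<zeta> < \<rho>" for \<xi>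
    using \<rho>(2)[OF G_closure[OF that(1)]] that e by (simp add: F_G \<zeta> dist_commute)
  with \<rho>(1) show "\<exists>d>0. \<forall>\<xi>\<in>{z. Im z \<le> 0}. dist \<xi> \<zeta> < d \<longrightarrow> dist (G \<xi>) (G \<zeta>) < e" by auto
qed

lemma closed_lower: "closed {z. Im z \<le> 0}"
  by (rule closed_halfspace_Im_le)

lemma F_proper: "maps_infinity_to_infinity F (closure (subgraph h))"
  unfolding maps_infinity_to_infinity_def filterlim_at_infinity[OF order_refl] eventually_inf_principal eventually_at_infinity
proof (intro allI impI)
  fix r :: real assume "r > 0"
  have "bounded (G ` ({z. Im z \<le> 0} \<inter> cball 0 r))"
    by (intro compact_imp_bounded compact_continuous_image continuous_on_subset[OF G_cont] closed_Int_compact closed_lower) auto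
  then obtain b where b: "\<forall>\<zeta>\<in>{z. Im z \<le> 0} \<inter> cball 0 r. norm (G \<zeta>) \<le> b" unfolding bounded_iff by auto
  show "\<exists>c. \<forall>z. c \<le> norm z \<longrightarrow> z \<in> closure (subgraph h) \<longrightarrow> r \<le> norm (F z)"
  proof (intro exI[of _ "b + 1"] allI impI, rule ccontr)
    fix z assume z: "b + 1 \<le> norm z" "z \<in> closure (subgraph h)" "\<not> r \<le> norm (F z)"
    then have "F z \<in> {z. Im z \<le> 0} \<inter> cball 0 r" using Im_le_0[of z] by (simp add: clos)
    then have "norm (G (F z)) \<le> b" using b by blast
    then show False using z by (simp add: G_F)
  qed
qed

lemma G_proper: "filterlim G at_infinity (inf at_infinity (principal {z. Im z \<le> 0}))"
  unfolding filterlim_at_infinity[OF order_refl] eventually_inf_principal eventually_at_infinity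
proof (intro allI impI)
  fix r :: real assume "r > 0"
  have "bounded (F ` (closure (subgraph h) \<inter> cball 0 r))"
    by (intro compact_imp_bounded compact_continuous_image continuous_on_subset[OF F_cont] closed_Int_compact) auto
  then obtain b where b: "\<forall>z\<in>closure (subgraph h) \<inter> cball 0 r. norm (F z) \<le> b" unfolding bounded_iff by auto
  show "\<exists>c. \<forall>z. c \<le> norm z \<longrightarrow> z \<in> {z. Im z \<le> 0} \<longrightarrow> r \<le> norm (G z)"
  proof (intro exI[of _ "b + 1"] allI impI, rule ccontr)
    fix z :: complex assume z: "b + 1 \<le> norm z" "z \<in> {z. Im z \<le> 0}" "\<not> r \<le> norm (G z)"
    then have "G z \<in> closure (subgraph h) \<inter> cball 0 r" using G_closure[of z] by simp
    then have "norm (F (G z)) \<le> b" using b by blast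
    then show False using z by (simp add: F_G)
  qed
qed

lemma G_deriv:
  assumes "Im \<zeta> < 0" shows "(G has_field_derivative 1 / D (G \<zeta>)) (at \<zeta>)"
proof -
  have inj: "inj_on F (subgraph h)" using F_bij by (simp add: bij_betw_def)
  obtain g where g: "g holomorphic_on (F ` subgraph h)"
    "\<And>z. z \<in> subgraph h \<Longrightarrow> deriv F z * deriv g (F z) = 1" "\<And>z. z \<in> subgraph h \<Longrightarrow> g (F z) = z"
    using holomorphic_has_inverse[OF F_hol op inj] by metis
  have img: "F ` subgraph h = {z. Im z < 0}" using F_bij by (simp add: bij_betw_def lower_half_plane_def)
  have Gs: "G \<zeta> \<in> subgraph h" if "Im \<zeta> < 0" for \<zeta>
    using F_below[OF G_closure[of \<zeta>]] F_G[of \<zeta>] that by simp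
  have eq: "g \<zeta> = G \<zeta>" if "Im \<zeta> < 0" for \<zeta>
    using g(3)[OF Gs[OF that]] F_G[of \<zeta>] that by simp
  have "(g has_field_derivative deriv g \<zeta>) (at \<zeta>)"
    using g(1) assms unfolding img by (intro holomorphic_derivI[OF _ open_halfspace_Im_lt[of 0]]) auto
  then have "(G has_field_derivative deriv g \<zeta>) (at \<zeta>)"
    by (rule has_field_derivative_transform_within_open[OF _ open_halfspace_Im_lt[of 0]]) (use assms eq in auto)
  moreover have "D (G \<zeta>) * deriv g \<zeta> = 1"
    using g(2)[OF Gs[OF assms]] F_G[of \<zeta>] assms DERIV_imp_deriv[OF F_deriv[OF Gs[OF assms]]]
    by simp
  then have "deriv g \<zeta> = 1 / D (G \<zeta>)" by (metis mult_not_zero nonzero_mult_div_cancel_left zero_neq_one)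
  ultimately show ?thesis by simp
qed

end

section \<open>Bernoulli's condition and Babenko's equation\<close>

lemma continuous_on_hilbert:
  assumes b: "l2_holder \<alpha> b" "0 < \<alpha>"
  shows "continuous_on UNIV (hilbert b)"
proof -
  have "continuous_on UNIV (\<lambda>x. Re (cauchy_transform b (of_real x)))"
    by (intro continuous_intros continuous_on_compose2[OF continuous_on_cauchy_transform[OF b]]) auto
  then show ?thesis by simp
qed

lemma hilbert_tendsto_0:
  assumes b: "l2_holder \<alpha> b" "0 < \<alpha>"
  shows "(hilbert b \<longlongrightarrow> 0) at_infinity"
  unfolding tendsto_at_infinity_iff_norm
proof (intro allI impI)
  fix e :: real assume "e > 0"
  then obtain R where R: "\<And>z. Im z \<le> 0 \<Longrightarrow> R \<le> norm z \<Longrightarrow> norm (cauchy_transform b z - 0) < e"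
    using cauchy_transform_tendsto_0[OF b] unfolding tendsto_inf_at_infinity_iff by blast
  have "norm (hilbert b x - 0) < e" if "R \<le> norm x" for x
    using R[of "of_real x"] that abs_Re_le_cmod[of "cauchy_transform b (of_real x)"] by simp
  then show "\<exists>R. \<forall>x. R \<le> norm x \<longrightarrow> norm (hilbert b x - 0) < e" by blast
qed

lemma inf_slope_posI:
  assumes w': "l2_holder \<alpha> (deriv w)" "0 < \<alpha>" and pos: "\<And>x. 0 < 1 + hilbert (deriv w) x"
  shows "inf_slope_pos w"
proof -
  let ?H = "hilbert (deriv w)"
  have "(0::real) < 1 / 2" by simp
  then obtain R where "\<And>x. R \<le> norm x \<Longrightarrow> norm (?H x - 0) < 1 / 2"
    using hilbert_tendsto_0[OF w'] unfolding tendsto_at_infinity_iff_norm by blast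
  then have R: "\<bar>?H x\<bar> < 1 / 2" if "R \<le> \<bar>x\<bar>" for x using that by simp
  have "compact {-\<bar>R\<bar>..\<bar>R\<bar>}" "{-\<bar>R\<bar>..\<bar>R\<bar>} \<noteq> {}" "continuous_on {-\<bar>R\<bar>..\<bar>R\<bar>} (\<lambda>x. 1 + ?H x)"
    by (auto intro!: continuous_intros continuous_on_subset[OF continuous_on_hilbert[OF w']])
  from continuous_attains_inf[OF this] obtain m where
    m: "\<And>x. x \<in> {-\<bar>R\<bar>..\<bar>R\<bar>} \<Longrightarrow> 1 + ?H m \<le> 1 + ?H x" by blast
  have "min (1 / 2) (1 + ?H m) \<le> 1 + ?H x" for x
  proof (cases "x \<in> {-\<bar>R\<bar>..\<bar>R\<bar>}")
    case True
    from m[OF this] show ?thesis by linarith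
  next
    case False
    then have "R \<le> \<bar>x\<bar>" by auto
    from R[OF this] show ?thesis by linarith
  qed
  moreover have "0 < min (1 / 2) (1 + ?H m)" using pos[of m] by simp
  ultimately show ?thesis unfolding inf_slope_pos_def by blast
qed

context
  fixes w w' :: "real \<Rightarrow> real" and \<alpha> \<mu> :: real
  assumes \<alpha>: "0 < \<alpha>" and w: "l2_holder \<alpha> w" and w': "l2_holder \<alpha> w'"
begin

text \<open>
  This is \<open>- (1 - 2\<mu>w) w'\<close>, the imaginary part of \<open>1/G'\<close> on the real line under Bernoulli's condition,
  written as the linear combination to which the linearity of the Hilbert transform applies.
\<close>
definition bernoulli_density :: "real \<Rightarrow> real" where
  "bernoulli_density t = (- 1) * w' t + (2 * \<mu>) * (w t * w' t)"

lemma l2_holder_bernoulli_density: "l2_holder \<alpha> bernoulli_density"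
  unfolding bernoulli_density_def[abs_def] by (intro l2_holder_linear l2_holder_mult w w')

lemma hilbert_bernoulli_density:
  "hilbert bernoulli_density x = - hilbert w' x + 2 * \<mu> * hilbert (\<lambda>t. w t * w' t) x"
  using hilbert_linear[OF w' l2_holder_mult[OF w w'] \<alpha>, of "-1" "2 * \<mu>"] l2_holder_bernoulli_density
  unfolding bernoulli_density_def[abs_def] by simp

text \<open>
  \<open>K = 1/G'\<close> has on the line the value \<open>(1 - 2\<mu>w)\<close> times the conjugate of \<open>G'\<close>. So \<open>K - 1\<close> and the Cauchy
  transform of its imaginary part differ by a function that is real on the line and vanishes at
  infinity. The real parts of the two give the equation.
\<close>
lemma bernoulli_imp_babenko:
  assumes K: "K holomorphic_on {z. Im z < 0}" "continuous_on {z. Im z \<le> 0} K"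
    and K_inverse: "\<And>z. Im z \<le> 0 \<Longrightarrow> K z * (1 + cauchy_transform w' z) = 1"
    and bernoulli: "\<And>x. (1 - 2 * \<mu> * w x) * ((1 + hilbert w' x)\<^sup>2 + (w' x)\<^sup>2) = 1"
  shows "hilbert w' x = \<mu> * (w x + w x * hilbert w' x + hilbert (\<lambda>t. w t * w' t) x)"
proof -
  define f where "f z = K z - 1 - cauchy_transform bernoulli_density z" for z
  note bd = l2_holder_bernoulli_density
  have K_real: "K (of_real x) = (1 - 2 * \<mu> * w x) *\<^sub>R Complex (1 + hilbert w' x) (- w' x)" for x
  proof -
    let ?c = "Complex (1 + hilbert w' x) (w' x)"
    have 1: "K (of_real x) * ?c = 1"
      using K_inverse[of "of_real x"] by (simp add: complex_eq_iff)
    have "?c * ((1 - 2 * \<mu> * w x) *\<^sub>R Complex (1 + hilbert w' x) (- w' x)) =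
       of_real ((1 - 2 * \<mu> * w x) * ((1 + hilbert w' x)\<^sup>2 + (w' x)\<^sup>2))"
      by (simp add: complex_eq_iff power2_eq_square algebra_simps)
    also have "\<dots> = 1" unfolding bernoulli by simp
    finally have 2: "?c * ((1 - 2 * \<mu> * w x) *\<^sub>R Complex (1 + hilbert w' x) (- w' x)) = 1" .
    have "K (of_real x) = K (of_real x) * (?c * ((1 - 2 * \<mu> * w x) *\<^sub>R Complex (1 + hilbert w' x) (- w' x)))"
      unfolding 2 by simp
    also have "\<dots> = (1 - 2 * \<mu> * w x) *\<^sub>R Complex (1 + hilbert w' x) (- w' x)"
      using 1 by (simp only: mult.assoc[symmetric] mult_1_left)
    finally show ?thesis .
  qed
  have "f (of_real x) = 0"
  proof (rule vanishing_real_boundary_values_imp_zero[of f])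
    show "f holomorphic_on {z. Im z < 0}"
      unfolding f_def by (intro holomorphic_intros K holomorphic_on_cauchy_transform[OF bd \<alpha>])
    show "continuous_on {z. Im z \<le> 0} f"
      unfolding f_def by (intro continuous_intros K continuous_on_cauchy_transform[OF bd \<alpha>])
    show "Im (f (of_real x)) = 0" for x
      by (simp add: f_def K_real bernoulli_density_def algebra_simps)
    have S: "((\<lambda>z. 1 / (1 + cauchy_transform w' z) - 1 - cauchy_transform bernoulli_density z) \<longlongrightarrow> 1 / (1 + 0) - 1 - 0)
      (inf at_infinity (principal {z. Im z \<le> 0}))"
      by (intro tendsto_intros cauchy_transform_tendsto_0[OF w' \<alpha>] cauchy_transform_tendsto_0[OF bd \<alpha>]) simp
    have "f z = 1 / (1 + cauchy_transform w' z) - 1 - cauchy_transform bernoulli_density z" if "Im z \<le> 0" for z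
    proof -
      have "1 + cauchy_transform w' z \<noteq> 0" using K_inverse[OF that] by auto
      then have "K z = 1 / (1 + cauchy_transform w' z)" using K_inverse[OF that] by (simp add: eq_divide_eq)
      then show ?thesis by (simp add: f_def)
    qed
    then have "\<forall>\<^sub>F z in inf at_infinity (principal {z. Im z \<le> 0}).
       1 / (1 + cauchy_transform w' z) - 1 - cauchy_transform bernoulli_density z = f z"
      by (simp add: eventually_inf_principal)
    from Lim_transform_eventually[OF S this] show "(f \<longlongrightarrow> 0) (inf at_infinity (principal {z. Im z \<le> 0}))" by simp
  qed simp
  then have "Re (f (of_real x)) = 0" by simp
  then have "(1 - 2 * \<mu> * w x) * (1 + hilbert w' x) - 1 = - hilbert w' x + 2 * \<mu> * hilbert (\<lambda>t. w t * w' t) x"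
    by (simp add: f_def K_real hilbert_bernoulli_density)
  then show ?thesis by (simp add: algebra_simps)
qed

text \<open>
  By Babenko's equation \<open>1 + \<H>b = (1 - 2\<mu>w) (1 + \<H>w')\<close> for the density \<open>b\<close> above. So the product of
  \<open>1 + S w'\<close> and \<open>1 + S b\<close> is on the line \<open>(1 - 2\<mu>w)\<close> times the square of the modulus of the first factor,
  hence real, and it tends to \<open>1\<close> at infinity.
\<close>
lemma babenko_imp_bernoulli:
  assumes babenko: "\<And>x. hilbert w' x = \<mu> * (w x + w x * hilbert w' x + hilbert (\<lambda>t. w t * w' t) x)"
  shows "(1 - 2 * \<mu> * w x) * ((1 + hilbert w' x)\<^sup>2 + (w' x)\<^sup>2) = 1"
proof -
  note bd = l2_holder_bernoulli_density
  define f where "f z = (1 + cauchy_transform w' z) * (1 + cauchy_transform bernoulli_density z) - 1" for z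
  have f_real: "f (of_real x) = of_real ((1 - 2 * \<mu> * w x) * ((1 + hilbert w' x)\<^sup>2 + (w' x)\<^sup>2) - 1)" for x
  proof -
    have "2 * \<mu> * hilbert (\<lambda>t. w t * w' t) x = 2 * hilbert w' x - 2 * \<mu> * w x * (1 + hilbert w' x)"
      using babenko[of x] by (simp add: algebra_simps)
    then have H: "1 + hilbert bernoulli_density x = (1 - 2 * \<mu> * w x) * (1 + hilbert w' x)"
      unfolding hilbert_bernoulli_density by (simp add: algebra_simps)
    have c: "1 + cauchy_transform b (of_real x) = Complex (1 + hilbert b x) (b x)" for b
      by (simp add: complex_eq_iff)
    show ?thesis unfolding f_def c H
      by (simp add: complex_eq_iff bernoulli_density_def power2_eq_square algebra_simps)
  qed
  have "f (of_real x) = 0"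
  proof (rule vanishing_real_boundary_values_imp_zero[of f])
    show "f holomorphic_on {z. Im z < 0}"
      unfolding f_def by (intro holomorphic_intros holomorphic_on_cauchy_transform[OF bd \<alpha>] holomorphic_on_cauchy_transform[OF w' \<alpha>])
    show "continuous_on {z. Im z \<le> 0} f"
      unfolding f_def by (intro continuous_intros continuous_on_cauchy_transform[OF bd \<alpha>] continuous_on_cauchy_transform[OF w' \<alpha>])
    show "Im (f (of_real x)) = 0" for x by (simp only: f_real Im_complex_of_real)
    have "(f \<longlongrightarrow> (1 + 0) * (1 + 0) - 1) (inf at_infinity (principal {z. Im z \<le> 0}))"
      unfolding f_def
      by (intro tendsto_intros cauchy_transform_tendsto_0[OF w' \<alpha>] cauchy_transform_tendsto_0[OF bd \<alpha>])
    then show "(f \<longlongrightarrow> 0) (inf at_infinity (principal {z. Im z \<le> 0}))" by simp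
  qed simp
  then show ?thesis unfolding f_real of_real_eq_0_iff by simp
qed

end

section \<open>From the wave to the equation\<close>

context free_surface_flow
begin

lemma DG_cont: "continuous_on {z. Im z \<le> 0} (\<lambda>\<zeta>. D (G \<zeta>))"
  by (rule continuous_on_compose2[OF D_cont G_cont]) (auto intro: G_closure)

lemma G_below: "Im \<zeta> < 0 \<Longrightarrow> G \<zeta> \<in> subgraph h"
  using F_below[OF G_closure[of \<zeta>]] F_G[of \<zeta>] by simp

lemma DG_hol: "(\<lambda>\<zeta>. D (G \<zeta>)) holomorphic_on {z. Im z < 0}"
proof -
  have "G holomorphic_on {z. Im z < 0}"
    using G_deriv by (auto simp: holomorphic_on_open open_halfspace_Im_lt)
  from holomorphic_on_compose_gen[OF this D_hol] show ?thesis
    using G_below by (auto simp: o_def)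
qed

text \<open>
  On the real line \<open>Im G\<close> is \<open>w\<close>, and \<open>Im (G \<zeta> - \<zeta>)\<close> tends to \<open>0\<close> because the stream function is
  asymptotic to the height. The constant \<open>c\<close> reflects that the potential is determined only up to a
  real constant.
\<close>
lemma inverse_is_cauchy_transform:
  assumes w: "\<And>x. w x = Im (G (of_real x))" and \<alpha>: "0 < \<alpha>" and lw: "l2_holder \<alpha> w"
  obtains c where "\<And>\<zeta>. Im \<zeta> \<le> 0 \<Longrightarrow> G \<zeta> = \<zeta> + cauchy_transform w \<zeta> + of_real c"
proof -
  define f where "f \<zeta> = G \<zeta> - \<zeta> - cauchy_transform w \<zeta>" for \<zeta>
  obtain c where "\<And>\<zeta>. Im \<zeta> \<le> 0 \<Longrightarrow> f \<zeta> = of_real c"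
  proof (rule real_boundary_values_imp_constant[of f])
    have "G holomorphic_on {z. Im z < 0}"
      using G_deriv by (auto simp: holomorphic_on_open open_halfspace_Im_lt)
    then show "f holomorphic_on {z. Im z < 0}"
      unfolding f_def by (intro holomorphic_intros holomorphic_on_cauchy_transform[OF lw \<alpha>])
    show "continuous_on {z. Im z \<le> 0} f"
      unfolding f_def by (intro continuous_intros G_cont continuous_on_cauchy_transform[OF lw \<alpha>])
    show "Im (f (of_real x)) = 0" for x by (simp add: f_def w)
    have "((\<lambda>\<zeta>. Im (F (G \<zeta>)) - Im (G \<zeta>)) \<longlongrightarrow> 0) (inf at_infinity (principal {z. Im z \<le> 0}))"
    proof (rule filterlim_compose[OF F_asymp])
      show "filterlim G (inf at_infinity (principal (closure (subgraph h)))) (inf at_infinity (principal {z. Im z \<le> 0}))"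
        unfolding filterlim_inf filterlim_principal using G_proper
        by (auto simp: eventually_inf_principal intro!: always_eventually G_closure)
    qed
    then have "((\<lambda>\<zeta>. - (Im (F (G \<zeta>)) - Im (G \<zeta>)) - Im (cauchy_transform w \<zeta>)) \<longlongrightarrow> - 0 - Im 0) (inf at_infinity (principal {z. Im z \<le> 0}))"
      by (intro tendsto_intros cauchy_transform_tendsto_0[OF lw \<alpha>])
    moreover have "\<forall>\<^sub>F \<zeta> in inf at_infinity (principal {z. Im z \<le> 0}).
        - (Im (F (G \<zeta>)) - Im (G \<zeta>)) - Im (cauchy_transform w \<zeta>) = Im (f \<zeta>)"
      unfolding eventually_inf_principal by (intro always_eventually) (simp add: f_def F_G)
    ultimately show "((\<lambda>\<zeta>. Im (f \<zeta>)) \<longlongrightarrow> 0) (inf at_infinity (principal {z. Im z \<le> 0}))"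
      using Lim_transform_eventually by fastforce
  qed blast
  then have "\<And>\<zeta>. Im \<zeta> \<le> 0 \<Longrightarrow> G \<zeta> = \<zeta> + cauchy_transform w \<zeta> + of_real c"
    by (simp add: f_def algebra_simps)
  with that show ?thesis by blast
qed

lemma D_times_inverse_derivative:
  assumes w: "\<And>x. w x = Im (G (of_real x))" and \<alpha>: "0 < \<alpha>" and lw: "l2_holder \<alpha> w" "l2_holder \<alpha> w'"
    and deriv: "\<And>x. (w has_real_derivative w' x) (at x)" and \<zeta>: "Im \<zeta> \<le> 0"
  shows "D (G \<zeta>) * (1 + cauchy_transform w' \<zeta>) = 1"
proof -
  obtain c where c: "\<And>\<zeta>. Im \<zeta> \<le> 0 \<Longrightarrow> G \<zeta> = \<zeta> + cauchy_transform w \<zeta> + of_real c"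
    using inverse_is_cauchy_transform[OF w \<alpha> lw(1)] by blast
  have "D (G \<zeta>) * (1 + cauchy_transform w' \<zeta>) = 1" if \<zeta>: "Im \<zeta> < 0" for \<zeta>
  proof -
    have "((\<lambda>\<zeta>. \<zeta> + cauchy_transform w \<zeta> + of_real c) has_field_derivative 1 + cauchy_transform w' \<zeta> + 0) (at \<zeta>)"
      by (intro DERIV_add DERIV_ident DERIV_const DERIV_cauchy_transform_eq[OF lw(1) \<alpha> lw(2) deriv \<zeta>])
    then have "(G has_field_derivative 1 + cauchy_transform w' \<zeta> + 0) (at \<zeta>)"
      by (rule has_field_derivative_transform_within_open[OF _ open_halfspace_Im_lt[of 0]]) (use \<zeta> c in auto)
    from DERIV_unique[OF this G_deriv[OF \<zeta>]] have "1 + cauchy_transform w' \<zeta> = 1 / D (G \<zeta>)" by simp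
    moreover have "D (G \<zeta>) \<noteq> 0" using Re_D_pos[OF G_below[OF \<zeta>]] by auto
    ultimately show ?thesis by simp
  qed
  moreover have "continuous_on (closure {z. Im z < 0}) (\<lambda>\<zeta>. D (G \<zeta>) * (1 + cauchy_transform w' \<zeta>))"
    unfolding closure_lower by (intro continuous_intros DG_cont continuous_on_cauchy_transform[OF lw(2) \<alpha>])
  ultimately show ?thesis
    using continuous_constant_on_closure[of "{z. Im z < 0}" "\<lambda>\<zeta>. D (G \<zeta>) * (1 + cauchy_transform w' \<zeta>)" 1 \<zeta>] \<zeta>
    by (simp add: closure_lower)
qed

text \<open>
  On the line \<open>G'\<close> is \<open>1 + \<H>w' + i w'\<close> and \<open>D\<close> is its reciprocal. The sign of \<open>1 + \<H>w'\<close> is therefore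
  that of \<open>Re D\<close>, and the value of \<open>\<bar>D\<bar>\<close> is Bernoulli's condition.
\<close>
lemma surface_equations:
  assumes w: "\<And>x. w x = Im (G (of_real x))" and \<alpha>: "0 < \<alpha>" and lw: "l2_holder \<alpha> w" "l2_holder \<alpha> w'"
    and deriv: "\<And>x. (w has_real_derivative w' x) (at x)"
  shows "0 < 1 + hilbert w' x"
    and "(1 - 2 * \<mu> * w x) * ((1 + hilbert w' x)\<^sup>2 + (w' x)\<^sup>2) = 1"
    and "hilbert w' x = \<mu> * (w x + w x * hilbert w' x + hilbert (\<lambda>t. w t * w' t) x)"
proof -
  have both: "0 < 1 + hilbert w' x \<and> (1 - 2 * \<mu> * w x) * ((1 + hilbert w' x)\<^sup>2 + (w' x)\<^sup>2) = 1" for x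
  proof -
    let ?c = "Complex (1 + hilbert w' x) (w' x)"
    obtain t where t: "G (of_real x) = \<gamma> t"
    proof (rule surface_cases[OF G_closure[of "of_real x"]])
      show "G (of_real x) \<notin> subgraph h" using F_below[OF G_closure, of "of_real x"] F_G[of "of_real x"] by simp
    qed auto
    have wx: "w x = v t" by (simp add: w t)
    have "D (\<gamma> t) * (1 + cauchy_transform w' (of_real x)) = 1"
      using D_times_inverse_derivative[OF w \<alpha> lw deriv, of "of_real x"] by (simp add: t)
    moreover have "1 + cauchy_transform w' (of_real x) = ?c" by (simp add: complex_eq_iff)
    ultimately have Dc: "D (\<gamma> t) * ?c = 1" by simp
    then have "(norm (D (\<gamma> t) * ?c))\<^sup>2 = 1" by simp
    then have eq: "(1 - 2 * \<mu> * w x) * ((1 + hilbert w' x)\<^sup>2 + (w' x)\<^sup>2) = 1"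
      unfolding norm_mult power_mult_distrib bernoulli by (simp add: wx cmod_power2)
    have "D (\<gamma> t) * (?c * cnj ?c) = cnj ?c" using Dc by (simp only: mult.assoc[symmetric] mult_1_left)
    then have "D (\<gamma> t) * of_real ((norm ?c)\<^sup>2) = cnj ?c" by (simp only: complex_norm_square)
    then have "Re (D (\<gamma> t) * of_real ((norm ?c)\<^sup>2)) = Re (cnj ?c)" by (rule arg_cong)
    then have "Re (D (\<gamma> t)) * (norm ?c)\<^sup>2 = 1 + hilbert w' x" by (simp del: of_real_power)
    moreover have "?c \<noteq> 0" using Dc by auto
    ultimately have "0 < 1 + hilbert w' x"
      using Re_D_surface_pos[of t] by (metis mult_pos_pos zero_less_norm_iff zero_less_power)
    with eq show ?thesis by blast
  qed
  then show "0 < 1 + hilbert w' x"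
    and "(1 - 2 * \<mu> * w x) * ((1 + hilbert w' x)\<^sup>2 + (w' x)\<^sup>2) = 1" by auto
  show "hilbert w' x = \<mu> * (w x + w x * hilbert w' x + hilbert (\<lambda>t. w t * w' t) x)"
    by (rule bernoulli_imp_babenko[OF \<alpha> lw DG_hol DG_cont D_times_inverse_derivative[OF w \<alpha> lw deriv]])
      (use both in auto)
qed

end

lemma derivatives_of_Im:
  assumes "(f has_field_derivative f') (at z)"
  shows "((\<lambda>z. Im (f z)) has_derivative (\<lambda>t. Im (f' * t))) (at z)"
    and "dX (\<lambda>z. Im (f z)) z = Im f'" and "dY (\<lambda>z. Im (f z)) z = Re f'"
proof -
  show d: "((\<lambda>z. Im (f z)) has_derivative (\<lambda>t. Im (f' * t))) (at z)"
    using assms unfolding has_field_derivative_def by (rule bounded_linear.has_derivative[OF bounded_linear_Im])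
  show "dX (\<lambda>z. Im (f z)) z = Im f'" "dY (\<lambda>z. Im (f z)) z = Re f'"
    unfolding dX_def dY_def frechet_derivative_at[OF d, symmetric] by simp_all
qed

text \<open>
  By the Cauchy--Riemann equations; so the gradient of the stream function extends continuously to
  the closure iff the derivative of the potential does.
\<close>
lemma grad_of_Im:
  assumes "(f has_field_derivative f') (at z)"
  shows "grad (\<lambda>z. Im (f z)) z = \<i> * cnj f'"
  using derivatives_of_Im(2,3)[OF assms] by (simp add: grad_def complex_eq_iff)

text \<open>
  The gradient of \<open>\<psi>\<close> determines the derivative of the potential, so the latter extends continuously
  to the closure, and with it the potential itself. These extensions satisfy the assumptions of the
  locale, whose inverse potential gives \<open>w\<close>.
\<close>
theorem wave_to_babenko:
  assumes wave: "regular_solitary_wave u v \<mu> \<psi>" and F: "F = (\<lambda>Z. Complex (\<phi> Z) (\<psi> Z))"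
    and hol: "F holomorphic_on below u v" and w: "w = surface_elevation (below u v) F"
    and \<alpha>: "0 < \<alpha>" "\<alpha> < 1" and wH: "w \<in> H1 \<inter> C1_holder \<alpha>"
  shows "babenko \<mu> w \<and>
          conformal_bij_closure (ext_closure (below u v) F) (below u v) lower_half_plane \<and>
          maps_infinity_to_infinity (ext_closure (below u v) F) (closure (below u v)) \<and>
          (\<forall>x. (1 - 2 * \<mu> * w x) * ((1 + hilbert (deriv w) x)\<^sup>2 + (deriv w x)\<^sup>2) = 1) \<and>
          inf_slope_pos w"
proof -
  define \<Omega> where "\<Omega> = below u v"
  let ?\<gamma> = "\<lambda>x. Complex (u x) (v x)"
  note sw = wave[unfolded regular_solitary_wave_def solitary_wave_def Let_def, folded \<Omega>_def]
  obtain u' where u': "\<And>x. (u has_vector_derivative u' x) (at x)" "continuous_on UNIV u'"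
    using sw by (auto simp: C1_differentiable_on_def)
  obtain v' where v': "\<And>x. (v has_vector_derivative v' x) (at x)" "continuous_on UNIV v'"
    using sw by (auto simp: C1_differentiable_on_def)
  have du: "(u has_real_derivative u' x) (at x)" and dv: "(v has_real_derivative v' x) (at x)" for x
    using u' v' by (simp_all add: has_real_derivative_iff_has_vector_derivative)
  have u'pos: "0 < u' x" for x using sw DERIV_imp_deriv[OF du[of x]] by metis
  have lim: "((\<lambda>x. Complex (u x - x) (v x)) \<longlongrightarrow> 0) at_infinity" using sw by blast
  have u_asymp: "((\<lambda>x. u x - x) \<longlongrightarrow> 0) at_infinity" using tendsto_Re[OF lim] by simp
  have v_asymp: "(v \<longlongrightarrow> 0) at_infinity" using tendsto_Im[OF lim] by simp
  have cv: "continuous_on UNIV v" by (rule DERIV_continuous_on) (rule has_field_derivative_at_within[OF dv])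
  obtain h where h: "continuous_on UNIV h" "(h \<longlongrightarrow> 0) at_infinity" "\<And>x. h (u x) = v x"
    "\<Omega> = subgraph h" "\<And>X. \<exists>x. u x = X"
    using curve_is_graph[OF du u'pos cv u_asymp v_asymp] unfolding \<Omega>_def by blast
  have op: "open \<Omega>" unfolding h(4) by (rule open_subgraph[OF h(1)])
  define gr where "gr = ext_closure \<Omega> (grad \<psi>)"
  \<comment> \<open>The derivative of the potential in terms of the gradient of its imaginary part.\<close>
  define D where "D z = \<i> * cnj (gr z)" for z
  have cgr: "continuous_on (closure \<Omega>) gr" using sw by (simp add: C1_closure_def gr_def)
  have cD: "continuous_on (closure \<Omega>) D" unfolding D_def by (intro continuous_intros cgr)
  have \<psi>F: "(\<lambda>Z. Im (F Z)) = \<psi>" by (simp add: F)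
  have dF: "(F has_field_derivative D z) (at z)" if z: "z \<in> \<Omega>" for z
  proof -
    have "F field_differentiable at z" using hol z op unfolding \<Omega>_def by (metis holomorphic_on_imp_differentiable_at)
    then have d: "(F has_field_derivative deriv F z) (at z)" by (simp add: DERIV_deriv_iff_field_differentiable)
    have "gr z = grad \<psi> z" using z by (simp add: gr_def ext_closure_def)
    then have "D z = deriv F z" unfolding D_def using grad_of_Im[OF d] by (simp add: \<psi>F)
    with d show ?thesis by simp
  qed
  obtain F1 where F1: "continuous_on (closure \<Omega>) F1" "\<And>z. z \<in> \<Omega> \<Longrightarrow> F1 z = F z"
    using continuous_primitive_extension[OF h(1), of F D] dF cD unfolding h(4)[symmetric] by blast
  define E where "E = ext_closure \<Omega> F"
  have cE: "continuous_on (closure \<Omega>) E"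
    unfolding E_def by (rule continuous_on_ext_closure[OF F1(1)]) (simp add: F1(2))
  have EF: "E z = F z" if "z \<in> \<Omega>" for z using that by (simp add: E_def ext_closure_def)
  have dE: "(E has_field_derivative D z) (at z)" if "z \<in> \<Omega>" for z
    by (rule has_field_derivative_transform_within_open[OF dF[OF that] op that]) (simp add: EF)
  have c\<psi>: "continuous_on (closure \<Omega>) \<psi>" using sw by (simp add: C1_closure_def)
  have E\<psi>: "Im (E z) = \<psi> z" if "z \<in> closure \<Omega>" for z
  proof -
    have "Im (E z) - \<psi> z = 0"
      by (rule continuous_constant_on_closure[of \<Omega> "\<lambda>z. Im (E z) - \<psi> z"])
        (use cE c\<psi> that EF \<psi>F in \<open>auto intro!: continuous_intros simp: F\<close>)
    then show ?thesis by simp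
  qed
  have nt: "at (?\<gamma> x) within \<Omega> \<noteq> bot" and \<gamma>cl: "?\<gamma> x \<in> closure \<Omega>" for x
  proof -
    show cl: "?\<gamma> x \<in> closure \<Omega>" unfolding h(4) closure_subgraph[OF h(1)] by (simp add: h(3))
    have "?\<gamma> x \<notin> \<Omega>" unfolding h(4) subgraph_def by (simp add: h(3))
    then show "at (?\<gamma> x) within \<Omega> \<noteq> bot" using cl by (simp add: trivial_limit_within closure_def)
  qed
  have normD: "norm (D z) = norm (gr z)" for z by (simp add: D_def norm_mult)
  interpret free_surface_flow h E D u v u' v' \<mu>
  proof unfold_locales
    show "continuous_on UNIV h" "(h \<longlongrightarrow> 0) at_infinity" by fact+
    show "(E has_field_derivative D z) (at z)" if "z \<in> subgraph h" for z using dE[of z] that by (simp add: h(4))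
    show "continuous_on (closure (subgraph h)) E" "continuous_on (closure (subgraph h)) D" using cE cD by (simp_all add: h(4))
    show "Im (E z) = 0" if z: "Im z = h (Re z)" for z
    proof -
      obtain x where "u x = Re z" using h(5) by blast
      then have "z = ?\<gamma> x" using z h(3)[of x] by (simp add: complex_eq_iff)
      then show ?thesis using E\<psi>[OF \<gamma>cl[of x]] sw by simp
    qed
    have a: "((\<lambda>Z. \<psi> Z - Im Z) \<longlongrightarrow> 0) (inf at_infinity (principal (closure \<Omega>)))" using sw by blast
    show "((\<lambda>z. Im (E z) - Im z) \<longlongrightarrow> 0) (inf at_infinity (principal (closure (subgraph h))))"
      unfolding h(4)[symmetric]
      by (rule Lim_transform_eventually[OF a]) (simp add: eventually_inf_principal E\<psi>)
    show "D (?\<gamma> x) \<noteq> 0" for x using sw normD[of "?\<gamma> x"] by (metis gr_def norm_eq_zero less_irrefl)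
    show "(norm (D (?\<gamma> x)))\<^sup>2 = 1 - 2 * \<mu> * v x" for x
    proof -
      have "(gr \<longlongrightarrow> gr (?\<gamma> x)) (at (?\<gamma> x) within closure \<Omega>)" using cgr \<gamma>cl[of x] by (simp add: continuous_on_def)
      then have "(gr \<longlongrightarrow> gr (?\<gamma> x)) (at (?\<gamma> x) within \<Omega>)" by (rule tendsto_within_subset[OF _ closure_subset])
      then have "(grad \<psi> \<longlongrightarrow> gr (?\<gamma> x)) (at (?\<gamma> x) within \<Omega>)"
        by (rule Lim_transform_eventually) (simp add: eventually_at_filter gr_def ext_closure_def)
      then have "((\<lambda>Z. (norm (grad \<psi> Z))\<^sup>2 + 2 * \<mu> * v x) \<longlongrightarrow> (norm (gr (?\<gamma> x)))\<^sup>2 + 2 * \<mu> * v x) (at (?\<gamma> x) within \<Omega>)"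
        by (intro tendsto_intros)
      moreover have "((\<lambda>Z. (norm (grad \<psi> Z))\<^sup>2 + 2 * \<mu> * v x) \<longlongrightarrow> 1) (at (?\<gamma> x) within \<Omega>)" using sw by blast
      ultimately have "(norm (gr (?\<gamma> x)))\<^sup>2 + 2 * \<mu> * v x = 1" by (rule tendsto_unique[OF nt])
      then show ?thesis by (simp add: normD)
    qed
  qed (use du dv u'pos u' v' u_asymp v_asymp h in auto)
  have wG: "w x = Im (G (of_real x))" for x
    by (simp add: w surface_elevation_def E_def \<Omega>_def[symmetric] h(4))
  note wp = H1_C1_holder_regularity[OF wH \<alpha>]
  note eqs = surface_equations[OF wG \<alpha>(1) wp(2,3,1)]
  have Dcl: "ext_closure \<Omega> (deriv E) z = D z" if "z \<in> closure \<Omega>" for z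
    by (rule ext_closure_eq[OF cD _ that]) (simp add: DERIV_imp_deriv dE)
  have "babenko \<mu> w" unfolding babenko_def using eqs(3) by blast
  moreover have "conformal_bij_closure E \<Omega> lower_half_plane"
    unfolding conformal_bij_closure_def conformal_bij_def
  proof (intro conjI ballI)
    show "E holomorphic_on \<Omega>" using F_hol by (simp add: h(4))
    show "bij_betw E \<Omega> lower_half_plane" using F_bij by (simp add: h(4))
    show "bij_betw E (closure \<Omega>) (closure lower_half_plane)"
      using F_bij_closure by (simp add: h(4) lower_half_plane_simps)
    show "continuous_on (closure \<Omega>) (ext_closure \<Omega> (deriv E))"
      by (rule continuous_on_ext_closure[OF cD]) (simp add: DERIV_imp_deriv dE)
    show "ext_closure \<Omega> (deriv E) z \<noteq> 0" if "z \<in> closure \<Omega>" for z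
    proof -
      have "0 < Re (D z)" using Re_D_pos_closure[of z] that by (simp add: h(4))
      then show ?thesis unfolding Dcl[OF that] by auto
    qed
  qed (rule cE)
  moreover have "maps_infinity_to_infinity E (closure \<Omega>)" using F_proper by (simp add: h(4))
  moreover have "inf_slope_pos w" by (rule inf_slope_posI[OF wp(3) \<alpha>(1) eqs(1)])
  ultimately show ?thesis using eqs(2) unfolding E_def \<Omega>_def by blast
qed

section \<open>From the equation to the wave\<close>

lemma Im_of_holomorphic:
  assumes U: "open U" and f: "\<forall>z\<in>U. (f has_field_derivative f' z) (at z)" "continuous_on U f'"
    and \<psi>: "\<forall>z\<in>U. \<psi> z = Im (f z)"
  shows "C1_open U \<psi>" and "\<And>z. z \<in> U \<Longrightarrow> dX \<psi> z = Im (f' z)" and "\<And>z. z \<in> U \<Longrightarrow> dY \<psi> z = Re (f' z)"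
    and "\<And>z. z \<in> U \<Longrightarrow> grad \<psi> z = \<i> * cnj (f' z)"
proof -
  have d: "(\<psi> has_derivative (\<lambda>t. Im (f' z * t))) (at z)" if z: "z \<in> U" for z
    by (rule has_derivative_transform_within_open[OF derivatives_of_Im(1)[OF bspec[OF f(1) z]] U z]) (simp add: \<psi>)
  show dX: "dX \<psi> z = Im (f' z)" and dY: "dY \<psi> z = Re (f' z)" if "z \<in> U" for z
    unfolding dX_def dY_def frechet_derivative_at[OF d[OF that], symmetric] by simp_all
  show gr: "grad \<psi> z = \<i> * cnj (f' z)" if "z \<in> U" for z
    using dX[OF that] dY[OF that] by (simp add: grad_def complex_eq_iff)
  have "continuous_on U (\<lambda>z. \<i> * cnj (f' z))" by (intro continuous_intros f(2))
  then have "continuous_on U (grad \<psi>)" by (rule continuous_on_eq) (simp add: gr)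
  then show "C1_open U \<psi>" unfolding C1_open_def differentiable_def using d by blast
qed

lemma harmonic_Im_of_holomorphic:
  assumes U: "open U" and f: "f holomorphic_on U" and \<psi>: "\<forall>z\<in>U. \<psi> z = Im (f z)"
  shows "harmonic U \<psi>"
proof -
  have f': "deriv f holomorphic_on U" and f'': "deriv (deriv f) holomorphic_on U"
    using f U by (auto intro: holomorphic_deriv)
  have d1: "\<forall>z\<in>U. (f has_field_derivative deriv f z) (at z)"
    and d2: "\<forall>z\<in>U. (deriv f has_field_derivative deriv (deriv f) z) (at z)"
    using holomorphic_derivI[OF f U] holomorphic_derivI[OF f' U] by auto
  note 1 = Im_of_holomorphic[OF U d1 holomorphic_on_imp_continuous_on[OF f'] \<psi>]
  have \<psi>2: "\<forall>z\<in>U. dX \<psi> z = Im (deriv f z)" and \<psi>3: "\<forall>z\<in>U. dY \<psi> z = Im (\<i> * deriv f z)"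
    using 1(2,3) by simp_all
  note 2 = Im_of_holomorphic[OF U d2 holomorphic_on_imp_continuous_on[OF f''] \<psi>2]
  have d3: "\<forall>z\<in>U. ((\<lambda>z. \<i> * deriv f z) has_field_derivative \<i> * deriv (deriv f) z) (at z)"
    using d2 by (blast intro: DERIV_cmult)
  have c3: "continuous_on U (\<lambda>z. \<i> * deriv (deriv f) z)"
    by (intro continuous_intros holomorphic_on_imp_continuous_on[OF f''])
  note 3 = Im_of_holomorphic[OF U d3 c3 \<psi>3]
  show ?thesis
    unfolding harmonic_def C2_open_def using 1(1) 2(1) 3(1) 2(2) 3(3) by simp
qed

text \<open>
  \<open>w\<close> is the given solution of the equation; \<open>G\<close> below is the candidate for the inverse of the complex
  potential, and \<open>G'\<close> its derivative up to the boundary.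
\<close>
locale babenko_solution =
  fixes w :: "real \<Rightarrow> real" and \<alpha> \<mu> :: real
  assumes \<alpha>: "0 < \<alpha>" and w: "l2_holder \<alpha> w" and w': "l2_holder \<alpha> (deriv w)"
    and w_deriv: "\<And>x. (w has_real_derivative deriv w x) (at x)"
    and babenko: "babenko \<mu> w" and slope: "inf_slope_pos w"
begin

definition G :: "complex \<Rightarrow> complex" where "G \<zeta> = \<zeta> + cauchy_transform w \<zeta>"
definition G' :: "complex \<Rightarrow> complex" where "G' \<zeta> = 1 + cauchy_transform (deriv w) \<zeta>"

abbreviation u where "u x \<equiv> x + hilbert w x"
abbreviation \<Omega> where "\<Omega> \<equiv> below u w"

lemma G_deriv: "Im \<zeta> < 0 \<Longrightarrow> (G has_field_derivative G' \<zeta>) (at \<zeta>)"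
  unfolding G_def G'_def by (intro DERIV_add DERIV_ident DERIV_cauchy_transform_eq[OF w \<alpha> w' w_deriv])

lemma G_hol: "G holomorphic_on {z. Im z < 0}"
  using G_deriv by (auto simp: holomorphic_on_open open_halfspace_Im_lt)

lemma G_cont: "continuous_on {z. Im z \<le> 0} G"
  unfolding G_def by (intro continuous_intros continuous_on_cauchy_transform[OF w \<alpha>])

lemma G'_hol: "G' holomorphic_on {z. Im z < 0}"
  unfolding G'_def by (intro holomorphic_intros holomorphic_on_cauchy_transform[OF w' \<alpha>])

lemma G'_cont: "continuous_on {z. Im z \<le> 0} G'"
  unfolding G'_def by (intro continuous_intros continuous_on_cauchy_transform[OF w' \<alpha>])

lemma G_real: "G (of_real x) = Complex (u x) (w x)"
  and G'_real: "G' (of_real x) = Complex (1 + hilbert (deriv w) x) (deriv w x)"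
  by (simp_all add: G_def G'_def complex_eq_iff)

text \<open>
  The maximum principle for \<open>i (c - G')\<close>, whose imaginary part is \<open>c - Re G'\<close>. At infinity \<open>Re G'\<close>
  tends to \<open>1\<close>, hence the requirement \<open>c \<le> 1\<close>.
\<close>
lemma Re_G'_ge: obtains c where "c > 0" "\<And>\<zeta>. Im \<zeta> \<le> 0 \<Longrightarrow> c \<le> Re (G' \<zeta>)"
proof -
  obtain c0 where c0: "c0 > 0" "\<And>x. c0 \<le> 1 + hilbert (deriv w) x"
    using slope unfolding inf_slope_pos_def by blast
  define c where "c = min c0 1"
  have real: "c \<le> Re (G' z)" if "Im z = 0" for z
    using c0(2)[of "Re z"] G'_real[of "Re z"] that by (simp add: complex_is_Real_iff c_def min_le_iff_disj of_real_Re)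
  have "c \<le> Re (G' \<zeta>)" if \<zeta>: "Im \<zeta> < 0" for \<zeta>
  proof -
    have "Im (\<i> * (of_real c - G' \<zeta>)) \<le> 0"
    proof (rule Im_max_principle[of lower_half_plane "\<lambda>z. \<i> * (of_real c - G' z)"])
      show "\<exists>R. \<forall>z\<in>closure lower_half_plane. R \<le> norm z \<longrightarrow> Im (\<i> * (of_real c - G' z)) \<le> e" if "e > 0" for e
      proof -
        obtain R where R: "\<And>z. Im z \<le> 0 \<Longrightarrow> R \<le> norm z \<Longrightarrow> norm (cauchy_transform (deriv w) z - 0) < e"
          using cauchy_transform_tendsto_0[OF w' \<alpha>] \<open>e > 0\<close> unfolding tendsto_inf_at_infinity_iff by blast
        have "Im (\<i> * (of_real c - G' z)) \<le> e" if z: "Im z \<le> 0" "R \<le> norm z" for z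
        proof -
          have "c \<le> 1" by (simp add: c_def)
          moreover have "\<bar>Re (cauchy_transform (deriv w) z)\<bar> < e"
            using R[OF z] abs_Re_le_cmod[of "cauchy_transform (deriv w) z"] by simp
          ultimately have "c - (1 + Re (cauchy_transform (deriv w) z)) \<le> e" by linarith
          then show ?thesis by (simp add: G'_def)
        qed
        then show ?thesis unfolding lower_half_plane_simps by blast
      qed
      show "Im (\<i> * (of_real c - G' z)) \<le> 0" if "z \<in> frontier lower_half_plane" for z
        using that real[of z] by (simp add: lower_half_plane_simps)
      show "(\<lambda>z. \<i> * (of_real c - G' z)) holomorphic_on lower_half_plane"
        unfolding lower_half_plane_def by (intro holomorphic_intros G'_hol)
      show "continuous_on (closure lower_half_plane) (\<lambda>z. \<i> * (of_real c - G' z))"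
        unfolding lower_half_plane_simps by (intro continuous_intros G'_cont)
      show "\<zeta> \<in> lower_half_plane" using \<zeta> by (simp add: lower_half_plane_def)
    qed (rule lower_half_plane_simps)
    then show ?thesis by simp
  qed
  then have "c \<le> Re (G' \<zeta>)" if "Im \<zeta> \<le> 0" for \<zeta> using real[of \<zeta>] that by (cases "Im \<zeta> = 0") auto
  moreover have "c > 0" using c0(1) by (simp add: c_def)
  ultimately show ?thesis using that by blast
qed

lemma G'_nonzero: "Im \<zeta> \<le> 0 \<Longrightarrow> G' \<zeta> \<noteq> 0"
  using Re_G'_ge by (metis not_le zero_complex.sel(1))

text \<open>
  In the open half plane, which is convex, \<open>Re G' \<ge> c\<close> gives
  \<open>Re ((G b - G a) / (b - a)) \<ge> c\<close> by the mean value theorem on the segment. The inequality, freed of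
  its denominator, passes to boundary points by a downward shift.
\<close>
lemma G_inj: "inj_on G {z. Im z \<le> 0}"
proof (rule inj_onI)
  obtain c where c: "c > 0" "\<And>\<zeta>. Im \<zeta> \<le> 0 \<Longrightarrow> c \<le> Re (G' \<zeta>)" using Re_G'_ge by blast
  have interior: "c * (norm (b - a))\<^sup>2 \<le> Re ((G b - G a) * cnj (b - a))" if ab: "Im a < 0" "Im b < 0" for a b
  proof -
    let ?p = "\<lambda>t. a + of_real t * (b - a)"
    have below: "Im (?p t) < 0" if "0 \<le> t" "t \<le> 1" for t
    proof -
      have "?p t \<in> closed_segment a b"
        using that by (auto simp: in_segment algebra_simps scaleR_conv_of_real)
      then show ?thesis
        using closed_segment_subset[of a "{z. Im z < 0}" b] ab convex_halfspace_Im_lt[of 0] by auto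
    qed
    have d: "((\<lambda>t. Re (G (?p t) * cnj (b - a))) has_real_derivative Re (G' (?p t)) * (norm (b - a))\<^sup>2) (at t)"
      if "0 \<le> t" "t \<le> 1" for t
    proof -
      have "((\<lambda>t. ?p t) has_vector_derivative 0 + 1 * (b - a)) (at t)"
        by (intro has_vector_derivative_add has_vector_derivative_const has_vector_derivative_mult_left)
          (use has_vector_derivative_of_real[OF DERIV_ident] in auto)
      then have "((\<lambda>t. ?p t) has_vector_derivative (b - a)) (at t)" by simp
      from field_vector_diff_chain_at[OF this G_deriv[OF below[OF that]]]
      have "((\<lambda>t. G (?p t)) has_vector_derivative (b - a) * G' (?p t)) (at t)" by (simp add: o_def)
      then have "((\<lambda>t. G (?p t) * cnj (b - a)) has_vector_derivative (b - a) * G' (?p t) * cnj (b - a)) (at t)"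
        by (rule has_vector_derivative_mult_left)
      then have "((\<lambda>t. Re (G (?p t) * cnj (b - a))) has_vector_derivative Re ((b - a) * G' (?p t) * cnj (b - a))) (at t)"
        by (rule bounded_linear.has_vector_derivative[OF bounded_linear_Re])
      moreover have "(b - a) * G' (?p t) * cnj (b - a) = G' (?p t) * of_real ((norm (b - a))\<^sup>2)"
        by (simp only: complex_norm_square mult_ac)
      ultimately show ?thesis
        by (simp only: has_real_derivative_iff_has_vector_derivative times_complex.sel Re_complex_of_real Im_complex_of_real mult_zero_right diff_zero)
    qed
    obtain t where t: "0 < t" "t < 1"
      "Re (G (?p 1) * cnj (b - a)) - Re (G (?p 0) * cnj (b - a)) = (1 - 0) * (Re (G' (?p t)) * (norm (b - a))\<^sup>2)"
      using MVT2[of 0 1 "\<lambda>t. Re (G (?p t) * cnj (b - a))" "\<lambda>t. Re (G' (?p t)) * (norm (b - a))\<^sup>2"] d by auto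
    have "Re ((G b - G a) * cnj (b - a)) = Re (G (?p 1) * cnj (b - a)) - Re (G (?p 0) * cnj (b - a))"
      by (simp add: left_diff_distrib)
    also have "\<dots> = Re (G' (?p t)) * (norm (b - a))\<^sup>2" using t(3) by simp
    also have "\<dots> \<ge> c * (norm (b - a))\<^sup>2"
      using c(2)[of "?p t"] below[of t] t by (intro mult_right_mono) auto
    finally show ?thesis .
  qed
  fix a b assume ab: "a \<in> {z. Im z \<le> 0}" "b \<in> {z. Im z \<le> 0}" "G a = G b"
  let ?f = "\<lambda>\<delta>. Re ((G (b - \<i> * of_real \<delta>) - G (a - \<i> * of_real \<delta>)) * cnj (b - a))"
  have "c * (norm (b - a))\<^sup>2 \<le> ?f 0"
  proof (rule continuous_ge_on_closure[of "{0<..1}" ?f])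
    show "continuous_on (closure {0<..1}) ?f"
      using ab by (intro continuous_intros continuous_on_compose2[OF G_cont]) auto
    show "c * (norm (b - a))\<^sup>2 \<le> ?f \<delta>" if "\<delta> \<in> {0<..1}" for \<delta>
      using interior[of "a - \<i> * of_real \<delta>" "b - \<i> * of_real \<delta>"] that ab by simp
  qed simp
  also have "?f 0 = 0" using ab(3) by simp
  finally have "c * (norm (b - a))\<^sup>2 \<le> 0" .
  then show "a = b" using c(1) by (simp add: mult_le_0_iff)
qed

lemma cauchy_bound: obtains M where "M > 0" "\<And>\<zeta>. Im \<zeta> \<le> 0 \<Longrightarrow> norm (cauchy_transform w \<zeta>) \<le> M"
proof -
  have "(0::real) < 1" by simp
  then obtain R where R: "\<And>z. Im z \<le> 0 \<Longrightarrow> R \<le> norm z \<Longrightarrow> norm (cauchy_transform w z - 0) < 1"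
    using cauchy_transform_tendsto_0[OF w \<alpha>] unfolding tendsto_inf_at_infinity_iff by blast
  have "bounded (cauchy_transform w ` ({z. Im z \<le> 0} \<inter> cball 0 R))"
    by (intro compact_imp_bounded compact_continuous_image closed_Int_compact closed_halfspace_Im_le
        continuous_on_subset[OF continuous_on_cauchy_transform[OF w \<alpha>]]) auto
  then obtain b where b: "\<forall>z\<in>{z. Im z \<le> 0} \<inter> cball 0 R. norm (cauchy_transform w z) \<le> b"
    unfolding bounded_iff by auto
  have "norm (cauchy_transform w z) \<le> max b 1" if "Im z \<le> 0" for z
  proof (cases "R \<le> norm z")
    case True
    from R[OF that this] show ?thesis by simp
  next
    case False
    then have "norm (cauchy_transform w z) \<le> b" using b that by simp
    then show ?thesis by simp
  qed
  then show ?thesis using that[of "max b 1"] by auto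
qed

lemma G_proper: "maps_infinity_to_infinity G {z. Im z \<le> 0}"
  unfolding maps_infinity_to_infinity_def filterlim_at_infinity[OF order_refl] eventually_inf_principal eventually_at_infinity
proof (intro allI impI)
  fix r :: real assume "r > 0"
  obtain M where M: "M > 0" "\<And>\<zeta>. Im \<zeta> \<le> 0 \<Longrightarrow> norm (cauchy_transform w \<zeta>) \<le> M" using cauchy_bound by blast
  have "r \<le> norm (G z)" if "r + M \<le> norm z" "Im z \<le> 0" for z
    using norm_diff_ineq[of z "cauchy_transform w z"] M(2)[OF that(2)] that(1) by (simp add: G_def)
  then show "\<exists>b. \<forall>z. b \<le> norm z \<longrightarrow> z \<in> {z. Im z \<le> 0} \<longrightarrow> r \<le> norm (G z)" by blast
qed

lemma u_deriv: "(u has_real_derivative 1 + hilbert (deriv w) x) (at x)"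
proof -
  have "((\<lambda>t. G (of_real t)) has_vector_derivative G' (of_real x) * 1) (at x)"
  proof (rule FTC_along_boundary_curve[of "\<lambda>_. 0" G G' of_real "\<lambda>_. 1"])
    show "(G has_field_derivative G' z) (at z)" if "z \<in> subgraph (\<lambda>_. 0)" for z
      using that by (intro G_deriv) (simp add: subgraph_def)
    show "continuous_on (closure (subgraph (\<lambda>_. 0))) G" "continuous_on (closure (subgraph (\<lambda>_. 0))) G'"
      using G_cont G'_cont by (simp_all add: closure_subgraph)
    show "(complex_of_real has_vector_derivative 1) (at t)" for t
      using has_vector_derivative_of_real[OF DERIV_ident] by simp
  qed (auto simp: closure_subgraph)
  then have "((\<lambda>t. Re (G (of_real t))) has_vector_derivative Re (G' (of_real x) * 1)) (at x)"
    by (rule bounded_linear.has_vector_derivative[OF bounded_linear_Re])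
  then show ?thesis by (simp add: G_real G'_real has_real_derivative_iff_has_vector_derivative)
qed

lemma u_deriv_pos: "0 < 1 + hilbert (deriv w) x"
  using slope unfolding inf_slope_pos_def by (meson less_le_trans)

lemma surface_asymp: "((\<lambda>x. u x - x) \<longlongrightarrow> 0) at_infinity" "(w \<longlongrightarrow> 0) at_infinity"
  using hilbert_tendsto_0[OF w \<alpha>] l2_holder_tendsto_0[OF w \<alpha>] by simp_all

text \<open>
  The image of the closed half plane is closed, and it is the union of the curve and of the image \<open>I\<close> of
  the open half plane, which is open and disjoint from the curve. So a connected set that avoids the
  curve lies inside or outside of \<open>I\<close>. The domain below the curve meets \<open>I\<close>, since \<open>G\<close> is close to the
  identity at great depth; the domain above does not, since \<open>Im G\<close> is bounded above.
\<close>
lemma image_G: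
  shows G_image_below: "G ` {z. Im z < 0} = \<Omega>" and G_image_closure: "G ` {z. Im z \<le> 0} = closure \<Omega>"
    and \<Omega>_open: "open \<Omega>" and surface_in_closure: "\<And>x. Complex (u x) (w x) \<in> closure \<Omega> - \<Omega>"
proof -
  obtain h where "continuous_on UNIV h" "(h \<longlongrightarrow> 0) at_infinity" "\<And>x. h (u x) = w x" "\<Omega> = subgraph h" "\<And>X. \<exists>x. u x = X"
  proof (rule curve_is_graph[where u = "\<lambda>x. u x" and v = w,
        OF u_deriv u_deriv_pos l2_holder_continuous[OF w \<alpha>] surface_asymp])
  qed (rule that)
  then have h: "continuous_on UNIV h" "\<And>x. h (u x) = w x" "\<Omega> = subgraph h" "\<And>X. \<exists>x. u x = X"
    by auto
  show op: "open \<Omega>" unfolding h(3) by (rule open_subgraph[OF h(1)])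
  have clos: "closure \<Omega> = {z. Im z \<le> h (Re z)}" unfolding h(3) by (rule closure_subgraph[OF h(1)])
  show "Complex (u x) (w x) \<in> closure \<Omega> - \<Omega>" for x
  proof
    show "Complex (u x) (w x) \<in> closure \<Omega>" unfolding clos by (simp add: h(2))
    show "Complex (u x) (w x) \<notin> \<Omega>" unfolding h(3) subgraph_def by (simp add: h(2))
  qed
  define I where "I = G ` {z. Im z < 0}"
  have img: "G ` {z. Im z \<le> 0} = I \<union> {z. Im z = h (Re z)}"
  proof -
    have "{z::complex. Im z \<le> 0} = {z. Im z < 0} \<union> range of_real"
      by (auto simp: complex_is_Real_iff[symmetric] Reals_def order_le_less)
    moreover have "G ` range of_real = {z. Im z = h (Re z)}"
    proof (intro equalityI subsetI)
      fix z assume "z \<in> {z. Im z = h (Re z)}"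
      moreover obtain x where "u x = Re z" using h(4) by blast
      ultimately have "z = G (of_real x)" using h(2)[of x] by (simp add: G_real complex_eq_iff)
      then show "z \<in> G ` range of_real" by blast
    qed (auto simp: G_real h(2))
    ultimately show ?thesis by (simp add: I_def image_Un)
  qed
  have inj: "inj_on G {z. Im z < 0}" by (rule inj_on_subset[OF G_inj]) auto
  have oI: "open I" unfolding I_def by (rule open_mapping_thm3[OF G_hol open_halfspace_Im_lt inj])
  have disj: "Im z \<noteq> h (Re z)" if z: "z \<in> I" for z
  proof
    assume eq: "Im z = h (Re z)"
    obtain x where "u x = Re z" using h(4) by blast
    then have zx: "z = G (of_real x)" using eq h(2)[of x] by (simp add: G_real complex_eq_iff)
    obtain \<zeta> where \<zeta>: "Im \<zeta> < 0" "z = G \<zeta>" using z by (auto simp: I_def)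
    have "\<zeta> = of_real x" using G_inj zx \<zeta> by (auto dest: inj_onD)
    then show False using \<zeta>(1) by simp
  qed
  have cl: "closed (G ` {z. Im z \<le> 0})"
    by (rule closed_proper_image[OF closed_halfspace_Im_le G_cont G_proper])
  obtain M where M: "M > 0" "\<And>\<zeta>. Im \<zeta> \<le> 0 \<Longrightarrow> norm (cauchy_transform w \<zeta>) \<le> M" using cauchy_bound by blast
  have ImG: "\<bar>Im (G \<zeta>) - Im \<zeta>\<bar> \<le> M" if "Im \<zeta> \<le> 0" for \<zeta>
    using M(2)[OF that] abs_Im_le_cmod[of "cauchy_transform w \<zeta>"] by (simp add: G_def)
  obtain B where B: "B > 0" "\<And>x. \<bar>w x\<bar> \<le> B" using l2_holder_bound[OF w] by blast
  have hB: "\<bar>h X\<bar> \<le> B" for X using h(2,4) B(2) by metis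
  have dichotomy: "A \<subseteq> I" if A: "connected A" "A \<inter> {z. Im z = h (Re z)} = {}" "A \<inter> I \<noteq> {}" for A
  proof -
    have "I \<inter> - (G ` {z. Im z \<le> 0}) \<inter> A = {}" by (auto simp: img)
    moreover have "A \<subseteq> I \<union> - (G ` {z. Im z \<le> 0})" using A(2) by (auto simp: img)
    ultimately have "I \<inter> A = {} \<or> - (G ` {z. Im z \<le> 0}) \<inter> A = {}"
      using connectedD[OF A(1) oI] cl by (simp add: open_Compl)
    then show ?thesis using A(2,3) by (auto simp: img)
  qed
  have sub: "\<Omega> \<subseteq> I"
  proof (rule dichotomy)
    show "connected \<Omega>" unfolding h(3) by (rule connected_subgraph[OF h(1)])
    show "\<Omega> \<inter> {z. Im z = h (Re z)} = {}" unfolding h(3) subgraph_def by auto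
    define \<zeta> where "\<zeta> = Complex 0 (- (M + B + 1))"
    have \<zeta>: "Im \<zeta> < 0" using M(1) B(1) by (simp add: \<zeta>_def)
    have "Im (G \<zeta>) < h (Re (G \<zeta>))"
      using ImG[of \<zeta>] \<zeta> hB[of "Re (G \<zeta>)"] by (simp add: \<zeta>_def)
    then have "G \<zeta> \<in> \<Omega> \<inter> I" using \<zeta> by (simp add: h(3) subgraph_def I_def)
    then show "\<Omega> \<inter> I \<noteq> {}" by blast
  qed
  moreover have "I \<subseteq> \<Omega>"
  proof (rule ccontr)
    assume "\<not> I \<subseteq> \<Omega>"
    then obtain z where z: "z \<in> I" "\<not> Im z < h (Re z)" by (auto simp: h(3) subgraph_def)
    define A where "A = {z. h (Re z) < Im z}"
    have "A = uminus ` subgraph (\<lambda>x. - h (- x))"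
      by (auto simp: A_def subgraph_def intro!: image_eqI[of _ _ "- _"])
    \<comment> \<open>The domain above the curve is the reflection of a domain below a graph.\<close>
    moreover have "connected (subgraph (\<lambda>x. - h (- x)))"
      by (intro connected_subgraph continuous_intros continuous_on_compose2[OF h(1)]) auto
    ultimately have "connected A" by (auto intro!: connected_continuous_image continuous_intros)
    then have "A \<subseteq> I"
    proof (rule dichotomy)
      show "A \<inter> {z. Im z = h (Re z)} = {}" by (auto simp: A_def)
      have "z \<in> A" using z(2) disj[OF z(1)] by (simp add: A_def)
      with z(1) show "A \<inter> I \<noteq> {}" by blast
    qed
    moreover have "Complex 0 (M + B + 1) \<in> A" using hB[of 0] M(1) by (auto simp: A_def)
    ultimately obtain \<zeta> where "Im \<zeta> < 0" "Complex 0 (M + B + 1) = G \<zeta>" by (auto simp: I_def)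
    moreover from this have "Im (G \<zeta>) = M + B + 1" by (metis complex.sel(2))
    ultimately show False using ImG[of \<zeta>] B(1) by linarith
  qed
  ultimately show "G ` {z. Im z < 0} = \<Omega>" by (simp add: I_def)
  then show "G ` {z. Im z \<le> 0} = closure \<Omega>"
  proof -
    have "I = {z. Im z < h (Re z)}" using \<open>G ` {z. Im z < 0} = \<Omega>\<close> unfolding I_def h(3) subgraph_def .
    then show ?thesis unfolding img clos by auto
  qed
qed

definition \<Phi> :: "complex \<Rightarrow> complex" where "\<Phi> = inv_into {z. Im z \<le> 0} G"

lemma \<Phi>_G: "Im \<zeta> \<le> 0 \<Longrightarrow> \<Phi> (G \<zeta>) = \<zeta>"
  unfolding \<Phi>_def by (rule inv_into_f_f[OF G_inj]) simp

lemma G_\<Phi>: "Z \<in> closure \<Omega> \<Longrightarrow> G (\<Phi> Z) = Z" and \<Phi>_closure: "Z \<in> closure \<Omega> \<Longrightarrow> Im (\<Phi> Z) \<le> 0"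
  unfolding \<Phi>_def G_image_closure[symmetric] by (auto intro: f_inv_into_f inv_into_into[of _ G "{z. Im z \<le> 0}", simplified])

lemma \<Phi>_below: "Z \<in> \<Omega> \<Longrightarrow> Im (\<Phi> Z) < 0"
  using \<Phi>_G unfolding G_image_below[symmetric] by auto

lemma \<Phi>_cont: "continuous_on (closure \<Omega>) \<Phi>"
  unfolding \<Phi>_def G_image_closure[symmetric]
  by (rule continuous_on_inv_into_proper[OF closed_halfspace_Im_le G_cont G_inj G_proper])

lemma \<Phi>_deriv: assumes Z: "Z \<in> \<Omega>" shows "(\<Phi> has_field_derivative 1 / G' (\<Phi> Z)) (at Z)"
proof -
  have inj: "inj_on G {z. Im z < 0}" by (rule inj_on_subset[OF G_inj]) auto
  obtain g where g: "g holomorphic_on \<Omega>"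
    "\<And>z. Im z < 0 \<Longrightarrow> deriv G z * deriv g (G z) = 1" "\<And>z. Im z < 0 \<Longrightarrow> g (G z) = z"
    using holomorphic_has_inverse[OF G_hol open_halfspace_Im_lt inj] unfolding G_image_below by auto
  have ZG: "Z = G (\<Phi> Z)" using G_\<Phi> Z closure_subset by (metis subsetD)
  have eq: "g Z = \<Phi> Z" if "Z \<in> \<Omega>" for Z
    using g(3)[OF \<Phi>_below[OF that]] G_\<Phi>[of Z] that closure_subset[of \<Omega>] by auto
  have "(g has_field_derivative deriv g Z) (at Z)" by (rule holomorphic_derivI[OF g(1) \<Omega>_open Z])
  then have "(\<Phi> has_field_derivative deriv g Z) (at Z)"
    by (rule has_field_derivative_transform_within_open[OF _ \<Omega>_open Z]) (simp add: eq)
  moreover have "G' (\<Phi> Z) * deriv g Z = 1"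
    using g(2)[OF \<Phi>_below[OF Z]] DERIV_imp_deriv[OF G_deriv[OF \<Phi>_below[OF Z]]] ZG by simp
  then have "deriv g Z = 1 / G' (\<Phi> Z)" by (metis mult_not_zero nonzero_mult_div_cancel_left zero_neq_one)
  ultimately show ?thesis by simp
qed

lemma \<Phi>_hol: "\<Phi> holomorphic_on \<Omega>"
  using \<Phi>_deriv \<Omega>_open by (auto simp: holomorphic_on_open)

lemma \<Phi>_conformal: "conformal_bij \<Phi> \<Omega> lower_half_plane"
  unfolding conformal_bij_def
proof
  show "bij_betw \<Phi> \<Omega> lower_half_plane"
  proof (rule bij_betw_byWitness[where f' = G])
    show "\<forall>Z\<in>\<Omega>. G (\<Phi> Z) = Z" using G_\<Phi> closure_subset by blast
    show "\<forall>\<zeta>\<in>lower_half_plane. \<Phi> (G \<zeta>) = \<zeta>" by (simp add: \<Phi>_G lower_half_plane_def)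
    show "\<Phi> ` \<Omega> \<subseteq> lower_half_plane" using \<Phi>_below by (auto simp: lower_half_plane_def)
    show "G ` lower_half_plane \<subseteq> \<Omega>" by (simp add: G_image_below lower_half_plane_def)
  qed
qed (rule \<Phi>_hol)

lemma \<Phi>_at_infinity: "filterlim \<Phi> (inf at_infinity (principal {z. Im z \<le> 0})) (inf at_infinity (principal (closure \<Omega>)))"
  unfolding filterlim_inf filterlim_principal
proof
  show "\<forall>\<^sub>F Z in inf at_infinity (principal (closure \<Omega>)). \<Phi> Z \<in> {z. Im z \<le> 0}"
    unfolding eventually_inf_principal by (intro always_eventually) (simp add: \<Phi>_closure)
  show "filterlim \<Phi> at_infinity (inf at_infinity (principal (closure \<Omega>)))"
    unfolding filterlim_at_infinity[OF order_refl] eventually_inf_principal eventually_at_infinity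
  proof (intro allI impI)
    fix r :: real assume "r > 0"
    obtain M where M: "M > 0" "\<And>\<zeta>. Im \<zeta> \<le> 0 \<Longrightarrow> norm (cauchy_transform w \<zeta>) \<le> M" using cauchy_bound by blast
    have "r \<le> norm (\<Phi> Z)" if Z: "r + M \<le> norm Z" "Z \<in> closure \<Omega>" for Z
    proof -
      have "Z = \<Phi> Z + cauchy_transform w (\<Phi> Z)" using G_\<Phi>[OF Z(2)] by (simp add: G_def)
      then show ?thesis
        using norm_triangle_ineq[of "\<Phi> Z" "cauchy_transform w (\<Phi> Z)"] M(2)[OF \<Phi>_closure[OF Z(2)]] Z(1) by simp
    qed
    then show "\<exists>b. \<forall>Z. b \<le> norm Z \<longrightarrow> Z \<in> closure \<Omega> \<longrightarrow> r \<le> norm (\<Phi> Z)" by blast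
  qed
qed

lemma bernoulli: "(1 - 2 * \<mu> * w x) * ((1 + hilbert (deriv w) x)\<^sup>2 + (deriv w x)\<^sup>2) = 1"
  by (rule babenko_imp_bernoulli[OF \<alpha> w w']) (use babenko in \<open>auto simp: babenko_def\<close>)

text \<open>
  The derivative of \<open>\<Phi>\<close> is \<open>E = 1 / G' \<circ> \<Phi>\<close>, which is continuous on the closure. It determines the
  gradient of the stream function there. The asymptotics come from
  \<open>Im (\<Phi> Z) - Im Z = - Im (S w (\<Phi> Z))\<close>.
\<close>
theorem regular_wave: "regular_solitary_wave u w \<mu> (ext_closure \<Omega> (\<lambda>Z. Im (\<Phi> Z)))"
proof -
  define \<psi> where "\<psi> = ext_closure \<Omega> (\<lambda>Z. Im (\<Phi> Z))"
  define E where "E Z = 1 / G' (\<Phi> Z)" for Z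
  let ?\<gamma> = "\<lambda>x. Complex (u x) (w x)"
  have c\<psi>: "continuous_on (closure \<Omega>) (\<lambda>Z. Im (\<Phi> Z))" by (intro continuous_intros \<Phi>_cont)
  have \<psi>cl: "\<psi> Z = Im (\<Phi> Z)" if "Z \<in> closure \<Omega>" for Z
    unfolding \<psi>_def by (rule ext_closure_eq[OF c\<psi> refl that])
  have \<psi>: "\<psi> Z = Im (\<Phi> Z)" if "Z \<in> \<Omega>" for Z
    using \<psi>cl[OF subsetD[OF closure_subset that]] .
  have \<psi>': "\<forall>Z\<in>\<Omega>. \<psi> Z = Im (\<Phi> Z)" and d\<Phi>: "\<forall>Z\<in>\<Omega>. (\<Phi> has_field_derivative E Z) (at Z)"
    using \<psi> \<Phi>_deriv by (simp_all add: E_def)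
  have cE: "continuous_on (closure \<Omega>) E"
    unfolding E_def using G'_nonzero \<Phi>_closure
    by (intro continuous_intros continuous_on_compose2[OF G'_cont \<Phi>_cont]) auto
  have cE': "continuous_on \<Omega> E" by (rule continuous_on_subset[OF cE closure_subset])
  note Im = Im_of_holomorphic[OF \<Omega>_open d\<Phi> cE' \<psi>']
  have cgr: "continuous_on (closure \<Omega>) (\<lambda>Z. \<i> * cnj (E Z))" by (intro continuous_intros cE)
  note gr = ext_closure_eq[OF cgr Im(4)]
  have \<Phi>\<gamma>: "\<Phi> (?\<gamma> x) = of_real x" for x
    using \<Phi>_G[of "of_real x"] by (simp add: G_real)
  have E\<gamma>: "(norm (E (?\<gamma> x)))\<^sup>2 = 1 - 2 * \<mu> * w x" for x
  proof -
    let ?N = "(1 + hilbert (deriv w) x)\<^sup>2 + (deriv w x)\<^sup>2"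
    have "(norm (E (?\<gamma> x)))\<^sup>2 = 1 / ?N"
      by (simp add: E_def \<Phi>\<gamma> G'_real norm_divide power_divide cmod_power2)
    also have "\<dots> = 1 - 2 * \<mu> * w x"
      using bernoulli[of x] by (metis mult_not_zero nonzero_mult_div_cancel_right zero_neq_one)
    finally show ?thesis .
  qed
  have \<gamma>cl: "?\<gamma> x \<in> closure \<Omega>" for x using surface_in_closure by blast
  have harm: "harmonic \<Omega> \<psi>" by (rule harmonic_Im_of_holomorphic[OF \<Omega>_open \<Phi>_hol \<psi>'])
  have "solitary_wave u w \<mu> \<psi>"
    unfolding solitary_wave_def Let_def
  proof (intro conjI allI)
    show "u C1_differentiable_on UNIV"
      unfolding C1_differentiable_on_def
      by (intro exI[of _ "\<lambda>x. 1 + hilbert (deriv w) x"] conjI continuous_intros continuous_on_hilbert[OF w' \<alpha>])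
        (use u_deriv in \<open>auto simp: has_real_derivative_iff_has_vector_derivative\<close>)
    show "w C1_differentiable_on UNIV"
      unfolding C1_differentiable_on_def
      by (intro exI[of _ "deriv w"] conjI l2_holder_continuous[OF w' \<alpha>])
        (use w_deriv in \<open>auto simp: has_real_derivative_iff_has_vector_derivative\<close>)
    show "0 < deriv u x" for x using u_deriv_pos[of x] by (simp add: DERIV_imp_deriv[OF u_deriv])
    have "((\<lambda>x. Complex (u x - x) (w x)) \<longlongrightarrow> Complex 0 0) at_infinity"
      by (intro tendsto_Complex surface_asymp)
    then show "((\<lambda>x. Complex (u x - x) (w x)) \<longlongrightarrow> 0) at_infinity" by (simp add: zero_complex.code)
    show "C1_closure \<Omega> \<psi>"
      unfolding C1_closure_def
      using Im(1) continuous_on_eq[OF c\<psi> \<psi>cl[symmetric]] continuous_on_ext_closure[OF cgr Im(4)] by blast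
    show "C2_open \<Omega> \<psi>" using harm by (simp add: harmonic_def)
    show "\<psi> (?\<gamma> x) = 0" for x using \<psi>cl[OF \<gamma>cl[of x]] by (simp add: \<Phi>\<gamma>)
    have "((\<lambda>Z. - Im (cauchy_transform w (\<Phi> Z))) \<longlongrightarrow> - Im 0) (inf at_infinity (principal (closure \<Omega>)))"
      by (intro tendsto_intros filterlim_compose[OF cauchy_transform_tendsto_0[OF w \<alpha>] \<Phi>_at_infinity])
    moreover have "- Im (cauchy_transform w (\<Phi> Z)) = \<psi> Z - Im Z" if "Z \<in> closure \<Omega>" for Z
      using arg_cong[OF G_\<Phi>[OF that], of Im] by (simp add: G_def \<psi>cl[OF that])
    then have "\<forall>\<^sub>F Z in inf at_infinity (principal (closure \<Omega>)). - Im (cauchy_transform w (\<Phi> Z)) = \<psi> Z - Im Z"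
      by (simp add: eventually_inf_principal)
    ultimately show "((\<lambda>Z. \<psi> Z - Im Z) \<longlongrightarrow> 0) (inf at_infinity (principal (closure \<Omega>)))"
      using Lim_transform_eventually by fastforce
    show "((\<lambda>Z. (norm (grad \<psi> Z))\<^sup>2 + 2 * \<mu> * w x) \<longlongrightarrow> 1) (at (?\<gamma> x) within \<Omega>)" for x
    proof -
      have "(E \<longlongrightarrow> E (?\<gamma> x)) (at (?\<gamma> x) within closure \<Omega>)" using cE \<gamma>cl[of x] by (simp add: continuous_on_def)
      then have "(E \<longlongrightarrow> E (?\<gamma> x)) (at (?\<gamma> x) within \<Omega>)" by (rule tendsto_within_subset[OF _ closure_subset])
      then have "((\<lambda>Z. (norm (E Z))\<^sup>2 + 2 * \<mu> * w x) \<longlongrightarrow> (norm (E (?\<gamma> x)))\<^sup>2 + 2 * \<mu> * w x) (at (?\<gamma> x) within \<Omega>)"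
        by (intro tendsto_intros)
      then have "((\<lambda>Z. (norm (E Z))\<^sup>2 + 2 * \<mu> * w x) \<longlongrightarrow> 1) (at (?\<gamma> x) within \<Omega>)" by (simp add: E\<gamma>)
      then show ?thesis
        by (rule Lim_transform_eventually) (simp add: eventually_at_filter Im(4) norm_mult)
    qed
  qed (rule harm)
  moreover have "0 < norm (ext_closure \<Omega> (grad \<psi>) (?\<gamma> x))" for x
  proof -
    have "E (?\<gamma> x) \<noteq> 0" using G'_nonzero[OF \<Phi>_closure[OF \<gamma>cl[of x]]] by (simp add: E_def)
    then show ?thesis by (simp add: gr[OF _ \<gamma>cl] norm_mult)
  qed
  ultimately show ?thesis unfolding regular_solitary_wave_def \<psi>_def by blast
qed

end

theorem proposition2p4:
  shows
    "(\<forall>u v \<mu> \<psi> \<phi> F w \<alpha>.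
        regular_solitary_wave u v \<mu> \<psi> \<longrightarrow>
        F = (\<lambda>Z. Complex (\<phi> Z) (\<psi> Z)) \<longrightarrow>
        F holomorphic_on below u v \<longrightarrow>
        w = surface_elevation (below u v) F \<longrightarrow>
        0 < \<alpha> \<longrightarrow> \<alpha> < 1 \<longrightarrow> w \<in> H1 \<inter> C1_holder \<alpha> \<longrightarrow>
          babenko \<mu> w \<and>
          conformal_bij_closure (ext_closure (below u v) F) (below u v) lower_half_plane \<and>
          maps_infinity_to_infinity (ext_closure (below u v) F) (closure (below u v)) \<and>
          (\<forall>x. (1 - 2 * \<mu> * w x) * ((1 + hilbert (deriv w) x)\<^sup>2 + (deriv w x)\<^sup>2) = 1) \<and>
          inf_slope_pos w)
     \<and>
     (\<forall>w \<alpha> \<mu> u \<Omega>.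
        0 < \<alpha> \<longrightarrow> \<alpha> < 1 \<longrightarrow> w \<in> H1 \<inter> C1_holder \<alpha> \<longrightarrow>
        babenko \<mu> w \<longrightarrow> inf_slope_pos w \<longrightarrow>
        u = (\<lambda>x. x + hilbert w x) \<longrightarrow> \<Omega> = below u w \<longrightarrow>
          (\<exists>\<Phi>. conformal_bij \<Phi> \<Omega> lower_half_plane \<and>
               regular_solitary_wave u w \<mu> (ext_closure \<Omega> (\<lambda>Z. Im (\<Phi> Z)))))"
proof ((rule conjI; intro allI impI), goal_cases)
  case (1 u v \<mu> \<psi> \<phi> F w \<alpha>)
  then show ?case by (rule wave_to_babenko)
next
  case (2 w \<alpha> \<mu> u \<Omega>)
  note regularity = H1_C1_holder_regularity[OF 2(3,1,2)]
  interpret babenko_solution w \<alpha> \<mu>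
    by unfold_locales (use regularity 2 in auto)
  show ?case unfolding 2(6,7) using \<Phi>_conformal regular_wave by blast
qed

end
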